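(* Let $X^e,X^v$ be the perturbative series in the completed algebra $\widehat{\mathcal{H}}_{CK}$, $X^e=\mathbb{1}-\sum_GG$ over all labelled 2-point generating ribbon graphs, $X^v=v+\sum_GG$ over all labelled 4-point generating ribbon graphs $G\neq v$. Let $f(X^v,X^e)=\frac{(X^v)^{n_1}}{(X^e)^{n_2}}$, $n_1,n_2\in\mathbb{Z}_{\ge0}$, be any monomial in $X^v$ and $1/X^e$. Then $$\Delta\bigl(f(X^v,X^e)\bigr)=\sum_{k\ge0}f(X^v,X^e)\left(\frac{X^v}{(X^e)^2}\right)^k\otimes f(X^v,X^e)_k,$$ where $(Y)_k$ denotes the component of loop order $k$ of a series $Y$.
   Context: A ribbon graph is a triple $G=(\mathcal{H},\sigma,\alpha)$ of a finite set $\mathcal{H}$ of half edges, a permutation $\sigma$ and an involution $\alpha$ of $\mathcal{H}$ (fixed points allowed). Cycles of $\sigma$ are vertices (degree = length), 2-cycles of $\alpha$ are internal edges, fixed points of $\alpha$ are external half edges. A cycle of $\sigma^{-1}\circ\alpha$ is an internal face if it contains no external half edge, otherwise a boundary, whose length is its number of external half edges. $F_G$ is the number of internal faces ("loop order"). $G$ is connected if $\langle\sigma,\alpha\rangle$ is transitive; its genus $g$ is given by $2-2g=|\mathcal{C}(\sigma)|-|\{\text{internal edges}\}|+|\mathcal{C}(\sigma^{-1}\alpha)|$, with $\mathcal{C}(\cdot)$ the set of cycles. Bridgeless: cutting any one internal edge does not disconnect a component. The $n$-point generating graphs ($n=2,4$) are the connected bridgeless ribbon graphs of genus $0$ with exactly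 one boundary, of length $n$, and all vertices of degree 4; the single vertex $v$ without internal edges is a 4-point one. A labelled graph is one together with a distinguished external half edge, up to isomorphisms (bijections intertwining $\sigma$ and $\alpha$) preserving it. $\mathcal{H}_{CK}$ is the commutative $\mathbb{Q}$-algebra freely generated by the isomorphism classes (forgetting labels) of 2- and 4-point generating graphs, $v$ included as a generator; product = disjoint union, $\mathbb{1}$ = empty graph = open edge. It is graded by $F$ (additive on disjoint unions); $\widehat{\mathcal{H}}_{CK}$ is the completion (product of graded pieces), and tensor products are completed accordingly with respect to total degree. Sums over labelled graphs are understood by sending each labelled graph to its class. $1/X^e=\sum_{m\ge0}(\mathbb{1}-X^e)^m$. $H=(\mathcal{H},\sigma,\alpha')\subset G$ is a ribbon subgraph iff the 2-cycles of $\alpha'$ are among those of $\alpha$. $G/H$ has as half edges the fixed points of $\alpha'$, as vertex cycles those of $\alpha'\circ\sigma$ with all other half edges deleted, and as involution the restriction of $\alpha$. $\pi$ deletes all bivalent vertices, merging adjacent edges (an open edge so obtained is $\mathbb{1}$). The coproduct is $\Delta(G)=\sum_{H}H\otimes\pi(G/H)$ over all $H\subset G$ all of whose components are generators (components $v$ allowed), extended linearly and continuously; it is multiplicative. *)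

theory Defs
  imports
    "HOL-Combinatorics.Orbits"
    "HOL-Library.Multiset"
    "HOL-Library.Poly_Mapping"
    "HOL-Library.Product_Plus"
    "HOL-Computational_Algebra.Formal_Power_Series"
begin

section \<open>Ribbon graphs\<close>

record 'a ribbon_graph =
  half_edges :: "'a set"
  vperm :: "'a \<Rightarrow> 'a"
  einv :: "'a \<Rightarrow> 'a"

definition ribbon_graph :: "'a ribbon_graph \<Rightarrow> bool" where
  "ribbon_graph G \<longleftrightarrow>
     finite (half_edges G) \<and> vperm G permutes half_edges G \<and>
     einv G permutes half_edges G \<and> (\<forall>x. einv G (einv G x) = x)"

text \<open>A cycle of a permutation is represented by its underlying set; fixed points count as
  cycles of length one.\<close>

definition cycles :: "'a set \<Rightarrow> ('a \<Rightarrow> 'a) \<Rightarrow> 'a set set" where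
  "cycles A p = orbit p ` A"

definition vertices :: "'a ribbon_graph \<Rightarrow> 'a set set" where
  "vertices G = cycles (half_edges G) (vperm G)"

definition internal_edges :: "'a ribbon_graph \<Rightarrow> 'a set set" where
  "internal_edges G = {{x, einv G x} | x. x \<in> half_edges G \<and> einv G x \<noteq> x}"

definition external :: "'a ribbon_graph \<Rightarrow> 'a set" where
  "external G = {x \<in> half_edges G. einv G x = x}"

definition faces :: "'a ribbon_graph \<Rightarrow> 'a set set" where
  "faces G = cycles (half_edges G) (inv (vperm G) \<circ> einv G)"

definition internal_faces :: "'a ribbon_graph \<Rightarrow> 'a set set" where
  "internal_faces G = {c \<in> faces G. c \<inter> external G = {}}"

definition boundaries :: "'a ribbon_graph \<Rightarrow> 'a set set" where
  "boundaries G = {c \<in> faces G. c \<inter> external G \<noteq> {}}"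

definition boundary_length :: "'a ribbon_graph \<Rightarrow> 'a set \<Rightarrow> nat" where
  "boundary_length G c = card (c \<inter> external G)"

definition loop_order :: "'a ribbon_graph \<Rightarrow> nat" where
  "loop_order G = card (internal_faces G)"

text \<open>Two half edges are related iff they lie in the same orbit of the group generated by
  \<^term>\<open>vperm G\<close> and \<^term>\<open>einv G\<close>.\<close>

definition same_component :: "'a ribbon_graph \<Rightarrow> ('a \<times> 'a) set" where
  "same_component G =
     (let R = {(x, vperm G x) | x. x \<in> half_edges G} \<union> {(x, einv G x) | x. x \<in> half_edges G}
      in (R \<union> R\<inverse>)\<^sup>*)"

definition connected_graph :: "'a ribbon_graph \<Rightarrow> bool" where
  "connected_graph G \<longleftrightarrow>
     (\<forall>x \<in> half_edges G. \<forall>y \<in> half_edges G. (x, y) \<in> same_component G)"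

definition components :: "'a ribbon_graph \<Rightarrow> 'a set set" where
  "components G = (\<lambda>x. same_component G `` {x}) ` half_edges G"

definition induced_graph :: "'a ribbon_graph \<Rightarrow> 'a set \<Rightarrow> 'a ribbon_graph" where
  "induced_graph G C =
     \<lparr>half_edges = C, vperm = perm_restrict (vperm G) C, einv = perm_restrict (einv G) C\<rparr>"

text \<open>The genus is rational-valued, so that no rounding can occur.\<close>

definition genus :: "'a ribbon_graph \<Rightarrow> rat" where
  "genus G =
     (2 - (of_nat (card (vertices G)) - of_nat (card (internal_edges G))
           + of_nat (card (faces G)))) / 2"

text \<open>Cutting the internal edge containing \<open>x\<close> turns its two halves into external half edges.\<close>

definition cut_edge :: "'a ribbon_graph \<Rightarrow> 'a \<Rightarrow> 'a ribbon_graph" where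
  "cut_edge G x = G\<lparr>einv := (einv G)(x := x, einv G x := einv G x)\<rparr>"

definition bridgeless :: "'a ribbon_graph \<Rightarrow> bool" where
  "bridgeless G \<longleftrightarrow>
     (\<forall>x \<in> half_edges G. einv G x \<noteq> x \<longrightarrow> components (cut_edge G x) = components G)"

definition n_point_generating :: "nat \<Rightarrow> 'a ribbon_graph \<Rightarrow> bool" where
  "n_point_generating n G \<longleftrightarrow>
     ribbon_graph G \<and> connected_graph G \<and> bridgeless G \<and> genus G = 0 \<and>
     (\<exists>b. boundaries G = {b} \<and> boundary_length G b = n) \<and>
     (\<forall>c \<in> vertices G. card c = 4)"

definition generating :: "'a ribbon_graph \<Rightarrow> bool" where
  "generating G \<longleftrightarrow> n_point_generating 2 G \<or> n_point_generating 4 G"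

definition graph_iso ::
    "('a \<Rightarrow> 'b) \<Rightarrow> 'a ribbon_graph \<Rightarrow> 'b ribbon_graph \<Rightarrow> bool" where
  "graph_iso \<phi> G G' \<longleftrightarrow>
     bij_betw \<phi> (half_edges G) (half_edges G') \<and>
     (\<forall>x \<in> half_edges G. \<phi> (vperm G x) = vperm G' (\<phi> x) \<and> \<phi> (einv G x) = einv G' (\<phi> x))"

definition isomorphic :: "'a ribbon_graph \<Rightarrow> 'b ribbon_graph \<Rightarrow> bool" where
  "isomorphic G G' \<longleftrightarrow> (\<exists>\<phi>. graph_iso \<phi> G G')"


section \<open>Generators\<close>

text \<open>Half edges are finite in number, so every isomorphism class has a representative whose
  half edges are natural numbers.\<close>

definition vertex_graph :: "nat ribbon_graph" where
  "vertex_graph =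
     \<lparr>half_edges = {..<4}, vperm = (\<lambda>i. if i < 4 then (i + 1) mod 4 else i), einv = id\<rparr>"

definition generator_rel :: "nat ribbon_graph \<Rightarrow> nat ribbon_graph \<Rightarrow> bool" where
  "generator_rel G G' \<longleftrightarrow> generating G \<and> generating G' \<and> isomorphic G G'"

lemma isomorphic_refl: "isomorphic G G"
  unfolding isomorphic_def graph_iso_def by (rule exI[of _ id]) auto

lemma graph_iso_inv:
  assumes "graph_iso \<phi> G G'" "ribbon_graph G"
  shows "graph_iso (inv_into (half_edges G) \<phi>) G' G"
proof -
  let ?H = "half_edges G" and ?H' = "half_edges G'"
  let ?\<psi> = "inv_into ?H \<phi>"
  have b: "bij_betw \<phi> ?H ?H'" using assms unfolding graph_iso_def by blast
  have cl: "vperm G x \<in> ?H" "einv G x \<in> ?H" if "x \<in> ?H" for x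
    using that assms(2) unfolding ribbon_graph_def by (auto simp: permutes_in_image)
  have "?\<psi> (vperm G' y) = vperm G (?\<psi> y) \<and> ?\<psi> (einv G' y) = einv G (?\<psi> y)"
    if y: "y \<in> ?H'" for y
  proof -
    define x where "x = ?\<psi> y"
    have x: "x \<in> ?H" and xy: "\<phi> x = y"
      unfolding x_def using b y by (auto simp: bij_betw_def inv_into_into f_inv_into_f)
    have "vperm G' y = \<phi> (vperm G x)" "einv G' y = \<phi> (einv G x)"
      using assms(1) x xy unfolding graph_iso_def by auto
    then show ?thesis
      using b cl[OF x] by (simp add: x_def[symmetric] bij_betw_inv_into_left)
  qed
  then show ?thesis
    unfolding graph_iso_def using bij_betw_inv_into[OF b] by blast
qed

lemma isomorphic_sym: "isomorphic G G' \<Longrightarrow> ribbon_graph G \<Longrightarrow> isomorphic G' G"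
  unfolding isomorphic_def using graph_iso_inv by blast

lemma isomorphic_trans: "isomorphic G G' \<Longrightarrow> isomorphic G' G'' \<Longrightarrow> isomorphic G G''"
proof -
  assume "isomorphic G G'" "isomorphic G' G''"
  then obtain \<phi> \<psi> where "graph_iso \<phi> G G'" "graph_iso \<psi> G' G''"
    unfolding isomorphic_def by blast
  then have "graph_iso (\<psi> \<circ> \<phi>) G G''"
    unfolding graph_iso_def by (auto intro: bij_betw_trans dest: bij_betwE)
  then show ?thesis unfolding isomorphic_def by blast
qed

lemma generating_imp_ribbon_graph: "generating G \<Longrightarrow> ribbon_graph G"
  unfolding generating_def n_point_generating_def by blast

lemma orbit_four_cycle:
  assumes p: "p a = b" "p b = c" "p c = d" "p d = a" and x: "x \<in> {a, b, c, d}"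
  shows "orbit p x = {a, b, c, d}"
proof
  show "orbit p x \<subseteq> {a, b, c, d}"
  proof
    fix y assume "y \<in> orbit p x"
    then show "y \<in> {a, b, c, d}" by induction (use p x in auto)
  qed
  have "p x \<in> orbit p x" "p (p x) \<in> orbit p x" "p (p (p x)) \<in> orbit p x"
    "p (p (p (p x))) \<in> orbit p x"
    by (intro orbit.intros)+
  then show "{a, b, c, d} \<subseteq> orbit p x"
    using x by (elim insertE emptyE) (simp_all add: p)
qed

lemma vertex_graph_generating: "n_point_generating 4 vertex_graph"
proof -
  let ?A = "{0, 1, 2, 3 :: nat}"
  define s where "s = (\<lambda>i::nat. if i < 4 then (i + 1) mod 4 else i)"
  define t where "t = (\<lambda>i::nat. if i < 4 then (i + 3) mod 4 else i)"
  have s: "s 0 = 1" "s 1 = 2" "s 2 = 3" "s 3 = 0" "4 \<le> i \<Longrightarrow> s i = i" for i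
    by (simp_all add: s_def)
  have t: "t 0 = 3" "t 3 = 2" "t 2 = 1" "t 1 = 0" "4 \<le> i \<Longrightarrow> t i = i" for i
    by (simp_all add: t_def)
  have cases4: "i = 0 \<or> i = 1 \<or> i = 2 \<or> i = 3 \<or> 4 \<le> i" for i :: nat by arith
  have st: "s (t i) = i" and ts: "t (s i) = i" for i
    using cases4[of i] by (elim disjE; simp only: s t)+
  have v: "half_edges vertex_graph = ?A" "vperm vertex_graph = s" "einv vertex_graph = id"
    unfolding vertex_graph_def s_def by auto
  have perm: "s permutes ?A"
    unfolding permutes_def
  proof (intro conjI allI impI)
    fix x :: nat assume "x \<notin> ?A" then show "s x = x" using cases4[of x] s(5) by blast
  next
    fix y show "\<exists>!x. s x = y" using st ts by metis
  qed
  have invs: "inv s = t" by (rule inv_equality; rule st ts)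
  have o1: "orbit s x = ?A" if "x \<in> ?A" for x
    by (rule orbit_four_cycle) (use s that in auto)
  have o2: "orbit t x = ?A" if "x \<in> ?A" for x
  proof -
    have "orbit t x = {0, 3, 2, 1}"
      by (rule orbit_four_cycle) (use t that in auto)
    then show ?thesis by auto
  qed
  have V: "vertices vertex_graph = {?A}"
    unfolding vertices_def cycles_def v
    by (simp only: image_insert image_empty o1 insert_iff simp_thms insert_absorb2)
  have E: "internal_edges vertex_graph = {}" "external vertex_graph = ?A"
    unfolding internal_edges_def external_def v by auto
  have F: "faces vertex_graph = {?A}"
    unfolding faces_def cycles_def v invs comp_id
    by (simp only: image_insert image_empty o2 insert_iff simp_thms insert_absorb2)
  have B: "boundaries vertex_graph = {?A}"
    unfolding boundaries_def F E by auto
  have R: "ribbon_graph vertex_graph"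
    unfolding ribbon_graph_def v using perm by (simp add: permutes_id)
  have C: "connected_graph vertex_graph"
    unfolding connected_graph_def v(1)
  proof (intro ballI)
    fix x y assume xy: "x \<in> ?A" "y \<in> ?A"
    define R where "R = {(x, s x) | x. x \<in> ?A}"
    have sA: "s z \<in> ?A" if "z \<in> ?A" for z
      using that by (simp only: permutes_in_image[OF perm])
    have Rs: "(z, s z) \<in> R" if "z \<in> ?A" for z
      using that unfolding R_def by blast
    have *: "(x, z) \<in> R\<^sup>* \<and> z \<in> ?A" if "z \<in> orbit s x" for z
      using that
    proof induction
      case base
      show ?case using Rs[OF xy(1)] sA[OF xy(1)] by (rule conjI[OF r_into_rtrancl])
    next
      case (step z)
      note z = conjunct1[OF step.IH] conjunct2[OF step.IH]
      show ?case by (rule conjI[OF rtrancl.rtrancl_into_rtrancl[OF z(1) Rs[OF z(2)]] sA[OF z(2)]])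
    qed
    have "y \<in> orbit s x" using xy(2) by (simp only: o1[OF xy(1)])
    then have "(x, y) \<in> R\<^sup>*" by (rule conjunct1[OF *])
    moreover have "R\<^sup>* \<subseteq> same_component vertex_graph"
      unfolding same_component_def Let_def v R_def by (rule rtrancl_mono) blast
    ultimately show "(x, y) \<in> same_component vertex_graph" by blast
  qed
  show ?thesis
    unfolding n_point_generating_def bridgeless_def genus_def boundary_length_def V E F B
    using R C by (simp add: v)
qed

text \<open>The isomorphism classes of generating graphs form the type \<open>ck_generator\<close>;
  \<open>abs_ck_generator\<close> sends a generating graph to its class.\<close>

quotient_type ck_generator = "nat ribbon_graph" / partial: generator_rel
proof (rule part_equivpI)
  show "\<exists>G. generator_rel G G"
    using vertex_graph_generating isomorphic_refl
    unfolding generator_rel_def generating_def by blast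
  show "symp generator_rel"
    unfolding generator_rel_def using isomorphic_sym generating_imp_ribbon_graph
    by (auto intro!: sympI)
  show "transp generator_rel"
    unfolding generator_rel_def using isomorphic_trans by (blast intro: transpI)
qed

definition gen_loops :: "ck_generator \<Rightarrow> nat" where
  "gen_loops g = loop_order (rep_ck_generator g)"

text \<open>A labelled graph is a generating graph with a distinguished external half edge;
  \<open>labelled_classes n\<close> are the isomorphism classes of labelled \<open>n\<close>-point graphs.\<close>

definition labelled :: "nat \<Rightarrow> (nat ribbon_graph \<times> nat) set" where
  "labelled n = {(G, h). n_point_generating n G \<and> h \<in> external G}"

definition labelled_rel ::
    "nat \<Rightarrow> ((nat ribbon_graph \<times> nat) \<times> (nat ribbon_graph \<times> nat)) set" where
  "labelled_rel n =
     {((G, h), (G', h')). (G, h) \<in> labelled n \<and> (G', h') \<in> labelled n \<and>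
        (\<exists>\<phi>. graph_iso \<phi> G G' \<and> \<phi> h = h')}"

definition labelled_classes :: "nat \<Rightarrow> (nat ribbon_graph \<times> nat) set set" where
  "labelled_classes n = labelled n // labelled_rel n"

definition forget_label :: "(nat ribbon_graph \<times> nat) set \<Rightarrow> ck_generator" where
  "forget_label L = the_elem ((\<lambda>(G, h). abs_ck_generator G) ` L)"


section \<open>The algebra and its completion\<close>

text \<open>Monomials are finite multisets of generators (disjoint unions of generating graphs, the
  empty multiset being the empty graph), so the free commutative algebra is \<open>hck\<close>. Its tensor
  square has the pairs of monomials as a basis.\<close>

type_synonym hck = "ck_generator multiset \<Rightarrow>\<^sub>0 rat"
type_synonym hck_tensor = "(ck_generator multiset \<times> ck_generator multiset) \<Rightarrow>\<^sub>0 rat"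

text \<open>An element of the completion is a sequence whose \<open>k\<close>-th entry is homogeneous of degree
  \<open>k\<close>, and products are Cauchy products. So the completion is the closed subring of \<open>hck fps\<close> of
  those series whose \<open>k\<close>-th coefficient is homogeneous of degree \<open>k\<close>, the formal variable only
  recording the loop order; the metric on \<open>fps\<close> induces the topology of the completion. The
  same applies to \<open>hck_tensor\<close> with the total degree.\<close>

type_synonym hck_hat = "hck fps"
type_synonym hck_tensor_hat = "hck_tensor fps"

definition monomial_degree :: "ck_generator multiset \<Rightarrow> nat" where
  "monomial_degree m = (\<Sum>g \<in># m. gen_loops g)"

definition tensor_degree :: "ck_generator multiset \<times> ck_generator multiset \<Rightarrow> nat" where
  "tensor_degree = (\<lambda>(a, b). monomial_degree a + monomial_degree b)"

definition homogeneous_part ::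
    "('m \<Rightarrow> nat) \<Rightarrow> nat \<Rightarrow> ('m \<Rightarrow>\<^sub>0 rat) \<Rightarrow> ('m \<Rightarrow>\<^sub>0 rat)" where
  "homogeneous_part deg n p =
     (\<Sum>m | m \<in> Poly_Mapping.keys p \<and> deg m = n. Poly_Mapping.single m (Poly_Mapping.lookup p m))"

definition to_completion :: "('m \<Rightarrow> nat) \<Rightarrow> ('m \<Rightarrow>\<^sub>0 rat) \<Rightarrow> ('m \<Rightarrow>\<^sub>0 rat) fps" where
  "to_completion deg p = Abs_fps (\<lambda>n. homogeneous_part deg n p)"

definition ck_gen :: "ck_generator \<Rightarrow> hck" where
  "ck_gen g = Poly_Mapping.single {#g#} 1"

definition tensor :: "hck \<Rightarrow> hck \<Rightarrow> hck_tensor" where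
  "tensor p q =
     (\<Sum>a \<in> Poly_Mapping.keys p. \<Sum>b \<in> Poly_Mapping.keys q.
        Poly_Mapping.single (a, b) (Poly_Mapping.lookup p a * Poly_Mapping.lookup q b))"

definition tensor_hat :: "hck_hat \<Rightarrow> hck_hat \<Rightarrow> hck_tensor_hat" where
  "tensor_hat Y Z = Abs_fps (\<lambda>n. \<Sum>i\<le>n. tensor (fps_nth Y i) (fps_nth Z (n - i)))"

definition loop_component :: "nat \<Rightarrow> hck_hat \<Rightarrow> hck_hat" where
  "loop_component k Y = Abs_fps (\<lambda>n. if n = k then fps_nth Y k else 0)"

definition geometric_inverse :: "hck_hat \<Rightarrow> hck_hat" where
  "geometric_inverse Y = suminf (\<lambda>m. (1 - Y) ^ m)"


section \<open>The coproduct\<close>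

definition ribbon_subgraphs :: "'a ribbon_graph \<Rightarrow> 'a ribbon_graph set" where
  "ribbon_subgraphs G =
     {H. ribbon_graph H \<and> half_edges H = half_edges G \<and> vperm H = vperm G \<and>
         internal_edges H \<subseteq> internal_edges G}"

text \<open>Deleting the elements outside \<open>A\<close> from the cycles of \<open>p\<close> leaves the first-return map.\<close>

definition first_return :: "('a \<Rightarrow> 'a) \<Rightarrow> 'a set \<Rightarrow> 'a \<Rightarrow> 'a" where
  "first_return p A x =
     (if x \<in> A then (p ^^ (LEAST n. 0 < n \<and> (p ^^ n) x \<in> A)) x else x)"

definition contract :: "'a ribbon_graph \<Rightarrow> 'a ribbon_graph \<Rightarrow> 'a ribbon_graph" where
  "contract G H =
     \<lparr>half_edges = external H,
      vperm = first_return (einv H \<circ> vperm G) (external H),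
      einv = perm_restrict (einv G) (external H)\<rparr>"

text \<open>Let \<open>B\<close> be the half edges at bivalent vertices. Following an edge from \<open>x\<close> means iterating
  \<open>einv\<close> and then, if this leads into \<open>B\<close>, crossing the bivalent vertex. If the walk arrives at
  an external half edge, \<open>einv\<close> fixes it and the walk runs back to \<open>x\<close>; so the first return
  to the complement of \<open>B\<close> is the opposite end of the merged edge, or \<open>x\<close> itself if the merged
  edge is external. Merged edges with no end outside \<open>B\<close>, in particular open edges, vanish.\<close>

definition delete_bivalent :: "'a ribbon_graph \<Rightarrow> 'a ribbon_graph" where
  "delete_bivalent G =
     (let B = {x \<in> half_edges G. card (orbit (vperm G) x) = 2};
          R = half_edges G - B
      in \<lparr>half_edges = R,
          vperm = perm_restrict (vperm G) R,
          einv = first_return (perm_restrict (vperm G) B \<circ> einv G) R\<rparr>)"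

definition graph_monomial :: "nat ribbon_graph \<Rightarrow> ck_generator multiset" where
  "graph_monomial G =
     image_mset (\<lambda>C. abs_ck_generator (induced_graph G C)) (mset_set (components G))"

definition coproduct_graph :: "nat ribbon_graph \<Rightarrow> hck_tensor" where
  "coproduct_graph G =
     (\<Sum>H | H \<in> ribbon_subgraphs G \<and> (\<forall>C \<in> components H. generating (induced_graph H C)).
        Poly_Mapping.single (graph_monomial H, graph_monomial (delete_bivalent (contract G H))) 1)"

text \<open>\<^const>\<open>coproduct_graph\<close> is extended from generators to monomials multiplicatively, then
  linearly, and finally continuously: \<open>Y\<close> is the limit of the partial sums of its homogeneous
  components.\<close>

definition coproduct_monomial :: "ck_generator multiset \<Rightarrow> hck_tensor" where
  "coproduct_monomial m = (\<Prod>g \<in># m. coproduct_graph (rep_ck_generator g))"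

definition coproduct :: "hck \<Rightarrow> hck_tensor" where
  "coproduct p =
     (\<Sum>m \<in> Poly_Mapping.keys p.
        Poly_Mapping.single 0 (Poly_Mapping.lookup p m) * coproduct_monomial m)"

definition coproduct_hat :: "hck_hat \<Rightarrow> hck_tensor_hat" where
  "coproduct_hat Y = suminf (\<lambda>k. to_completion tensor_degree (coproduct (fps_nth Y k)))"


section \<open>The perturbative series\<close>

definition ck_v :: ck_generator where
  "ck_v = abs_ck_generator vertex_graph"

definition X_e :: hck_hat where
  "X_e = 1 - Abs_fps (\<lambda>n.
     \<Sum>L | L \<in> labelled_classes 2 \<and> gen_loops (forget_label L) = n. ck_gen (forget_label L))"

definition X_v :: hck_hat where
  "X_v = to_completion monomial_degree (ck_gen ck_v) + Abs_fps (\<lambda>n.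
     \<Sum>L | L \<in> labelled_classes 4 \<and> forget_label L \<noteq> ck_v \<and> gen_loops (forget_label L) = n.
       ck_gen (forget_label L))"

end

theory Submission
  imports Defs "HOL-Library.Nat_Bijection"
begin

text \<open>A subgraph \<open>H\<close> of \<open>G\<close> all of whose components are generators amounts to a decoration of the
  contracted graph \<open>\<Gamma> = \<pi>(G/H)\<close>: every vertex carries the labelled 4-point graph inserted there, and
  every internal edge the list of labelled 2-point graphs met along it. Labelled connected graphs have
  no automorphisms, so this is a bijection between isomorphism classes. Loop orders add up and
  the other defining properties pass between \<open>G\<close> and \<open>\<Gamma>\<close>; for genus 0 this is because \<open>4F + 2n\<close>
  exceeds the number of half edges by 4. As \<open>1/X\<^sup>e\<close> is the series of lists of 2-point graphs,
  summing over all decorations of \<open>\<Gamma>\<close> yields \<open>X\<^sup>v\<close> to the number of vertices divided by \<open>X\<^sup>e\<close> to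
  the number of internal edges. For loop order \<open>k\<close> these numbers are \<open>k + 1\<close> and \<open>2k\<close> for a 4-point,
  \<open>k\<close> and \<open>2k - 1\<close> for a 2-point graph, which gives the formula for \<open>X\<^sup>v\<close> and \<open>X\<^sup>e\<close>; in the 2-point
  case the subgraph \<open>H = G\<close>, contracted to the open edge, accounts for \<open>X\<^sup>e \<otimes> 1\<close>. Finally both
  sides are multiplicative in \<open>f\<close>.\<close>

section \<open>First returns of a permutation\<close>

text \<open>Shrinking components and deleting bivalent vertices both replace a permutation by a
  first-return map, so vertices, edges and faces of the contracted graph fall under one small theory
  of first returns. Following an edge through bivalent vertices iterates a product of two
  involutions, and its reversal symmetry makes the merged edges an involution. The delicate cases
  are rings of bivalent vertices and chains running into an external half edge. Connectedness and
  bridgelessness exclude both, except when no 4-point component is present, and then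
  \<open>H = G\<close>. The coproduct sums over actual subgraphs of a representative, not over
  isomorphism classes of pairs. Hence rigidity must also show that equal decorations give equal
  subgraphs and that the identification of the quotient with its representative involves no choice.
  Taking least half edges as marks orients every edge and thereby orders its list. The right-hand
  side is multiplicative but not additive in \<open>f\<close>, so it cannot be checked graph by
  graph. It is verified for the series X^v and X^e, and 1/X^e follows by uniqueness of
  inverses.\<close>

definition hits :: "('a \<Rightarrow> 'a) \<Rightarrow> 'a set \<Rightarrow> 'a \<Rightarrow> bool" where
  "hits p A x \<longleftrightarrow> (\<exists>n>0. (p ^^ n) x \<in> A)"

definition hit_time :: "('a \<Rightarrow> 'a) \<Rightarrow> 'a set \<Rightarrow> 'a \<Rightarrow> nat" where
  "hit_time p A x = (LEAST n. 0 < n \<and> (p ^^ n) x \<in> A)"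

text \<open>Walks also start at bivalent half edges, which lie outside the target set;
  \<open>first_return\<close> is the identity there, whereas \<open>hit\<close> still gives the
  point of arrival. If \<open>A\<close> is never reached the value is arbitrary, hence the guard
  \<open>hits\<close>.\<close>

definition hit :: "('a \<Rightarrow> 'a) \<Rightarrow> 'a set \<Rightarrow> 'a \<Rightarrow> 'a" where
  "hit p A x = (p ^^ hit_time p A x) x"

lemma first_return_eq_hit: "x \<in> A \<Longrightarrow> first_return p A x = hit p A x"
  by (simp add: first_return_def hit_def hit_time_def)

lemma first_return_outside: "x \<notin> A \<Longrightarrow> first_return p A x = x"
  by (simp add: first_return_def)

lemma hits_iff_orbit: "hits p A x \<longleftrightarrow> orbit p x \<inter> A \<noteq> {}"
  by (auto simp: hits_def orbit_altdef)

lemma hit_time_hits: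
  assumes "hits p A x"
  shows "0 < hit_time p A x" "hit p A x \<in> A"
  using assms LeastI_ex[of "\<lambda>n. 0 < n \<and> (p ^^ n) x \<in> A"]
  by (auto simp: hits_def hit_time_def hit_def)

lemma before_hit_time: "0 < i \<Longrightarrow> i < hit_time p A x \<Longrightarrow> (p ^^ i) x \<notin> A"
  unfolding hit_time_def using not_less_Least by blast

lemma hit_time_unique:
  assumes "0 < n" "(p ^^ n) x \<in> A" "\<And>i. 0 < i \<Longrightarrow> i < n \<Longrightarrow> (p ^^ i) x \<notin> A"
  shows "hit_time p A x = n"
  unfolding hit_time_def
  by (rule Least_equality) (use assms in \<open>auto simp: not_less[symmetric]\<close>)

lemma hit_base:
  assumes "p x \<in> A"
  shows "hit_time p A x = 1" "hit p A x = p x"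
proof -
  show "hit_time p A x = 1" by (rule hit_time_unique) (use assms in auto)
  then show "hit p A x = p x" by (simp add: hit_def)
qed

lemma hits_step: "p x \<notin> A \<Longrightarrow> hits p A (p x) \<longleftrightarrow> hits p A x"
proof -
  assume x: "p x \<notin> A"
  have "hits p A (p x)" if "0 < n" "(p ^^ n) x \<in> A" for n
  proof -
    obtain m where m: "n = Suc m" using \<open>0 < n\<close> gr0_implies_Suc by blast
    then have "(p ^^ m) (p x) \<in> A" using that(2) by (simp add: funpow_swap1)
    moreover have "m \<noteq> 0" using x that m by (cases m) auto
    ultimately show ?thesis unfolding hits_def by blast
  qed
  moreover have "hits p A x" if "0 < n" "(p ^^ n) (p x) \<in> A" for n
    unfolding hits_def by (rule exI[of _ "Suc n"]) (use that in \<open>simp add: funpow_swap1\<close>)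
  ultimately show ?thesis unfolding hits_def by blast
qed

lemma hit_step:
  assumes "hits p A x" "p x \<notin> A"
  shows "hit_time p A x = Suc (hit_time p A (p x))" "hit p A x = hit p A (p x)"
proof -
  have h: "hits p A (p x)" using assms hits_step by metis
  show *: "hit_time p A x = Suc (hit_time p A (p x))"
  proof (rule hit_time_unique)
    show "(p ^^ Suc (hit_time p A (p x))) x \<in> A"
      using hit_time_hits(2)[OF h] by (simp add: hit_def funpow_swap1)
    fix i assume i: "0 < i" "i < Suc (hit_time p A (p x))"
    show "(p ^^ i) x \<notin> A"
    proof (cases "i = 1")
      case False
      then obtain j where j: "i = Suc j" "0 < j" using i(1) by (cases i) auto
      then have "(p ^^ j) (p x) \<notin> A" using i(2) by (intro before_hit_time) auto
      then show ?thesis using j by (simp add: funpow_swap1)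
    qed (use assms in auto)
  qed simp
  show "hit p A x = hit p A (p x)" unfolding hit_def * by (simp add: funpow_swap1)
qed

text \<open>Induction on the waiting time, so that claims about \<open>hit\<close> reduce to a
  single step without exponents.\<close>

lemma hits_induct [consumes 1, case_names base step]:
  assumes "hits p A x"
    and base: "\<And>x. p x \<in> A \<Longrightarrow> P x"
    and step: "\<And>x. p x \<notin> A \<Longrightarrow> hits p A (p x) \<Longrightarrow> P (p x) \<Longrightarrow> P x"
  shows "P x"
  using assms(1)
proof (induction "hit_time p A x" arbitrary: x)
  case 0
  then show ?case using hit_time_hits(1)[OF \<open>hits p A x\<close>] by simp
next
  case (Suc n)
  show ?case
  proof (cases "p x \<in> A")
    case False
    then have h: "hits p A (p x)" using Suc.prems hits_step by metis
    have "n = hit_time p A (p x)" using Suc.hyps(2) hit_step(1)[OF Suc.prems False] by simp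
    then have "P (p x)" using h by (rule Suc.hyps(1))
    then show ?thesis by (rule step[OF False h])
  qed (use base in auto)
qed

text \<open>The two iterations coincide from their first step on, because they stay outside
  \<open>A\<close> until they stop. Applied to the face permutations of \<open>G\<close> and
  \<open>H\<close>, which agree off the external half edges of \<open>H\<close>.\<close>

lemma hit_change_start:
  assumes "hits p A x" "p x = q y" "\<And>z. z \<notin> A \<Longrightarrow> p z = q z"
  shows "hits q A y" "hit p A x = hit q A y"
proof -
  have *: "\<forall>y. p x = q y \<longrightarrow> hits q A y \<and> hit p A x = hit q A y" using assms(1)
  proof (induction rule: hits_induct)
    case (base x)
    have "hits q A y" if "p x = q y" for y
      using base that unfolding hits_def by (intro exI[of _ 1]) auto
    then show ?case using base by (metis hit_base(2))
  next
    case (step x)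
    have "hits q A (p x) \<and> hit p A (p x) = hit q A (p x)"
      using step assms(3) by blast
    then show ?case using step by (metis hit_step(2) hits_step)
  qed
  from * assms(2) show "hits q A y" "hit p A x = hit q A y" by auto
qed

text \<open>\<open>g\<close> shadows \<open>w\<close> until the arrival in \<open>A\<close> and
  deviates by \<open>\<tau>\<close> only there. In the application \<open>\<tau>\<close> is the
  inverse rotation at a 4-valent vertex, which is all that separates following a face from following
  an edge.\<close>

lemma hit_twist:
  assumes "hits w A x" "\<And>z. w z \<notin> A \<Longrightarrow> g z = w z"
    and "\<And>z. w z \<in> A \<Longrightarrow> g z = \<tau> (w z) \<and> g z \<in> A"
  shows "hits g A x" "hit g A x = \<tau> (hit w A x)"
proof -
  have "hits g A x \<and> hit g A x = \<tau> (hit w A x)" using assms(1)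
  proof (induction rule: hits_induct)
    case (base x)
    then have "g x = \<tau> (w x)" "g x \<in> A" using assms(3) by blast+
    moreover have "hits g A x" unfolding hits_def by (intro exI[of _ 1]) (use \<open>g x \<in> A\<close> in auto)
    ultimately show ?case using base hit_base(2) by metis
  next
    case (step x)
    then show ?case using assms(2) by (metis hit_step(2) hits_step)
  qed
  then show "hits g A x" "hit g A x = \<tau> (hit w A x)" by auto
qed

lemma hit_invariant:
  assumes "hits p A x" "P x" "\<And>z. P z \<Longrightarrow> P (p z)"
  shows "P (hit p A x)"
proof -
  have "P ((p ^^ n) x)" for n by (induction n) (use assms in auto)
  then show ?thesis by (simp add: hit_def)
qed

lemma funpow_intertwine:
  assumes "x \<in> S" "\<And>z. z \<in> S \<Longrightarrow> p z \<in> S \<and> q (f z) = f (p z)"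
  shows "(q ^^ n) (f x) = f ((p ^^ n) x) \<and> (p ^^ n) x \<in> S"
  by (induction n) (use assms in auto)

lemma hit_intertwine:
  assumes "x \<in> S" "\<And>z. z \<in> S \<Longrightarrow> p z \<in> S \<and> q (f z) = f (p z)"
    and "\<And>z. z \<in> S \<Longrightarrow> f z \<in> A' \<longleftrightarrow> z \<in> A"
  shows "hits q A' (f x) \<longleftrightarrow> hits p A x" "hit_time q A' (f x) = hit_time p A x"
    "hit q A' (f x) = f (hit p A x)"
proof -
  have *: "(q ^^ n) (f x) = f ((p ^^ n) x)" "(p ^^ n) x \<in> S" for n
    using funpow_intertwine[of x S p q f] assms(1,2) by blast+
  then show 1: "hits q A' (f x) \<longleftrightarrow> hits p A x" "hit_time q A' (f x) = hit_time p A x"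
    using assms(3) by (auto simp: hits_def hit_time_def)
  show "hit q A' (f x) = f (hit p A x)" unfolding hit_def 1 * ..
qed

lemma orbit_intertwine:
  assumes "x \<in> S" "\<And>z. z \<in> S \<Longrightarrow> p z \<in> S \<and> q (f z) = f (p z)"
  shows "orbit q (f x) = f ` orbit p x"
proof -
  have *: "(q ^^ n) (f x) = f ((p ^^ n) x)" for n
    using funpow_intertwine[of x S p q f] assms(1,2) by blast
  show ?thesis by (auto simp: orbit_altdef *)
qed

lemma permutes_self_in_orbit: "p permutes S \<Longrightarrow> finite S \<Longrightarrow> x \<in> orbit p x"
  by (meson permutation_permutes permutation_self_in_orbit)

lemma permutes_orbit_eq:
  assumes "p permutes S" "finite S" "y \<in> orbit p x"
  shows "orbit p y = orbit p x"
  using cyclic_on_orbit[OF assms(1,2)] assms(3) by (rule orbit_cyclic_eq3)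

lemma permutes_orbit_inv:
  "p permutes S \<Longrightarrow> finite S \<Longrightarrow> orbit (inv p) x = orbit p x"
  by (meson permutation_permutes orbit_inv_eq)

text \<open>\<open>z\<close> lies on the cycle of \<open>p z\<close>, so forward invariance carries
  membership around the cycle back to \<open>z\<close>.\<close>

lemma permutes_invariant_inv:
  assumes "p permutes S" "finite S" "Z \<subseteq> S" "\<And>z. z \<in> Z \<Longrightarrow> p z \<in> Z" "p z \<in> Z"
  shows "z \<in> Z"
proof -
  have "z \<in> orbit p z" using permutes_self_in_orbit assms(1,2) .
  also have "\<dots> = orbit p (p z)" using permutes_orbit_eq[OF assms(1,2)] orbit.base by metis
  finally have "z \<in> orbit p (p z)" .
  then show ?thesis by induction (use assms in auto)
qed

lemma permutes_hits_self: "p permutes S \<Longrightarrow> finite S \<Longrightarrow> x \<in> A \<Longrightarrow> hits p A x"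
  unfolding hits_iff_orbit using permutes_self_in_orbit[of p S x] by blast

lemma funpow_split: "m \<le> n \<Longrightarrow> (p ^^ n) x = (p ^^ (n - m)) ((p ^^ m) x)"
  using funpow_add[of "n - m" m p] by simp

text \<open>Stretches of an orbit between consecutive visits to \<open>A\<close> do not overlap:
  cancelling the smaller exponent by injectivity would place one starting point strictly inside the
  stretch of the other, which avoids \<open>A\<close>.\<close>

lemma inj_hit_time_eq:
  assumes "inj p" "x \<in> A" "y \<in> A" "m \<le> hit_time p A x" "n \<le> hit_time p A y" "0 < m" "0 < n"
    and "(p ^^ m) x = (p ^^ n) y"
  shows "x = y \<and> m = n"
proof -
  have *: "x = y \<and> m = n" if "m \<le> n" "n \<le> hit_time p A y" "0 < m" "(p ^^ m) x = (p ^^ n) y" "x \<in> A"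
    for x y m n
  proof -
    have "(p ^^ n) y = (p ^^ m) ((p ^^ (n - m)) y)"
      using \<open>m \<le> n\<close> by (metis comp_apply funpow_add le_add_diff_inverse)
    then have e: "x = (p ^^ (n - m)) y"
      using that inj_fn[OF assms(1)] by (metis injD)
    show ?thesis
    proof (cases "n = m")
      case False
      then have "(p ^^ (n - m)) y \<notin> A" using that by (intro before_hit_time) auto
      with e that show ?thesis by simp
    qed (use e in simp)
  qed
  show ?thesis
  proof (cases "m \<le> n")
    case True then show ?thesis using * assms by metis
  next
    case False then show ?thesis using *[of n m x y] assms by auto
  qed
qed

lemma first_return_permutes:
  assumes "p permutes S" "finite S" "A \<subseteq> S"
  shows "first_return p A permutes A"
proof -
  have h: "hits p A x" if "x \<in> A" for x using permutes_hits_self assms(1,2) that .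
  have "inj_on (first_return p A) A"
  proof (rule inj_onI)
    fix x y assume xy: "x \<in> A" "y \<in> A" "first_return p A x = first_return p A y"
    then have "(p ^^ hit_time p A x) x = (p ^^ hit_time p A y) y"
      by (simp add: first_return_eq_hit hit_def)
    then show "x = y"
      using inj_hit_time_eq[OF permutes_inj[OF assms(1)] xy(1,2) order_refl order_refl
        hit_time_hits(1)[OF h[OF xy(1)]] hit_time_hits(1)[OF h[OF xy(2)]]] by simp
  qed
  moreover have "first_return p A ` A \<subseteq> A"
    using hit_time_hits(2)[OF h] by (simp add: image_subset_iff first_return_eq_hit)
  ultimately have "bij_betw (first_return p A) A A"
    using endo_inj_surj[OF finite_subset[OF assms(3,2)]] by (simp add: bij_betw_def)
  then show ?thesis by (rule bij_imp_permutes) (simp add: first_return_outside)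
qed

text \<open>Strong induction on the exponent: a visit to \<open>A\<close> after the first return is
  a visit reached from that return in fewer steps.\<close>

lemma first_return_orbit:
  assumes "p permutes S" "finite S" "A \<subseteq> S" "x \<in> A"
  shows "orbit (first_return p A) x = orbit p x \<inter> A"
proof
  let ?r = "first_return p A"
  have h: "hits p A x" if "x \<in> A" for x using permutes_hits_self assms(1,2) that .
  have r: "?r x \<in> orbit p x \<inter> A" if "x \<in> A" for x
    using hit_time_hits[OF h[OF that]] that
    by (auto simp: first_return_eq_hit hit_def orbit_altdef)
  show "orbit ?r x \<subseteq> orbit p x \<inter> A"
  proof
    fix y assume "y \<in> orbit ?r x"
    then show "y \<in> orbit p x \<inter> A"
    proof induction
      case base then show ?case using r assms(4) .
    next
      case (step y) then show ?case using r[of y] orbit_trans[of _ p y x] by blast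
    qed
  qed
  have "(p ^^ n) x \<in> orbit ?r x" if "0 < n" "x \<in> A" "(p ^^ n) x \<in> A" for n x
    using that
  proof (induction n arbitrary: x rule: less_induct)
    case (less n)
    let ?m = "hit_time p A x"
    have m: "0 < ?m" "?r x = (p ^^ ?m) x" using hit_time_hits[OF h] less.prems
      by (auto simp: first_return_eq_hit hit_def)
    have "?m \<le> n" using before_hit_time[of n p A x] less.prems by (meson not_le)
    show ?case
    proof (cases "?m = n")
      case True then show ?thesis using m orbit.base[of ?r x] by simp
    next
      case False
      have e: "(p ^^ n) x = (p ^^ (n - ?m)) (?r x)"
        unfolding m(2) using \<open>?m \<le> n\<close> by (rule funpow_split)
      have "(p ^^ (n - ?m)) (?r x) \<in> orbit ?r (?r x)"
        using less.prems e m \<open>?m \<le> n\<close> False r[of x] by (intro less.IH) auto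
      then show ?thesis unfolding e using orbit_trans orbit.base by metis
    qed
  qed
  then show "orbit p x \<inter> A \<subseteq> orbit ?r x" using assms(4) by (auto simp: orbit_altdef)
qed

text \<open>Retracing the steps from the first return meets \<open>A\<close> again only at the
  start, so forward and backward waiting times are equal.\<close>

lemma first_return_inv:
  assumes "p permutes S" "finite S" "A \<subseteq> S"
  shows "inv (first_return p A) = first_return (inv p) A"
proof (rule inv_equality)
  let ?r = "first_return p A" and ?s = "first_return (inv p) A"
  have *: "?s (?r x) = x" for x
  proof (cases "x \<in> A")
    case True
    let ?m = "hit_time p A x"
    have h: "0 < ?m" "hit p A x \<in> A"
      using hit_time_hits[OF permutes_hits_self[OF assms(1,2) True]] by blast+
    have unwind: "(inv p ^^ i) ((p ^^ n) x) = (p ^^ (n - i)) x" if "i \<le> n" for i n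
      using that
    proof (induction i arbitrary: n)
      case (Suc i)
      then obtain k where k: "n = Suc k" by (cases n) auto
      have "(inv p ^^ Suc i) y = (inv p ^^ i) (inv p y)" for y by (simp add: funpow_swap1)
      then have "(inv p ^^ Suc i) ((p ^^ n) x) = (inv p ^^ i) ((p ^^ k) x)"
        by (simp add: k permutes_inverses(2)[OF assms(1)])
      then show ?case using Suc k by simp
    qed simp
    have "hit_time (inv p) A (hit p A x) = ?m"
    proof (rule hit_time_unique)
      show "(inv p ^^ ?m) (hit p A x) \<in> A" using True by (simp add: hit_def unwind)
      show "(inv p ^^ i) (hit p A x) \<notin> A" if "0 < i" "i < ?m" for i
        using that before_hit_time[of "?m - i" p A x] by (simp add: hit_def unwind)
    qed (use h in simp)
    then have "hit (inv p) A (hit p A x) = x" by (simp add: hit_def unwind)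
    then show ?thesis using True h by (simp add: first_return_eq_hit)
  qed (simp add: first_return_outside)
  show "\<And>x. ?s (?r x) = x" by (rule *)
  have r: "?r permutes A" by (rule first_return_permutes[OF assms])
  show "\<And>y. ?r (?s y) = y" using * r by (metis permutes_surj surjD)
qed

text \<open>Iterates of \<open>m\<close> are sent to the corresponding iterates of \<open>h\<close>;
  equal lengths make this compatible with the step that closes the cycle. It attaches the four half
  edges of a vertex to the legs of an inserted piece.\<close>

lemma cycle_intertwiner:
  assumes "m \<in> orbit p m" "h \<in> orbit q h" "card (orbit p m) = card (orbit q h)"
  obtains \<psi> where "bij_betw \<psi> (orbit p m) (orbit q h)" "\<psi> m = h"
    "\<And>x. x \<in> orbit p m \<Longrightarrow> \<psi> (p x) = q (\<psi> x)"
proof -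
  let ?k = "funpow_dist1 p m m" and ?l = "funpow_dist1 q h h"
  let ?P = "\<lambda>n. (p ^^ n) m" and ?Q = "\<lambda>n. (q ^^ n) h"
  have P: "bij_betw ?P {0..<?k} (orbit p m)"
    unfolding bij_betw_def
    using inj_on_funpow_dist1[OF assms(1)] orbit_conv_funpow_dist1[OF assms(1)] by simp
  have Q: "bij_betw ?Q {0..<?l} (orbit q h)"
    unfolding bij_betw_def
    using inj_on_funpow_dist1[OF assms(2)] orbit_conv_funpow_dist1[OF assms(2)] by simp
  have kl: "?k = ?l" using bij_betw_same_card[OF P] bij_betw_same_card[OF Q] assms(3) by simp
  have pk: "?P ?k = m" and qk: "?Q ?k = h"
    using funpow_dist1_prop[OF assms(1)] funpow_dist1_prop[OF assms(2)] by (simp_all only: kl)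
  define \<psi> where "\<psi> = ?Q \<circ> inv_into {0..<?k} ?P"
  have \<psi>: "\<psi> (?P n) = ?Q n" if "n < ?k" for n
  proof -
    have "inv_into {0..<?k} ?P (?P n) = n"
      using that P by (intro inv_into_f_f) (simp_all add: bij_betw_def del: funpow.simps)
    then show ?thesis by (simp only: \<psi>_def comp_def)
  qed
  have "bij_betw \<psi> (orbit p m) (orbit q h)"
    unfolding \<psi>_def by (rule bij_betw_trans[OF bij_betw_inv_into[OF P] Q[folded kl]])
  moreover have "\<psi> m = h" using \<psi>[of 0] by simp
  moreover have "\<psi> (p x) = q (\<psi> x)" if "x \<in> orbit p m" for x
  proof -
    have "x \<in> ?P ` {0..<?k}" using that P by (simp only: bij_betw_def)
    then obtain n where n': "x = ?P n" "n \<in> {0..<?k}" by (rule imageE)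
    note n = atLeastLessThan_iff[THEN iffD1, OF n'(2), THEN conjunct2] n'(1)
    have Suc: "p (?P i) = ?P (Suc i)" "q (?Q i) = ?Q (Suc i)" for i by simp_all
    show ?thesis
    proof (cases "Suc n < ?k")
      case True
      show ?thesis unfolding n(2) Suc \<psi>[OF True] \<psi>[OF n(1)] ..
    next
      case False
      then have "Suc n = ?k" using n(1) by linarith
      then show ?thesis unfolding n(2) Suc \<psi>[OF n(1)] by (simp only: \<open>Suc n = ?k\<close> pk qk \<open>\<psi> m = h\<close>)
    qed
  qed
  ultimately show ?thesis by (rule that)
qed

section \<open>Ribbon graphs\<close>

lemma ribbon_graphD:
  assumes "ribbon_graph G"
  shows "finite (half_edges G)" "vperm G permutes half_edges G" "einv G permutes half_edges G"
    "\<And>x. einv G (einv G x) = x"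
    "\<And>x. vperm G x \<in> half_edges G \<longleftrightarrow> x \<in> half_edges G"
    "\<And>x. einv G x \<in> half_edges G \<longleftrightarrow> x \<in> half_edges G"
  using assms unfolding ribbon_graph_def by (auto simp: permutes_in_image)

text \<open>Connectedness and bridgelessness are handled through invariant sets, not paths: such
  sets can be restricted to the contracted graph and lifted back, while paths would have to be
  rerouted through the contracted pieces. Forward closure suffices, as all cycles are
  finite.\<close>

definition graph_closed :: "'a ribbon_graph \<Rightarrow> 'a set \<Rightarrow> bool" where
  "graph_closed G Z \<longleftrightarrow> Z \<subseteq> half_edges G \<and> (\<forall>z\<in>Z. vperm G z \<in> Z \<and> einv G z \<in> Z)"

definition component_of :: "'a ribbon_graph \<Rightarrow> 'a \<Rightarrow> 'a set" where
  "component_of G x = same_component G `` {x}"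

lemma graph_closedD:
  "graph_closed G Z \<Longrightarrow> Z \<subseteq> half_edges G"
  "graph_closed G Z \<Longrightarrow> z \<in> Z \<Longrightarrow> vperm G z \<in> Z"
  "graph_closed G Z \<Longrightarrow> z \<in> Z \<Longrightarrow> einv G z \<in> Z"
  by (auto simp: graph_closed_def)

lemma graph_closed_inv:
  assumes "ribbon_graph G" "graph_closed G Z"
  shows "vperm G z \<in> Z \<longleftrightarrow> z \<in> Z" "einv G z \<in> Z \<longleftrightarrow> z \<in> Z"
proof -
  note r = ribbon_graphD[OF assms(1)] and c = graph_closedD[OF assms(2)]
  show "vperm G z \<in> Z \<longleftrightarrow> z \<in> Z" using permutes_invariant_inv[OF r(2,1) c(1)] c(2) by blast
  show "einv G z \<in> Z \<longleftrightarrow> z \<in> Z" using permutes_invariant_inv[OF r(3,1) c(1)] c(3) by blast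
qed

lemma graph_closed_Diff:
  assumes "ribbon_graph G" "graph_closed G Z"
  shows "graph_closed G (half_edges G - Z)"
  using graph_closed_inv[OF assms] ribbon_graphD(5,6)[OF assms(1)] by (simp add: graph_closed_def)

lemma component_of_closed:
  assumes "ribbon_graph G" "x \<in> half_edges G"
  shows "graph_closed G (component_of G x)"
proof -
  define R where "R = {(x, vperm G x) | x. x \<in> half_edges G} \<union> {(x, einv G x) | x. x \<in> half_edges G}"
  have s: "same_component G = (R \<union> R\<inverse>)\<^sup>*" by (simp add: same_component_def R_def Let_def)
  have sub: "y \<in> half_edges G" if "(x, y) \<in> (R \<union> R\<inverse>)\<^sup>*" for y
    using that by induction (use assms(2) ribbon_graphD[OF assms(1)] in \<open>auto simp: R_def\<close>)
  have "(x, vperm G z) \<in> (R \<union> R\<inverse>)\<^sup>*" "(x, einv G z) \<in> (R \<union> R\<inverse>)\<^sup>*"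
    if "(x, z) \<in> (R \<union> R\<inverse>)\<^sup>*" for z
  proof -
    have "(z, vperm G z) \<in> R" "(z, einv G z) \<in> R" using sub[OF that] by (auto simp: R_def)
    then show "(x, vperm G z) \<in> (R \<union> R\<inverse>)\<^sup>*" "(x, einv G z) \<in> (R \<union> R\<inverse>)\<^sup>*"
      using that by (auto intro: rtrancl_into_rtrancl)
  qed
  then show ?thesis using sub by (auto simp: graph_closed_def component_of_def s)
qed

lemma component_of_self: "x \<in> component_of G x"
  by (simp add: component_of_def same_component_def Let_def)

lemma component_of_least:
  assumes "ribbon_graph G" "graph_closed G Z" "x \<in> Z"
  shows "component_of G x \<subseteq> Z"
proof -
  have "y \<in> Z" if "(x, y) \<in> same_component G" for y
    using that unfolding same_component_def Let_def
    by induction (use assms(3) graph_closed_inv[OF assms(1,2)] in auto)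
  then show ?thesis by (auto simp: component_of_def)
qed

lemma component_of_eq: "y \<in> component_of G x \<Longrightarrow> component_of G y = component_of G x"
proof -
  assume "y \<in> component_of G x"
  then have xy: "(x, y) \<in> same_component G" by (simp add: component_of_def)
  have "sym (same_component G)" "trans (same_component G)"
    by (simp_all add: same_component_def Let_def sym_rtrancl sym_Un_converse trans_rtrancl)
  with xy show ?thesis by (auto simp: component_of_def dest: symD transD)
qed

lemma components_eq: "components G = component_of G ` half_edges G"
  by (simp add: components_def component_of_def)

lemma components_component_of: "C \<in> components G \<Longrightarrow> x \<in> C \<Longrightarrow> C = component_of G x"
  using component_of_eq[of x G] by (auto simp: components_eq)

lemma components_closed: "ribbon_graph G \<Longrightarrow> C \<in> components G \<Longrightarrow> graph_closed G C"
  using component_of_closed by (auto simp: components_eq)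

lemma Union_components: "ribbon_graph G \<Longrightarrow> \<Union>(components G) = half_edges G"
  using graph_closedD(1)[OF component_of_closed] component_of_self[of _ G]
  by (fastforce simp: components_eq)

lemma connected_graph_iff:
  assumes "ribbon_graph G"
  shows "connected_graph G \<longleftrightarrow> (\<forall>Z. graph_closed G Z \<longrightarrow> Z \<noteq> {} \<longrightarrow> Z = half_edges G)"
proof
  assume c: "connected_graph G"
  show "\<forall>Z. graph_closed G Z \<longrightarrow> Z \<noteq> {} \<longrightarrow> Z = half_edges G"
  proof (intro allI impI)
    fix Z assume Z: "graph_closed G Z" "Z \<noteq> {}"
    then obtain x where x: "x \<in> Z" by blast
    then have "half_edges G \<subseteq> component_of G x"
      using c graph_closedD(1)[OF Z(1)] by (auto simp: connected_graph_def component_of_def)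
    then show "Z = half_edges G"
      using component_of_least[OF assms Z(1) x] graph_closedD(1)[OF Z(1)] by blast
  qed
next
  assume "\<forall>Z. graph_closed G Z \<longrightarrow> Z \<noteq> {} \<longrightarrow> Z = half_edges G"
  then have "component_of G x = half_edges G" if "x \<in> half_edges G" for x
    using component_of_closed[OF assms that] component_of_self[of x G] by blast
  then show "connected_graph G" by (auto simp: connected_graph_def component_of_def)
qed

lemma connected_components:
  assumes "ribbon_graph G" "connected_graph G" "half_edges G \<noteq> {}"
  shows "components G = {half_edges G}"
proof -
  have "component_of G x = half_edges G" if "x \<in> half_edges G" for x
    using component_of_closed[OF assms(1) that] component_of_self[of x G] assms(1,2)
      connected_graph_iff by blast
  then show ?thesis using assms(3) by (auto simp: components_eq)
qed

section \<open>Bridges in terms of closed sets\<close>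

definition cut_closed :: "'a ribbon_graph \<Rightarrow> 'a \<Rightarrow> 'a set \<Rightarrow> bool" where
  "cut_closed G x Z \<longleftrightarrow> Z \<subseteq> half_edges G \<and> (\<forall>z\<in>Z. vperm G z \<in> Z) \<and>
     (\<forall>z\<in>Z. z \<noteq> x \<longrightarrow> z \<noteq> einv G x \<longrightarrow> einv G z \<in> Z)"

lemma ribbon_graph_cut_edge:
  assumes "ribbon_graph G" "x \<in> half_edges G"
  shows "ribbon_graph (cut_edge G x)"
proof -
  note r = ribbon_graphD[OF assms(1)]
  let ?e = "(einv G)(x := x, einv G x := einv G x)"
  have i: "?e (?e y) = y" for y using r(4) by (auto simp: fun_upd_def) metis+
  have "?e permutes half_edges G"
    unfolding permutes_def using i r(6) assms(2) permutes_not_in[OF r(3)]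
    by (metis fun_upd_apply)
  then show ?thesis using r i by (simp add: ribbon_graph_def cut_edge_def)
qed

lemma graph_closed_cut_edge: "graph_closed (cut_edge G x) Z \<longleftrightarrow> cut_closed G x Z"
  by (auto simp: graph_closed_def cut_closed_def cut_edge_def)

text \<open>The least set containing \<open>x\<close> and closed apart from the edge at
  \<open>x\<close> is the component of \<open>x\<close> in the cut graph. The edge fails to be a
  bridge exactly when this set contains the other end, and then cutting changes no
  component.\<close>

lemma bridgeless_iff:
  assumes "ribbon_graph G"
  shows "bridgeless G \<longleftrightarrow> (\<forall>x \<in> half_edges G. \<forall>Z. cut_closed G x Z \<longrightarrow> x \<in> Z \<longrightarrow> einv G x \<in> Z)"
proof
  note r = ribbon_graphD[OF assms]
  assume b: "bridgeless G"
  show "\<forall>x \<in> half_edges G. \<forall>Z. cut_closed G x Z \<longrightarrow> x \<in> Z \<longrightarrow> einv G x \<in> Z"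
  proof (intro ballI allI impI)
    fix x Z assume x: "x \<in> half_edges G" "cut_closed G x Z" "x \<in> Z"
    show "einv G x \<in> Z"
    proof (cases "einv G x = x")
      case False
      let ?C = "component_of (cut_edge G x) x"
      have "?C \<in> components (cut_edge G x)" using x(1) by (simp add: components_eq cut_edge_def)
      then have "?C \<in> components G" using b x(1) False by (auto simp: bridgeless_def)
      then have "?C = component_of G x" using component_of_self components_component_of by metis
      then have "einv G x \<in> ?C"
        using graph_closedD(3)[OF component_of_closed[OF assms x(1)]] component_of_self by metis
      moreover have "?C \<subseteq> Z"
        by (rule component_of_least[OF ribbon_graph_cut_edge[OF assms x(1)]])
          (simp_all add: graph_closed_cut_edge x)
      ultimately show ?thesis by blast
    qed (use x in simp)
  qed
next
  note r = ribbon_graphD[OF assms]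
  assume b: "\<forall>x \<in> half_edges G. \<forall>Z. cut_closed G x Z \<longrightarrow> x \<in> Z \<longrightarrow> einv G x \<in> Z"
  show "bridgeless G" unfolding bridgeless_def
  proof (intro ballI impI)
    fix x assume x: "x \<in> half_edges G" "einv G x \<noteq> x"
    note r' = ribbon_graph_cut_edge[OF assms x(1)]
    have h: "half_edges (cut_edge G x) = half_edges G" by (simp add: cut_edge_def)
    have "component_of (cut_edge G x) y = component_of G y" if y: "y \<in> half_edges G" for y
    proof
      have "graph_closed G (component_of G y)" by (rule component_of_closed[OF assms y])
      then have "graph_closed (cut_edge G x) (component_of G y)"
        unfolding graph_closed_cut_edge by (auto simp: cut_closed_def graph_closed_def)
      then show "component_of (cut_edge G x) y \<subseteq> component_of G y"
        using component_of_least[OF r'] component_of_self by metis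
      let ?C = "component_of (cut_edge G x) y"
      have C: "cut_closed G x ?C" using component_of_closed[OF r'] y h graph_closed_cut_edge by metis
      \<comment> \<open>It is unknown which end of the edge lies in \<open>?C\<close>, so the
        hypothesis is used with the edge seen from either end; the closure condition is the same for
        both.\<close>
      then have C': "cut_closed G (einv G x) ?C" using r(4) by (auto simp: cut_closed_def)
      have "einv G z \<in> ?C" if "z \<in> ?C" for z
      proof (cases "z = x \<or> z = einv G x")
        case True
        then show ?thesis
        proof
          assume "z = x"
          then show ?thesis using b[rule_format, OF x(1) C] that by simp
        next
          assume z: "z = einv G x"
          have "einv G x \<in> half_edges G" using x(1) r(6) by simp
          from b[rule_format, OF this C'] show ?thesis using that z by simp
        qed
      qed (use C that in \<open>auto simp: cut_closed_def\<close>)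
      then have "graph_closed G ?C" using C by (auto simp: cut_closed_def graph_closed_def)
      then show "component_of G y \<subseteq> ?C" using component_of_least[OF assms] component_of_self by metis
    qed
    then show "components (cut_edge G x) = components G" by (simp add: components_eq h)
  qed
qed

section \<open>Faces and the single boundary\<close>

abbreviation face_perm :: "'a ribbon_graph \<Rightarrow> 'a \<Rightarrow> 'a" where
  "face_perm G \<equiv> inv (vperm G) \<circ> einv G"

lemma face_perm_permutes: "ribbon_graph G \<Longrightarrow> face_perm G permutes half_edges G"
  using permutes_compose[OF _ permutes_inv] ribbon_graphD(2,3) by blast

lemma external_iff: "x \<in> external G \<longleftrightarrow> x \<in> half_edges G \<and> einv G x = x"
  by (simp add: external_def)

text \<open>Stated elementwise on external half edges, so that it compares directly between graphs
  whose faces differ as sets but agree on external half edges.\<close>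

definition single_boundary :: "'a ribbon_graph \<Rightarrow> bool" where
  "single_boundary G \<longleftrightarrow> external G \<noteq> {} \<and>
     (\<forall>x\<in>external G. \<forall>y\<in>external G. y \<in> orbit (face_perm G) x)"

lemma single_boundary_iff:
  assumes "ribbon_graph G"
  shows "(\<exists>b. boundaries G = {b} \<and> boundary_length G b = n) \<longleftrightarrow>
    single_boundary G \<and> card (external G) = n" (is "?l = ?r")
proof
  note p = face_perm_permutes[OF assms] ribbon_graphD(1)[OF assms]
  have self: "x \<in> orbit (face_perm G) x" for x by (rule permutes_self_in_orbit[OF p])
  have S: "x \<in> half_edges G" if "x \<in> external G" for x using that by (simp add: external_def)
  {
    assume ?l
    then obtain b where b: "boundaries G = {b}" "boundary_length G b = n" by blast
    have o: "orbit (face_perm G) x = b" if "x \<in> external G" for x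
    proof -
      have "orbit (face_perm G) x \<in> boundaries G"
        unfolding boundaries_def faces_def cycles_def using that self S by blast
      then show ?thesis using b(1) by blast
    qed
    then have "b \<inter> external G = external G" using self by blast
    moreover have "external G \<noteq> {}" using b(1) by (auto simp: boundaries_def)
    ultimately show ?r using b(2) o self unfolding single_boundary_def boundary_length_def by auto
  next
    assume ?r
    then obtain x where x: "x \<in> external G" by (auto simp: single_boundary_def)
    let ?b = "orbit (face_perm G) x"
    have sub: "external G \<subseteq> ?b" using \<open>?r\<close> x by (auto simp: single_boundary_def)
    have "c = ?b" if c: "c \<in> boundaries G" for c
    proof -
      obtain z where "c = orbit (face_perm G) z" "c \<inter> external G \<noteq> {}"
        using c unfolding boundaries_def faces_def cycles_def mem_Collect_eq image_iff by blast
      then obtain y where "c = orbit (face_perm G) z" "y \<in> c" "y \<in> external G" by blast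
      then have "orbit (face_perm G) y = c" "orbit (face_perm G) y = ?b"
        using permutes_orbit_eq[OF p, of y z] permutes_orbit_eq[OF p, of y x] sub by blast+
      then show ?thesis by simp
    qed
    moreover have "?b \<in> boundaries G"
      unfolding boundaries_def faces_def cycles_def using x self S by blast
    ultimately have "boundaries G = {?b}" by blast
    moreover have "boundary_length G ?b = n"
      using \<open>?r\<close> sub by (simp add: boundary_length_def Int_absorb1)
    ultimately show ?l by blast
  }
qed

section \<open>Counting half edges\<close>

lemma finite_vertices: "ribbon_graph G \<Longrightarrow> finite (vertices G)"
  by (simp add: vertices_def cycles_def ribbon_graph_def)

lemma finite_internal_edges: "ribbon_graph G \<Longrightarrow> finite (internal_edges G)"
proof -
  assume "ribbon_graph G"
  moreover have "internal_edges G \<subseteq> (\<lambda>x. {x, einv G x}) ` half_edges G" by (auto simp: internal_edges_def)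
  ultimately show ?thesis using ribbon_graphD(1) finite_surj by blast
qed

lemma card_half_edges_vertices:
  assumes "ribbon_graph G" "\<forall>c \<in> vertices G. card c = k"
  shows "k * card (vertices G) = card (half_edges G)"
proof -
  note r = ribbon_graphD[OF assms(1)]
  have U: "\<Union>(vertices G) = half_edges G"
    using permutes_orbit_subset[OF r(2)] permutes_self_in_orbit[OF r(2,1)]
    by (fastforce simp: vertices_def cycles_def)
  have fin: "finite (vertices G)" using r(1) by (simp add: vertices_def cycles_def)
  have "c1 \<inter> c2 = {}" if "c1 \<in> vertices G" "c2 \<in> vertices G" "c1 \<noteq> c2" for c1 c2
  proof (rule ccontr)
    note c = that
    assume "c1 \<inter> c2 \<noteq> {}"
    then obtain y where y: "y \<in> c1" "y \<in> c2" by blast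
    obtain x1 x2 where "c1 = orbit (vperm G) x1" "c2 = orbit (vperm G) x2"
      using c(1,2) by (auto simp: vertices_def cycles_def)
    then show False using y c(3) permutes_orbit_eq[OF r(2,1)] by metis
  qed
  then show ?thesis
    using card_partition[OF fin, of k] assms(2) r(1) U by simp
qed

lemma card_half_edges_edges:
  assumes "ribbon_graph G"
  shows "card (half_edges G) = card (external G) + 2 * card (internal_edges G)"
proof -
  note r = ribbon_graphD[OF assms]
  have U: "\<Union>(internal_edges G) = half_edges G - external G"
  proof (intro equalityI subsetI)
    fix y assume "y \<in> \<Union>(internal_edges G)"
    then obtain x where "x \<in> half_edges G" "einv G x \<noteq> x" "y = x \<or> y = einv G x"
      unfolding internal_edges_def by blast
    then show "y \<in> half_edges G - external G" using r(4)[of x] r(6)[of x] by (auto simp: external_def)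
  next
    fix y assume "y \<in> half_edges G - external G"
    then show "y \<in> \<Union>(internal_edges G)" by (auto simp: internal_edges_def external_def)
  qed
  have "finite (\<Union>(internal_edges G))" unfolding U using r(1) by simp
  moreover from this have "finite (internal_edges G)" by (rule finite_UnionD)
  moreover have "card c = 2" if "c \<in> internal_edges G" for c
    using that by (auto simp: internal_edges_def)
  moreover have "c1 \<inter> c2 = {}" if "c1 \<in> internal_edges G" "c2 \<in> internal_edges G" "c1 \<noteq> c2" for c1 c2
  proof (rule ccontr)
    assume "c1 \<inter> c2 \<noteq> {}"
    then obtain y where y: "y \<in> c1" "y \<in> c2" by blast
    have "c = {y, einv G y}" if c: "c \<in> internal_edges G" "y \<in> c" for c
    proof -
      obtain x where x: "c = {x, einv G x}" using c(1) by (auto simp: internal_edges_def)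
      then show ?thesis using c(2) r(4)[of x] by auto
    qed
    then show False using y that by metis
  qed
  ultimately have "2 * card (internal_edges G) = card (half_edges G - external G)"
    using card_partition[of "internal_edges G" 2] U by metis
  moreover have "external G \<subseteq> half_edges G" by (auto simp: external_def)
  ultimately show ?thesis using r(1) by (simp add: card_Diff_subset finite_subset card_mono)
qed

text \<open>For h half edges, V = h/4 and E = (h - n)/2, and a single boundary gives F + 1 faces.
  Genus zero, V - E + F + 1 = 2, thus becomes 4F + 2n = h + 4. This form mentions neither vertices
  nor edges and can be summed over components.\<close>

lemma n_point_generating_iff:
  "n_point_generating n G \<longleftrightarrow>
     ribbon_graph G \<and> connected_graph G \<and> bridgeless G \<and> single_boundary G \<and>
     card (external G) = n \<and> (\<forall>x\<in>half_edges G. card (orbit (vperm G) x) = 4) \<and>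
     4 * loop_order G + 2 * n = card (half_edges G) + 4"
proof -
  have "genus G = 0 \<longleftrightarrow> 4 * loop_order G + 2 * n = card (half_edges G) + 4"
    if G: "ribbon_graph G" and sb: "single_boundary G" "card (external G) = n"
      and v: "\<forall>c\<in>vertices G. card c = 4"
  proof -
    have fin: "finite (faces G)" using G by (simp add: faces_def cycles_def ribbon_graph_def)
    have "\<exists>b. boundaries G = {b}" using single_boundary_iff[OF G] sb by blast
    then have "card (boundaries G) = 1" by auto
    moreover have "faces G = internal_faces G \<union> boundaries G" "internal_faces G \<inter> boundaries G = {}"
      by (auto simp: internal_faces_def boundaries_def)
    ultimately have F: "card (faces G) = loop_order G + 1"
      using fin by (simp add: card_Un_disjoint loop_order_def)
    have c: "4 * card (vertices G) = card (half_edges G)"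
        "card (half_edges G) = n + 2 * card (internal_edges G)"
      using card_half_edges_vertices[OF G v] card_half_edges_edges[OF G] sb by auto
    have "genus G = 0 \<longleftrightarrow> 2 = (of_nat (card (vertices G)) - of_nat (card (internal_edges G))
           + of_nat (card (faces G)) :: rat)" by (simp add: genus_def)
    also have "\<dots> \<longleftrightarrow> of_nat (2 + card (internal_edges G)) = (of_nat (card (vertices G) + card (faces G)) :: rat)"
      by (auto simp: algebra_simps)
    also have "\<dots> \<longleftrightarrow> 2 + card (internal_edges G) = card (vertices G) + card (faces G)"
      by (rule of_nat_eq_iff)
    also have "\<dots> \<longleftrightarrow> 4 * loop_order G + 2 * n = card (half_edges G) + 4"
      using F c by linarith
    finally show ?thesis .
  qed
  moreover have "(\<forall>c\<in>vertices G. card c = 4) \<longleftrightarrow> (\<forall>x\<in>half_edges G. card (orbit (vperm G) x) = 4)"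
    by (simp add: vertices_def cycles_def)
  ultimately show ?thesis
    unfolding n_point_generating_def using single_boundary_iff[of G n] by blast
qed

lemma n_point_generatingD:
  assumes "n_point_generating n G"
  shows "ribbon_graph G" "connected_graph G" "bridgeless G" "single_boundary G"
     "card (external G) = n" "x \<in> half_edges G \<Longrightarrow> card (orbit (vperm G) x) = 4"
     "4 * loop_order G + 2 * n = card (half_edges G) + 4"
     "4 * card (vertices G) = card (half_edges G)"
     "card (half_edges G) = n + 2 * card (internal_edges G)"
  using assms card_half_edges_vertices[of G 4] card_half_edges_edges[of G]
  unfolding n_point_generating_iff by (auto simp: vertices_def cycles_def)

text \<open>\<open>Suc\<close> on the left avoids a truncated subtraction and forces 2-point graphs
  to have positive loop order, which is what makes the series of chains well defined.\<close>

lemma n_point_generating_counts: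
  "n_point_generating 4 G \<Longrightarrow> card (vertices G) = Suc (loop_order G) \<and> card (internal_edges G) = 2 * loop_order G"
  "n_point_generating 2 G \<Longrightarrow> card (vertices G) = loop_order G \<and> Suc (card (internal_edges G)) = 2 * loop_order G"
  using n_point_generatingD(7-9)[of 4 G] n_point_generatingD(7-9)[of 2 G] by linarith+

lemma n_point_generating_nonempty: "n_point_generating n G \<Longrightarrow> half_edges G \<noteq> {}"
  using n_point_generatingD(4) by (fastforce simp: single_boundary_def external_def)

section \<open>Isomorphisms\<close>

lemma graph_isoD:
  assumes "graph_iso \<phi> G G'"
  shows "bij_betw \<phi> (half_edges G) (half_edges G')" "inj_on \<phi> (half_edges G)"
    "\<phi> ` half_edges G = half_edges G'"
    "x \<in> half_edges G \<Longrightarrow> \<phi> x \<in> half_edges G'"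
    "x \<in> half_edges G \<Longrightarrow> vperm G' (\<phi> x) = \<phi> (vperm G x)"
    "x \<in> half_edges G \<Longrightarrow> einv G' (\<phi> x) = \<phi> (einv G x)"
  using assms unfolding graph_iso_def bij_betw_def by auto

lemma graph_iso_comp:
  "graph_iso \<phi> G G' \<Longrightarrow> graph_iso \<psi> G' G'' \<Longrightarrow> graph_iso (\<psi> \<circ> \<phi>) G G''"
  unfolding graph_iso_def by (auto intro: bij_betw_trans dest: bij_betwE)

lemma graph_iso_inverse:
  assumes "graph_iso \<phi> G G'" "ribbon_graph G" "h \<in> half_edges G"
  obtains \<psi> where "graph_iso \<psi> G' G" "\<psi> (\<phi> h) = h"
  using graph_iso_inv[OF assms(1,2)] inv_into_f_f[OF graph_isoD(2)[OF assms(1)] assms(3)] by blast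

text \<open>The half edges on which the two isomorphisms agree form a closed set, which is
  everything as soon as it contains \<open>h\<close>.\<close>

lemma graph_iso_rigid:
  assumes "ribbon_graph G" "connected_graph G" "graph_iso \<phi> G G'" "graph_iso \<psi> G G'"
    and "h \<in> half_edges G" "\<phi> h = \<psi> h" "x \<in> half_edges G"
  shows "\<phi> x = \<psi> x"
proof -
  let ?Z = "{x \<in> half_edges G. \<phi> x = \<psi> x}"
  have "graph_closed G ?Z"
    using graph_isoD(5,6)[OF assms(3)] graph_isoD(5,6)[OF assms(4)] ribbon_graphD(5,6)[OF assms(1)]
    unfolding graph_closed_def by (auto; metis)
  then have "?Z = half_edges G" using assms(1,2,5,6) connected_graph_iff by blast
  then show ?thesis using assms(7) by blast
qed

definition transport :: "('a \<Rightarrow> 'b) \<Rightarrow> 'a ribbon_graph \<Rightarrow> 'b ribbon_graph" where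
  "transport \<phi> G =
     (let S = half_edges G; push = (\<lambda>p y. if y \<in> \<phi> ` S then \<phi> (p (inv_into S \<phi> y)) else y)
      in \<lparr>half_edges = \<phi> ` S, vperm = push (vperm G), einv = push (einv G)\<rparr>)"

lemma transport_iso:
  assumes "ribbon_graph G" "inj_on \<phi> (half_edges G)"
  shows "ribbon_graph (transport \<phi> G)" "graph_iso \<phi> G (transport \<phi> G)"
    "half_edges (transport \<phi> G) = \<phi> ` half_edges G"
proof -
  note r = ribbon_graphD[OF assms(1)]
  let ?S = "half_edges G"
  let ?p = "\<lambda>p y. if y \<in> \<phi> ` ?S then \<phi> (p (inv_into ?S \<phi> y)) else y"
  have b: "bij_betw \<phi> ?S (\<phi> ` ?S)" using assms(2) by (simp add: bij_betw_def)
  have i: "inv_into ?S \<phi> (\<phi> x) = x" if "x \<in> ?S" for x using assms(2) that by simp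
  have "?p (einv G) (?p (einv G) y) = y" for y
  proof (cases "y \<in> \<phi> ` ?S")
    case True
    then obtain x where "y = \<phi> x" "x \<in> ?S" by blast
    then show ?thesis using r(4,6) i by simp
  qed simp
  then show "ribbon_graph (transport \<phi> G)"
    using permutes_bij_inv_into[OF r(2) b] permutes_bij_inv_into[OF r(3) b] r(1)
    unfolding ribbon_graph_def transport_def by (simp add: Let_def)
  show "graph_iso \<phi> G (transport \<phi> G)"
    using b i unfolding graph_iso_def transport_def by (simp add: Let_def)
  show "half_edges (transport \<phi> G) = \<phi> ` half_edges G" by (simp add: transport_def Let_def)
qed

section \<open>Invariance of the generating property under isomorphism\<close>

locale graph_isomorphism =
  fixes \<phi> :: "'a \<Rightarrow> 'b" and G :: "'a ribbon_graph" and G' :: "'b ribbon_graph"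
  assumes iso: "graph_iso \<phi> G G'" and rib: "ribbon_graph G" and rib': "ribbon_graph G'"
begin

lemmas i = graph_isoD[OF iso]
lemmas r = ribbon_graphD[OF rib]
lemmas r' = ribbon_graphD[OF rib']

lemma external: "x \<in> half_edges G \<Longrightarrow> \<phi> x \<in> external G' \<longleftrightarrow> x \<in> external G"
  using i(4,6) r(6) inj_onD[OF i(2), of "einv G x" x] by (auto simp: external_iff)

lemma external_image: "external G' = \<phi> ` external G"
proof -
  have "external G \<subseteq> half_edges G" "external G' \<subseteq> \<phi> ` half_edges G"
    using i(3) by (auto simp: external_iff)
  then show ?thesis using external by blast
qed

lemma vperm_step: "z \<in> half_edges G \<Longrightarrow> vperm G z \<in> half_edges G \<and> vperm G' (\<phi> z) = \<phi> (vperm G z)"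
  using i(5) r(5) by simp

lemma einv_step: "z \<in> half_edges G \<Longrightarrow> einv G z \<in> half_edges G \<and> einv G' (\<phi> z) = \<phi> (einv G z)"
  using i(6) r(6) by simp

lemma face_step:
  "z \<in> half_edges G \<Longrightarrow> face_perm G z \<in> half_edges G \<and> face_perm G' (\<phi> z) = \<phi> (face_perm G z)"
proof -
  assume z: "z \<in> half_edges G"
  have f: "face_perm G z \<in> half_edges G"
    using permutes_in_image[OF face_perm_permutes[OF rib]] z by simp
  have "vperm G' (\<phi> (face_perm G z)) = \<phi> (einv G z)"
    using vperm_step[OF f] permutes_inverses(1)[OF r(2)] by simp
  then have "\<phi> (face_perm G z) = inv (vperm G') (\<phi> (einv G z))"
    using permutes_inverses(2)[OF r'(2)] by metis
  then show ?thesis using f einv_step[OF z] by simp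
qed

lemma orbit_vperm: "x \<in> half_edges G \<Longrightarrow> orbit (vperm G') (\<phi> x) = \<phi> ` orbit (vperm G) x"
  by (rule orbit_intertwine[where S = "half_edges G"]) (use vperm_step in auto)

lemma orbit_face: "x \<in> half_edges G \<Longrightarrow> orbit (face_perm G') (\<phi> x) = \<phi> ` orbit (face_perm G) x"
  by (rule orbit_intertwine[where S = "half_edges G"]) (simp, rule face_step)

lemma closed_vimage:
  assumes "graph_closed G' Z"
  shows "graph_closed G {x \<in> half_edges G. \<phi> x \<in> Z}"
  using vperm_step einv_step graph_closedD(2,3)[OF assms] by (fastforce simp: graph_closed_def)

lemma closed_image:
  assumes "graph_closed G Z"
  shows "graph_closed G' (\<phi> ` Z)"
  unfolding graph_closed_def
proof (intro conjI ballI)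
  show "\<phi> ` Z \<subseteq> half_edges G'" using graph_closedD(1)[OF assms] i(4) by blast
  fix y assume "y \<in> \<phi> ` Z"
  then obtain x where "y = \<phi> x" "x \<in> Z" "x \<in> half_edges G" using graph_closedD(1)[OF assms] by blast
  then show "vperm G' y \<in> \<phi> ` Z" "einv G' y \<in> \<phi> ` Z"
    using i(5,6) graph_closedD(2,3)[OF assms] by simp_all
qed

lemma component: "x \<in> half_edges G \<Longrightarrow> component_of G' (\<phi> x) = \<phi> ` component_of G x"
proof
  assume x: "x \<in> half_edges G"
  show "component_of G' (\<phi> x) \<subseteq> \<phi> ` component_of G x"
    by (intro component_of_least[OF rib'] closed_image component_of_closed[OF rib x] imageI component_of_self)
  have "component_of G x \<subseteq> {y \<in> half_edges G. \<phi> y \<in> component_of G' (\<phi> x)}"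
    using x component_of_self[of "\<phi> x" G']
    by (intro component_of_least[OF rib] closed_vimage component_of_closed[OF rib'] i(4)) simp_all
  then show "\<phi> ` component_of G x \<subseteq> component_of G' (\<phi> x)" by blast
qed

lemma connected: "connected_graph G \<Longrightarrow> connected_graph G'"
  unfolding connected_graph_iff[OF rib'] connected_graph_iff[OF rib]
proof (intro allI impI)
  fix Z assume c: "\<forall>Z. graph_closed G Z \<longrightarrow> Z \<noteq> {} \<longrightarrow> Z = half_edges G"
    and Z: "graph_closed G' Z" "Z \<noteq> {}"
  have s: "Z \<subseteq> \<phi> ` half_edges G" using graph_closedD(1)[OF Z(1)] i(3) by simp
  then have "{x \<in> half_edges G. \<phi> x \<in> Z} \<noteq> {}" using Z(2) by blast
  then have "{x \<in> half_edges G. \<phi> x \<in> Z} = half_edges G" using c closed_vimage[OF Z(1)] by blast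
  then show "Z = half_edges G'" using s unfolding i(3)[symmetric] by blast
qed

lemma bridgeless: "bridgeless G \<Longrightarrow> bridgeless G'"
  unfolding bridgeless_iff[OF rib'] bridgeless_iff[OF rib]
proof (intro ballI allI impI)
  fix y Z assume b: "\<forall>x\<in>half_edges G. \<forall>Z. cut_closed G x Z \<longrightarrow> x \<in> Z \<longrightarrow> einv G x \<in> Z"
    and y: "y \<in> half_edges G'" and Z: "cut_closed G' y Z" "y \<in> Z"
  obtain x where x: "x \<in> half_edges G" "y = \<phi> x" using y i(3) by blast
  let ?Z = "{x \<in> half_edges G. \<phi> x \<in> Z}"
  have "cut_closed G x ?Z" unfolding cut_closed_def
  proof (intro conjI ballI impI)
    fix z assume z: "z \<in> ?Z"
    show "vperm G z \<in> ?Z" using z vperm_step[of z] Z(1) unfolding cut_closed_def by fastforce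
    assume "z \<noteq> x" "z \<noteq> einv G x"
    then have "\<phi> z \<noteq> y" "\<phi> z \<noteq> einv G' y"
      using x z einv_step[of x] inj_onD[OF i(2)] by (metis (mono_tags) mem_Collect_eq)+
    then show "einv G z \<in> ?Z" using z einv_step[of z] Z(1) unfolding cut_closed_def by fastforce
  qed blast
  moreover have "x \<in> ?Z" using x Z(2) by blast
  ultimately have "einv G x \<in> ?Z" using b x(1) by blast
  then show "einv G' y \<in> Z" using x i(6) by simp
qed

lemma single_boundary: "single_boundary G \<Longrightarrow> single_boundary G'"
proof -
  assume s: "single_boundary G"
  have E: "x \<in> half_edges G" if "x \<in> external G" for x using that by (simp add: external_def)
  show ?thesis unfolding single_boundary_def external_image
  proof (intro conjI ballI)
    show "\<phi> ` external G \<noteq> {}" using s by (simp add: single_boundary_def)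
    fix x y assume "x \<in> \<phi> ` external G" "y \<in> \<phi> ` external G"
    then obtain x0 y0 where *: "x = \<phi> x0" "y = \<phi> y0" "x0 \<in> external G" "y0 \<in> external G" by blast
    then have "y0 \<in> orbit (face_perm G) x0" using s by (simp add: single_boundary_def)
    then show "y \<in> orbit (face_perm G') x" unfolding *(1,2) orbit_face[OF E[OF *(3)]] by blast
  qed
qed

lemma loop_order: "loop_order G' = loop_order G"
proof -
  note p = face_perm_permutes[OF rib]
  have F: "faces G' = (`) \<phi> ` faces G"
    unfolding faces_def cycles_def i(3)[symmetric] image_image
    by (rule image_cong[OF refl]) (rule orbit_face)
  have sub: "c \<subseteq> half_edges G" if "c \<in> faces G" for c
    using that permutes_orbit_subset[OF p] by (auto simp: faces_def cycles_def)
  have e: "\<phi> ` c \<inter> external G' = {} \<longleftrightarrow> c \<inter> external G = {}" if "c \<in> faces G" for c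
  proof -
    have "\<phi> x \<in> external G' \<longleftrightarrow> x \<in> external G" if "x \<in> c" for x
      using sub[OF \<open>c \<in> faces G\<close>] external that by blast
    then show ?thesis by blast
  qed
  have "internal_faces G' = (`) \<phi> ` {c \<in> faces G. \<phi> ` c \<inter> external G' = {}}"
    unfolding internal_faces_def F by blast
  also have "{c \<in> faces G. \<phi> ` c \<inter> external G' = {}} = internal_faces G"
    unfolding internal_faces_def using e by (intro Collect_cong) blast
  finally have "internal_faces G' = (`) \<phi> ` internal_faces G" .
  moreover have "inj_on ((`) \<phi>) (internal_faces G)"
    using sub inj_on_image_eq_iff[OF i(2)] by (intro inj_onI) (simp add: internal_faces_def)
  ultimately show ?thesis by (simp add: loop_order_def card_image)
qed

lemma n_point_generating: "n_point_generating n G \<Longrightarrow> n_point_generating n G'"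
proof -
  assume g: "n_point_generating n G"
  note d = n_point_generatingD[OF g]
  have "card (orbit (vperm G') y) = 4" if y: "y \<in> half_edges G'" for y
  proof -
    obtain x where x: "y = \<phi> x" "x \<in> half_edges G" using y unfolding i(3)[symmetric] by blast
    have "orbit (vperm G) x \<subseteq> half_edges G" using permutes_orbit_subset[OF r(2) x(2)] .
    then show ?thesis using d(6)[OF x(2)] i(2)
      unfolding x(1) orbit_vperm[OF x(2)] by (simp add: card_image inj_on_subset)
  qed
  moreover have "card (external G') = n"
    using d(5) i(2) unfolding external_image
    by (subst card_image) (auto simp: external_def intro: inj_on_subset)
  moreover have "card (half_edges G') = card (half_edges G)"
    using bij_betw_same_card[OF i(1)] by simp
  ultimately show ?thesis unfolding n_point_generating_iff
    using d rib' connected bridgeless single_boundary loop_order by simp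
qed

end

lemma graph_iso_induced:
  assumes "graph_iso \<phi> G G'" "ribbon_graph G" "graph_closed G C"
  shows "graph_iso \<phi> (induced_graph G C) (induced_graph G' (\<phi> ` C))"
proof -
  note c = graph_closedD[OF assms(3)]
  have "inj_on \<phi> C" using graph_isoD(2)[OF assms(1)] c(1) by (rule inj_on_subset)
  then show ?thesis
    using graph_isoD(5,6)[OF assms(1)] c
    by (auto simp: graph_iso_def induced_graph_def perm_restrict_def bij_betw_def)
qed

lemma perm_restrict_permutes:
  assumes "p permutes S" "finite S" "C \<subseteq> S" "\<And>x. x \<in> C \<Longrightarrow> p x \<in> C"
  shows "perm_restrict p C permutes C"
proof (rule bij_imp_permutes)
  have "inj_on (perm_restrict p C) C"
    using permutes_inj[OF assms(1)] by (auto simp: inj_on_def perm_restrict_def)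
  moreover have "perm_restrict p C ` C \<subseteq> C" using assms(4) by (auto simp: perm_restrict_def)
  ultimately show "bij_betw (perm_restrict p C) C C"
    using endo_inj_surj[OF finite_subset[OF assms(3,2)]] by (simp add: bij_betw_def)
qed (simp add: perm_restrict_def)

lemma ribbon_graph_induced:
  assumes "ribbon_graph G" "graph_closed G C"
  shows "ribbon_graph (induced_graph G C)"
proof -
  note r = ribbon_graphD[OF assms(1)] and c = graph_closedD[OF assms(2)]
  have "perm_restrict (vperm G) C permutes C" "perm_restrict (einv G) C permutes C"
    using perm_restrict_permutes[OF r(2,1) c(1)] perm_restrict_permutes[OF r(3,1) c(1)] c(2,3) by blast+
  then show ?thesis using r(1,4) c(1,3)
    by (auto simp: ribbon_graph_def induced_graph_def perm_restrict_def finite_subset)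
qed

lemma induced_graph_whole: "ribbon_graph G \<Longrightarrow> induced_graph G (half_edges G) = G"
  using ribbon_graphD(2,3)[of G] by (simp add: induced_graph_def)


section \<open>Generators and labelled classes\<close>

lemma abs_ck_generator_eq_iff:
  assumes "generating G" "generating G'"
  shows "abs_ck_generator G = abs_ck_generator G' \<longleftrightarrow> isomorphic G G'"
  using Quotient3_rel[OF Quotient3_ck_generator, of G G'] assms isomorphic_refl
  by (auto simp: generator_rel_def)

lemma generating_rep: "generating (rep_ck_generator g)"
  using Quotient3_rep_reflp[OF Quotient3_ck_generator] by (auto simp: generator_rel_def)

lemma abs_rep_ck_generator: "abs_ck_generator (rep_ck_generator g) = g"
  by (rule Quotient3_abs_rep[OF Quotient3_ck_generator])

lemma rep_abs_iso:
  assumes "generating G"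
  obtains \<phi> where "graph_iso \<phi> G (rep_ck_generator (abs_ck_generator G))"
  using abs_ck_generator_eq_iff[OF assms generating_rep] abs_rep_ck_generator
  unfolding isomorphic_def by metis

lemma n_point_generating_iso:
  "graph_iso \<phi> G G' \<Longrightarrow> ribbon_graph G' \<Longrightarrow> n_point_generating n G \<Longrightarrow> n_point_generating n G'"
  using graph_isomorphism.n_point_generating[of \<phi> G G' n] n_point_generatingD(1)
  by (auto simp: graph_isomorphism_def)

lemma generating_iso:
  "graph_iso \<phi> G G' \<Longrightarrow> ribbon_graph G' \<Longrightarrow> generating G \<Longrightarrow> generating G'"
  using n_point_generating_iso by (auto simp: generating_def)

lemma gen_loops_abs: "generating G \<Longrightarrow> gen_loops (abs_ck_generator G) = loop_order G"
proof -
  assume g: "generating G"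
  then obtain \<phi> where "graph_iso \<phi> G (rep_ck_generator (abs_ck_generator G))" by (rule rep_abs_iso)
  then show ?thesis unfolding gen_loops_def
    using graph_isomorphism.loop_order[of \<phi> G] generating_imp_ribbon_graph[OF g]
      generating_imp_ribbon_graph[OF generating_rep] by (auto simp: graph_isomorphism_def)
qed

definition label_class :: "nat \<Rightarrow> nat ribbon_graph \<Rightarrow> nat \<Rightarrow> (nat ribbon_graph \<times> nat) set" where
  "label_class n G h = labelled_rel n `` {(G, h)}"

text \<open>Chosen through \<open>forget_label\<close>, so that it is literally the representative
  on which the coproduct of the generator is evaluated. Classes with the same underlying generator
  share this graph and differ only in the root.\<close>

definition class_graph :: "(nat ribbon_graph \<times> nat) set \<Rightarrow> nat ribbon_graph" where
  "class_graph L = rep_ck_generator (forget_label L)"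

definition class_root :: "(nat ribbon_graph \<times> nat) set \<Rightarrow> nat" where
  "class_root L = (SOME h. (class_graph L, h) \<in> L)"

lemma labelledD:
  assumes "(G, h) \<in> labelled n"
  shows "n_point_generating n G" "h \<in> external G" "h \<in> half_edges G" "ribbon_graph G"
  using assms n_point_generatingD(1) by (auto simp: labelled_def external_def)

lemma labelled_iso:
  assumes "(G, h) \<in> labelled n" "graph_iso \<phi> G G'" "ribbon_graph G'"
  shows "(G', \<phi> h) \<in> labelled n"
  using labelledD[OF assms(1)] n_point_generating_iso[OF assms(2,3)]
    graph_isomorphism.external[of \<phi> G G' h] assms
  by (auto simp: labelled_def graph_isomorphism_def)

lemma equiv_labelled: "equiv (labelled n) (labelled_rel n)"
proof (rule equivI)
  show "labelled_rel n \<subseteq> labelled n \<times> labelled n" by (auto simp: labelled_rel_def)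
  show "refl_on (labelled n) (labelled_rel n)"
    by (rule refl_onI) (auto simp: labelled_rel_def graph_iso_def intro!: exI[of _ id])
  show "sym (labelled_rel n)"
  proof (rule symI)
    fix x y assume "(x, y) \<in> labelled_rel n"
    then obtain G h G' h' \<phi> where *: "x = (G, h)" "y = (G', h')" "(G, h) \<in> labelled n"
      "(G', h') \<in> labelled n" "graph_iso \<phi> G G'" "\<phi> h = h'"
      by (auto simp: labelled_rel_def)
    obtain \<psi> where "graph_iso \<psi> G' G" "\<psi> (\<phi> h) = h"
      using graph_iso_inverse[OF *(5) labelledD(4,3)[OF *(3)]] .
    then show "(y, x) \<in> labelled_rel n" using * by (auto simp: labelled_rel_def)
  qed
  show "trans (labelled_rel n)"
  proof (rule transI)
    fix x y z assume "(x, y) \<in> labelled_rel n" "(y, z) \<in> labelled_rel n"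
    then obtain \<phi> \<psi> where *: "x \<in> labelled n" "z \<in> labelled n"
      "graph_iso \<phi> (fst x) (fst y)" "\<phi> (snd x) = snd y"
      "graph_iso \<psi> (fst y) (fst z)" "\<psi> (snd y) = snd z"
      by (auto simp: labelled_rel_def)
    then show "(x, z) \<in> labelled_rel n"
      using graph_iso_comp[OF *(3,5)]
      by (cases x; cases z) (auto simp: labelled_rel_def intro!: exI[of _ "\<psi> \<circ> \<phi>"])
  qed
qed

lemma label_class_in: "(G, h) \<in> labelled n \<Longrightarrow> label_class n G h \<in> labelled_classes n"
  by (simp add: label_class_def labelled_classes_def quotientI)

lemma label_class_eq_iff:
  assumes "(G, h) \<in> labelled n" "(G', h') \<in> labelled n"
  shows "label_class n G h = label_class n G' h' \<longleftrightarrow> (\<exists>\<phi>. graph_iso \<phi> G G' \<and> \<phi> h = h')"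
  using eq_equiv_class_iff[OF equiv_labelled assms] assms
  by (simp add: label_class_def labelled_rel_def)

lemma label_class_iso:
  assumes "(G, h) \<in> labelled n" "graph_iso \<phi> G G'" "ribbon_graph G'"
  shows "label_class n G' (\<phi> h) = label_class n G h"
  using label_class_eq_iff[OF assms(1) labelled_iso[OF assms]] assms(2) by metis

lemma image_eq_singletonI: "a \<in> A \<Longrightarrow> (\<And>x. x \<in> A \<Longrightarrow> f x = c) \<Longrightarrow> f ` A = {c}"
  by auto

lemma forget_label_class:
  assumes "(G, h) \<in> labelled n" "n = 2 \<or> n = 4"
  shows "forget_label (label_class n G h) = abs_ck_generator G"
proof -
  have "abs_ck_generator G' = abs_ck_generator G" if x: "(G', h') \<in> label_class n G h" for G' h'
  proof -
    from x have "generating G" "generating G'" "isomorphic G G'"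
      using assms(2) by (auto simp: label_class_def labelled_rel_def isomorphic_def labelled_def generating_def)
    then show ?thesis using abs_ck_generator_eq_iff[of G G'] by simp
  qed
  then have c: "case_prod (\<lambda>G h. abs_ck_generator G) x = abs_ck_generator G" if "x \<in> label_class n G h" for x
    using that by (cases x) (simp only: prod.case)
  have "(G, h) \<in> label_class n G h"
    using equiv_class_self[OF equiv_labelled assms(1)] by (simp add: label_class_def)
  then have "(\<lambda>(G, h). abs_ck_generator G) ` label_class n G h = {abs_ck_generator G}"
    by (rule image_eq_singletonI) (rule c)
  then show ?thesis by (simp add: forget_label_def)
qed

lemma labelled_classesE:
  assumes "L \<in> labelled_classes n"
  obtains G h where "(G, h) \<in> labelled n" "L = label_class n G h"
  using assms unfolding labelled_classes_def label_class_def by (auto elim!: quotientE)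

text \<open>An isomorphism onto the representative of the generator carries the label along, so the
  class does contain a pair whose graph is \<open>class_graph L\<close>; this justifies the choice
  made in \<open>class_root\<close>.\<close>

lemma class_graph:
  assumes "L \<in> labelled_classes n" "n = 2 \<or> n = 4"
  shows "(class_graph L, class_root L) \<in> labelled n"
    "label_class n (class_graph L) (class_root L) = L"
proof -
  obtain G h where G: "(G, h) \<in> labelled n" "L = label_class n G h"
    using assms(1) by (rule labelled_classesE)
  have g: "generating G" using labelledD(1)[OF G(1)] assms(2) by (auto simp: generating_def)
  have c: "class_graph L = rep_ck_generator (abs_ck_generator G)"
    unfolding class_graph_def G(2) forget_label_class[OF G(1) assms(2)] ..
  obtain \<phi> where \<phi>: "graph_iso \<phi> G (class_graph L)" using rep_abs_iso[OF g] c by metis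
  have "ribbon_graph (class_graph L)" unfolding c by (rule generating_imp_ribbon_graph[OF generating_rep])
  then have "(class_graph L, \<phi> h) \<in> labelled n" using labelled_iso[OF G(1) \<phi>] by blast
  then have "(class_graph L, \<phi> h) \<in> L"
    using G \<phi> by (auto simp: label_class_def labelled_rel_def)
  then have r: "(class_graph L, class_root L) \<in> L" unfolding class_root_def by (rule someI)
  then show "(class_graph L, class_root L) \<in> labelled n"
    using G(2) by (auto simp: label_class_def labelled_rel_def)
  show "label_class n (class_graph L) (class_root L) = L"
    using r equiv_class_eq[OF equiv_labelled] unfolding label_class_def G(2) by blast
qed

lemma gen_loops_forget: "gen_loops (forget_label L) = loop_order (class_graph L)"
  by (simp add: gen_loops_def class_graph_def)

lemma abs_class_graph: "abs_ck_generator (class_graph L) = forget_label L"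
  by (simp add: class_graph_def abs_rep_ck_generator)

text \<open>The relation 4k + 2n = h + 4 fixes the number \<open>?N\<close> of half edges. Every
  class therefore has a representative on \<open>{..<?N}\<close>, given by two permutations and a
  root.\<close>

lemma finite_labelled_classes:
  assumes n: "n = 2 \<or> n = 4"
  shows "finite {L \<in> labelled_classes n. gen_loops (forget_label L) = k}"
proof -
  let ?N = "4 * k + 2 * n - 4"
  let ?P = "{p. p permutes {..<?N}}"
  let ?T = "(\<lambda>(p, q, h). (\<lparr>half_edges = {..<?N}, vperm = p, einv = q\<rparr>, h)) ` (?P \<times> ?P \<times> {..<?N})"
  have "L \<in> (\<lambda>(G, h). label_class n G h) ` ?T"
    if L: "L \<in> labelled_classes n" "gen_loops (forget_label L) = k" for L
  proof -
    let ?G = "class_graph L" and ?h = "class_root L"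
    note G = class_graph[OF L(1) n]
    note d = labelledD[OF G(1)]
    have c: "card (half_edges ?G) = ?N"
      using n_point_generatingD(7)[OF d(1)] L(2) by (simp add: gen_loops_forget)
    obtain \<phi> where \<phi>: "bij_betw \<phi> (half_edges ?G) {..<?N}"
      using ex_bij_betw_finite_nat[OF ribbon_graphD(1)[OF d(4)]] c by (auto simp: atLeast0LessThan)
    note t = transport_iso[OF d(4) bij_betw_imp_inj_on[OF \<phi>]]
    have h: "half_edges (transport \<phi> ?G) = {..<?N}" using t(3) \<phi> by (simp add: bij_betw_def)
    have "label_class n (transport \<phi> ?G) (\<phi> ?h) = L"
      using label_class_iso[OF G(1) t(2,1)] G(2) by simp
    moreover have "(transport \<phi> ?G, \<phi> ?h) \<in> ?T"
      using ribbon_graphD(2,3)[OF t(1)] h d(3) bij_betwE[OF \<phi>]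
      by (auto intro!: rev_image_eqI[of "(vperm (transport \<phi> ?G), einv (transport \<phi> ?G), \<phi> ?h)"])
    ultimately show ?thesis by force
  qed
  then have "{L \<in> labelled_classes n. gen_loops (forget_label L) = k} \<subseteq> (\<lambda>(G, h). label_class n G h) ` ?T"
    by blast
  moreover have "finite ?T" by (intro finite_imageI finite_cartesian_product finite_permutations finite_lessThan)
  ultimately show ?thesis by (rule finite_subset[OF _ finite_imageI])
qed

text \<open>The involution of \<open>v\<close> is the identity, so all powers of its rotation are
  automorphisms; the n-th one sends 0 to n.\<close>

lemma vertex_graph_rotation:
  assumes "h \<in> half_edges vertex_graph"
  shows "\<exists>\<phi>. graph_iso \<phi> vertex_graph vertex_graph \<and> \<phi> 0 = h"
proof -
  have r: "ribbon_graph vertex_graph" using vertex_graph_generating n_point_generatingD(1) by blast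
  have iso: "graph_iso (vperm vertex_graph ^^ n) vertex_graph vertex_graph" for n
    unfolding graph_iso_def
  proof (intro conjI ballI)
    let ?s = "vperm vertex_graph"
    have "(?s ^^ n) permutes half_edges vertex_graph"
    proof (induction n)
      case (Suc n)
      show ?case unfolding funpow.simps by (rule permutes_compose[OF Suc ribbon_graphD(2)[OF r]])
    qed (simp add: permutes_id flip: id_def)
    then show "bij_betw (?s ^^ n) (half_edges vertex_graph) (half_edges vertex_graph)"
      by (rule permutes_imp_bij)
    fix x
    show "(?s ^^ n) (?s x) = ?s ((?s ^^ n) x)" by (simp add: funpow_swap1)
    show "(?s ^^ n) (einv vertex_graph x) = einv vertex_graph ((?s ^^ n) x)"
      by (simp add: vertex_graph_def)
  qed
  have "(vperm vertex_graph ^^ n) 0 = n" if "n < 4" for n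
    using that by (induction n) (simp_all add: vertex_graph_def)
  then show ?thesis using iso assms by (auto simp: vertex_graph_def)
qed

text \<open>The rotations identify the four labellings of \<open>v\<close>. Hence \<open>v\<close>
  occurs exactly once in the sum over all labelled 4-point classes, in agreement with
  \<open>X_v\<close>, where it is added by hand.\<close>

lemma forget_label_eq_ck_v:
  "{L \<in> labelled_classes 4. forget_label L = ck_v} = {label_class 4 vertex_graph 0}"
proof -
  note v = vertex_graph_generating
  have l: "(vertex_graph, h) \<in> labelled 4" if "h < 4" for h
    using v that by (simp add: labelled_def external_def vertex_graph_def)
  have r: "ribbon_graph vertex_graph" using v n_point_generatingD(1) by blast
  have "L = label_class 4 vertex_graph 0" if L: "L \<in> labelled_classes 4" "forget_label L = ck_v" for L
  proof -
    note G = class_graph[OF L(1), simplified]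
    have "isomorphic (class_graph L) vertex_graph"
      using abs_class_graph[of L] L(2) labelledD(1)[OF G(1)] v
      by (subst abs_ck_generator_eq_iff[symmetric]) (auto simp: generating_def ck_v_def)
    then obtain \<phi> where \<phi>: "graph_iso \<phi> (class_graph L) vertex_graph" unfolding isomorphic_def by blast
    have h: "\<phi> (class_root L) \<in> half_edges vertex_graph"
      using graph_isoD(4)[OF \<phi>] labelledD(3)[OF G(1)] by blast
    then obtain \<rho> where \<rho>: "graph_iso \<rho> vertex_graph vertex_graph" "\<rho> 0 = \<phi> (class_root L)"
      using vertex_graph_rotation by blast
    have "L = label_class 4 vertex_graph (\<phi> (class_root L))"
      using label_class_iso[OF G(1) \<phi> r] G(2) by simp
    also have "\<dots> = label_class 4 vertex_graph 0"
      using label_class_iso[OF l \<rho>(1) r, of 0] \<rho>(2) by simp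
    finally show ?thesis .
  qed
  moreover have "forget_label (label_class 4 vertex_graph 0) = ck_v"
    using forget_label_class[OF l] by (simp add: ck_v_def)
  ultimately show ?thesis using label_class_in[OF l] by auto
qed

section \<open>Contracting a subgraph\<close>

lemma hit_skip:
  assumes "hits p A x" "\<And>i. 0 < i \<Longrightarrow> i \<le> n \<Longrightarrow> (p ^^ i) x \<notin> A"
  shows "hits p A ((p ^^ n) x)" "hit p A ((p ^^ n) x) = hit p A x"
proof -
  have "hits p A ((p ^^ n) x) \<and> hit p A ((p ^^ n) x) = hit p A x"
    using assms(2)
  proof (induction n)
    case (Suc n)
    then have "hits p A ((p ^^ n) x)" "hit p A ((p ^^ n) x) = hit p A x" by auto
    moreover have "p ((p ^^ n) x) \<notin> A" using Suc.prems[of "Suc n"] by simp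
    ultimately show ?case using hits_step[of p "(p ^^ n) x" A] hit_step(2)[of p A "(p ^^ n) x"] by simp
  qed (use assms(1) in simp)
  then show "hits p A ((p ^^ n) x)" "hit p A ((p ^^ n) x) = hit p A x" by auto
qed

lemma graph_closed_induced_face:
  assumes "ribbon_graph G" "graph_closed G C" "x \<in> C"
  shows "face_perm (induced_graph G C) x = face_perm G x" "face_perm G x \<in> C"
proof -
  note r = ribbon_graphD[OF assms(1)] and c = graph_closedD[OF assms(2)]
  let ?z = "einv G x" and ?y = "face_perm G x"
  have z: "?z \<in> C" using c(3) assms(3) .
  have sy: "vperm G ?y = ?z" using permutes_inverses(1)[OF r(2)] by simp
  then show y: "?y \<in> C" using z graph_closed_inv(1)[OF assms(1,2), of ?y] by simp
  have p: "perm_restrict (vperm G) C permutes C"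
    using perm_restrict_permutes[OF r(2,1) c(1)] c(2) by blast
  have "inv (perm_restrict (vperm G) C) ?z = ?y"
    using permutes_inverses(2)[OF p, of ?y] sy y by (simp add: perm_restrict_def)
  then show "face_perm (induced_graph G C) x = ?y"
    using assms(3) by (simp add: induced_graph_def perm_restrict_def)
qed

lemma graph_closed_induced_orbits:
  assumes "ribbon_graph G" "graph_closed G C" "x \<in> C"
  shows "orbit (face_perm (induced_graph G C)) x = orbit (face_perm G) x"
    "orbit (face_perm G) x \<subseteq> C"
    "orbit (vperm (induced_graph G C)) x = orbit (vperm G) x"
proof -
  show "orbit (face_perm (induced_graph G C)) x = orbit (face_perm G) x"
    by (rule orbit_cong0[where A = C])
      (use graph_closed_induced_face[OF assms(1,2)] assms(3) in simp_all)
  have "y \<in> C" if "y \<in> orbit (face_perm G) x" for y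
    using that by induction (use graph_closed_induced_face(2)[OF assms(1,2)] assms(3) in simp_all)
  then show "orbit (face_perm G) x \<subseteq> C" by blast
  show "orbit (vperm (induced_graph G C)) x = orbit (vperm G) x"
    by (rule orbit_cong0[where A = C])
      (use graph_closedD(2)[OF assms(2)] assms(3) in \<open>simp_all add: induced_graph_def perm_restrict_def\<close>)
qed

lemma external_induced: "graph_closed G C \<Longrightarrow> external (induced_graph G C) = external G \<inter> C"
  using graph_closedD(1) by (fastforce simp: external_def induced_graph_def perm_restrict_def)

section \<open>Additivity over components\<close>

lemma disjoint_components: "C \<in> components G \<Longrightarrow> D \<in> components G \<Longrightarrow> C \<noteq> D \<Longrightarrow> C \<inter> D = {}"
  using components_component_of[of C G] components_component_of[of D G] by blast

lemma sum_card_components: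
  assumes "ribbon_graph G" "A \<subseteq> half_edges G"
  shows "card A = (\<Sum>C\<in>components G. card (A \<inter> C))"
proof -
  note r = ribbon_graphD[OF assms(1)]
  have fin: "finite (components G)" using r(1) by (simp add: components_eq)
  have "A = (\<Union>C\<in>components G. A \<inter> C)" using Union_components[OF assms(1)] assms(2) by blast
  then have "card A = card (\<Union>C\<in>components G. A \<inter> C)" by simp
  also have "\<dots> = (\<Sum>C\<in>components G. card (A \<inter> C))"
    by (rule card_UN_disjoint[OF fin])
      (use disjoint_components finite_subset[OF assms(2) r(1)] in blast)+
  finally show ?thesis .
qed

text \<open>The face permutation preserves closed sets, so every face lies in one component and is a
  face of the graph induced there.\<close>

lemma loop_order_components:
  assumes "ribbon_graph G"
  shows "loop_order G = (\<Sum>C\<in>components G. loop_order (induced_graph G C))"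
proof -
  note r = ribbon_graphD[OF assms]
  have fin: "finite (components G)" "finite (internal_faces G)"
    using r(1) by (simp_all add: components_eq internal_faces_def faces_def cycles_def)
  have I: "internal_faces (induced_graph G C) = {c \<in> internal_faces G. c \<subseteq> C}" (is "?l = ?r")
    if C: "C \<in> components G" for C
  proof -
    note cl = components_closed[OF assms C]
    note o = graph_closed_induced_orbits[OF assms cl]
    have sub: "C \<subseteq> half_edges G" by (rule graph_closedD(1)[OF cl])
    have "c \<in> ?l \<longleftrightarrow> c \<in> ?r" for c
    proof
      assume "c \<in> ?l"
      then obtain x where x: "x \<in> C" "c = orbit (face_perm (induced_graph G C)) x" "c \<inter> (external G \<inter> C) = {}"
        unfolding internal_faces_def faces_def cycles_def external_induced[OF cl]
        by (auto simp: induced_graph_def)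
      then show "c \<in> ?r" using o(1,2)[OF x(1)] sub by (auto simp: internal_faces_def faces_def cycles_def)
    next
      assume "c \<in> ?r"
      then obtain x where x: "x \<in> half_edges G" "c = orbit (face_perm G) x" "c \<subseteq> C" "c \<inter> external G = {}"
        by (auto simp: internal_faces_def faces_def cycles_def)
      have "x \<in> C" using x(2,3) permutes_self_in_orbit[OF face_perm_permutes[OF assms] r(1)] by blast
      then show "c \<in> ?l" using o(1) x unfolding internal_faces_def faces_def cycles_def external_induced[OF cl]
        by (auto simp: induced_graph_def)
    qed
    then show ?thesis by blast
  qed
  have "internal_faces G = (\<Union>C\<in>components G. {c \<in> internal_faces G. c \<subseteq> C})"
  proof -
    have "\<exists>C\<in>components G. c \<subseteq> C" if c: "c \<in> internal_faces G" for c
    proof -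
      obtain x where x: "x \<in> half_edges G" "c = orbit (face_perm G) x"
        using c by (auto simp: internal_faces_def faces_def cycles_def)
      then show ?thesis
        using graph_closed_induced_orbits(2)[OF assms component_of_closed[OF assms x(1)] component_of_self]
        by (auto simp: components_eq)
    qed
    then show ?thesis by blast
  qed
  then have "loop_order G = card (\<Union>C\<in>components G. {c \<in> internal_faces G. c \<subseteq> C})"
    by (simp add: loop_order_def)
  also have "\<dots> = (\<Sum>C\<in>components G. card {c \<in> internal_faces G. c \<subseteq> C})"
  proof (rule card_UN_disjoint[OF fin(1)])
    show "\<forall>C\<in>components G. finite {c \<in> internal_faces G. c \<subseteq> C}" using fin(2) by simp
    have "c \<noteq> {}" if "c \<in> internal_faces G" for c
      using that orbit_nonempty[of "face_perm G"] by (fastforce simp: internal_faces_def faces_def cycles_def)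
    then show "\<forall>C\<in>components G. \<forall>D\<in>components G. C \<noteq> D \<longrightarrow>
        {c \<in> internal_faces G. c \<subseteq> C} \<inter> {c \<in> internal_faces G. c \<subseteq> D} = {}"
      using disjoint_components by blast
  qed
  also have "\<dots> = (\<Sum>C\<in>components G. loop_order (induced_graph G C))"
    by (rule sum.cong) (simp_all add: loop_order_def I)
  finally show ?thesis .
qed

locale contraction =
  fixes G H :: "'a ribbon_graph"
  assumes rib: "ribbon_graph G" and sub: "H \<in> ribbon_subgraphs G"
    and gen: "\<And>C. C \<in> components H \<Longrightarrow> generating (induced_graph H C)"
begin

abbreviation "S \<equiv> half_edges G"
abbreviation "E \<equiv> external H"
definition s0 :: "'a \<Rightarrow> 'a" where "s0 = first_return (einv H \<circ> vperm G) E"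
definition B :: "'a set" where "B = {x \<in> E. card (orbit s0 x) = 2}"
definition R :: "'a set" where "R = E - B"
definition \<beta> :: "'a \<Rightarrow> 'a" where "\<beta> = perm_restrict (einv G) E"
definition sB :: "'a \<Rightarrow> 'a" where "sB = perm_restrict s0 B"
definition w :: "'a \<Rightarrow> 'a" where "w = sB \<circ> \<beta>"
definition K :: "'a ribbon_graph" where "K = delete_bivalent (contract G H)"
abbreviation t :: "'a \<Rightarrow> 'a" where "t \<equiv> hit w R"

text \<open>The quotient \<open>G/H\<close> is \<open>(E, s0, \<beta>)\<close>, with bivalent vertices on \<open>B\<close> and 4-valent ones on \<open>R\<close>.
  Iterating \<open>w\<close> follows a chain of bivalent vertices, and \<open>t\<close> is the end of the chain.\<close>

lemma H_sel: "ribbon_graph H" "half_edges H = S" "vperm H = vperm G"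
  using sub by (auto simp: ribbon_subgraphs_def)

lemmas r = ribbon_graphD[OF rib]
lemmas rH = ribbon_graphD[OF H_sel(1), unfolded H_sel(2,3)]

lemma E_iff: "x \<in> E \<longleftrightarrow> x \<in> S \<and> einv H x = x"
  by (simp add: external_def H_sel)

lemma E_sub: "E \<subseteq> S" by (auto simp: E_iff)

lemma finite_E: "finite E" using E_sub r(1) by (rule finite_subset)

text \<open>A half edge that is not external in \<open>H\<close> lies on an internal edge of
  \<open>H\<close>, which is also an edge of \<open>G\<close>.\<close>

lemma einv_outside: "x \<notin> E \<Longrightarrow> einv G x = einv H x"
proof (cases "x \<in> S")
  case True
  assume "x \<notin> E"
  then have "einv H x \<noteq> x" using True by (simp add: E_iff)
  then have "{x, einv H x} \<in> internal_edges H" using True by (auto simp: internal_edges_def H_sel)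
  then have "{x, einv H x} \<in> internal_edges G" using sub by (auto simp: ribbon_subgraphs_def)
  then obtain y where "{x, einv H x} = {y, einv G y}" by (auto simp: internal_edges_def)
  then show ?thesis using \<open>einv H x \<noteq> x\<close> r(4) by (metis doubleton_eq_iff)
next
  case False
  then show ?thesis using permutes_not_in[OF r(3)] permutes_not_in[OF rH(3)] by simp
qed

lemma einv_E: "einv G x \<in> E \<longleftrightarrow> x \<in> E"
proof -
  have *: "x \<in> E" if "einv G x \<in> E" for x
    using that einv_outside[of x] rH(4)[of x] by (metis E_iff)
  show ?thesis using *[of x] *[of "einv G x"] r(4)[of x] by metis
qed

lemma einv_vperm_permutes: "(einv H \<circ> vperm G) permutes S"
  by (rule permutes_compose[OF r(2) rH(3)])

text \<open>The reason why shrinking works: the permutation whose first return defines the vertices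
  of the quotient runs backwards along the faces of \<open>H\<close>, so these vertices are the
  boundaries of \<open>H\<close>.\<close>

lemma inv_einv_vperm: "inv (einv H \<circ> vperm G) = face_perm H"
proof -
  have "inv (einv H) = einv H" by (rule inv_equality) (rule rH(4))+
  then show ?thesis
    using o_inv_distrib[OF permutes_bij[OF rH(3)] permutes_bij[OF r(2)]] by (simp add: H_sel)
qed

lemma s0_permutes: "s0 permutes E"
  unfolding s0_def by (rule first_return_permutes[OF einv_vperm_permutes r(1) E_sub])

lemma s0_E: "s0 x \<in> E \<longleftrightarrow> x \<in> E" by (rule permutes_in_image[OF s0_permutes])

lemma inv_s0: "inv s0 = first_return (face_perm H) E"
  unfolding s0_def first_return_inv[OF einv_vperm_permutes r(1) E_sub] inv_einv_vperm ..

lemma component_in: "x \<in> S \<Longrightarrow> component_of H x \<in> components H"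
  by (simp add: components_eq H_sel)

text \<open>A component has a single boundary, so its external half edges form exactly one cycle of
  \<open>s0\<close>, of length 2 or 4. Vertices of the quotient thus correspond to components of
  \<open>H\<close>.\<close>

lemma component_data:
  assumes "C \<in> components H"
  shows "graph_closed H C" "C \<subseteq> S" "external (induced_graph H C) = E \<inter> C"
    "\<exists>x. x \<in> E \<inter> C" "x \<in> E \<inter> C \<Longrightarrow> orbit s0 x = E \<inter> C" "x \<in> E \<inter> C \<Longrightarrow> C = component_of H x"
    "card (E \<inter> C) = 2 \<or> card (E \<inter> C) = 4" "n_point_generating (card (E \<inter> C)) (induced_graph H C)"
proof -
  show cl: "graph_closed H C" by (rule components_closed[OF H_sel(1) assms])
  show "C \<subseteq> S" using graph_closedD(1)[OF cl] H_sel by simp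
  show e: "external (induced_graph H C) = E \<inter> C" by (rule external_induced[OF cl])
  obtain m where m: "m = 2 \<or> m = 4" "n_point_generating m (induced_graph H C)"
    using gen[OF assms] by (auto simp: generating_def)
  note d = n_point_generatingD[OF m(2)]
  show "card (E \<inter> C) = 2 \<or> card (E \<inter> C) = 4" "n_point_generating (card (E \<inter> C)) (induced_graph H C)"
    using m d(5) e by auto
  show "\<exists>x. x \<in> E \<inter> C" using d(4) e by (auto simp: single_boundary_def)
  show "C = component_of H x" if "x \<in> E \<inter> C" using that components_component_of[OF assms] by blast
  show "orbit s0 x = E \<inter> C" if x: "x \<in> E \<inter> C"
  proof -
    note o = graph_closed_induced_orbits[OF H_sel(1) cl, of x]
    have "orbit s0 x = orbit (einv H \<circ> vperm G) x \<inter> E"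
      unfolding s0_def using x by (intro first_return_orbit[OF einv_vperm_permutes r(1) E_sub]) blast
    also have "orbit (einv H \<circ> vperm G) x = orbit (face_perm H) x"
      using permutes_orbit_inv[OF einv_vperm_permutes r(1)] inv_einv_vperm by metis
    also have "orbit (face_perm H) x \<inter> E = E \<inter> C"
      using o x d(4) e by (auto simp: single_boundary_def)
    finally show ?thesis .
  qed
qed

lemma orbit_s0: "x \<in> E \<Longrightarrow> orbit s0 x = E \<inter> component_of H x"
  by (rule component_data(5)[OF component_in])
    (use E_sub component_of_self[of x H] in \<open>simp_all add: subset_iff\<close>)

lemma self_orbit_s0: "x \<in> orbit s0 x"
  by (rule permutes_self_in_orbit[OF s0_permutes finite_E])

lemma orbit_s0_eq: "y \<in> orbit s0 x \<Longrightarrow> orbit s0 y = orbit s0 x"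
  by (rule permutes_orbit_eq[OF s0_permutes finite_E])

lemma B_s0: "s0 x \<in> B \<longleftrightarrow> x \<in> B"
  using s0_E orbit_s0_eq[OF orbit.base, of x] by (simp add: B_def)

lemma R_s0: "s0 x \<in> R \<longleftrightarrow> x \<in> R" using s0_E B_s0 by (simp add: R_def)

lemma card_orbit_R: "x \<in> R \<Longrightarrow> card (orbit s0 x) = 4"
  using component_data(5,7)[OF component_in, of x] component_of_self[of x H] E_sub
  by (auto simp: R_def B_def)

lemma R_E: "R \<subseteq> E" and B_E: "B \<subseteq> E" and E_un: "E = R \<union> B" and R_B: "x \<in> R \<Longrightarrow> x \<notin> B"
  by (auto simp: R_def B_def)

lemma finite_R: "finite R" using R_E finite_E by (rule finite_subset)

lemma s0_B:
  assumes "x \<in> B"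
  shows "s0 (s0 x) = x" "s0 x \<noteq> x" "orbit s0 x = {x, s0 x}" "inv s0 x = s0 x"
proof -
  have c: "card (orbit s0 x) = 2" using assms by (simp add: B_def)
  show n: "s0 x \<noteq> x"
  proof
    assume "s0 x = x"
    then have "orbit s0 x = {x}" by (simp add: orbit_eq_singleton_iff)
    then show False using c by simp
  qed
  have "{x, s0 x} \<subseteq> orbit s0 x" using self_orbit_s0 orbit.base by fast
  moreover have "finite (orbit s0 x)" using c card.infinite by fastforce
  ultimately show o: "orbit s0 x = {x, s0 x}" using c n by (metis card_2_iff card_subset_eq)
  have "s0 (s0 x) \<in> {x, s0 x}" unfolding o[symmetric] by (intro orbit.intros)
  then show i: "s0 (s0 x) = x" using n permutes_inj[OF s0_permutes] by (auto dest: injD)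
  show "inv s0 x = s0 x" using i permutes_inverses(2)[OF s0_permutes] by metis
qed

lemma sB_B: "x \<in> B \<Longrightarrow> sB x = s0 x" and sB_not_B: "x \<notin> B \<Longrightarrow> sB x = x"
  by (simp_all add: sB_def perm_restrict_def)

lemma sB_sB: "sB (sB x) = x"
  by (cases "x \<in> B") (simp_all add: sB_B sB_not_B B_s0 s0_B(1))

lemma sB_in: "sB x \<in> B \<longleftrightarrow> x \<in> B" "sB x \<in> E \<longleftrightarrow> x \<in> E" "sB x \<in> R \<longleftrightarrow> x \<in> R"
  by (cases "x \<in> B"; simp add: sB_B sB_not_B B_s0 s0_E R_s0)+

lemma \<beta>_E: "x \<in> E \<Longrightarrow> \<beta> x = einv G x" and \<beta>_not_E: "x \<notin> E \<Longrightarrow> \<beta> x = x"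
  by (simp_all add: \<beta>_def perm_restrict_def)

lemma \<beta>_\<beta>: "\<beta> (\<beta> x) = x" by (cases "x \<in> E") (simp_all add: \<beta>_E \<beta>_not_E einv_E r(4))

lemma \<beta>_in: "\<beta> x \<in> E \<longleftrightarrow> x \<in> E" by (cases "x \<in> E") (simp_all add: \<beta>_E \<beta>_not_E einv_E)

lemma w_in: "w x \<in> E \<longleftrightarrow> x \<in> E" by (simp add: w_def sB_in \<beta>_in)

lemma w_R: "w x \<in> R \<longleftrightarrow> \<beta> x \<in> R" by (simp add: w_def sB_in)

lemma w_B: "w x \<in> B \<longleftrightarrow> \<beta> x \<in> B" by (simp add: w_def sB_in)

lemma w_eq_R: "\<beta> x \<in> R \<Longrightarrow> w x = \<beta> x" by (simp add: w_def sB_not_B R_B)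

lemma w_eq_B: "\<beta> x \<in> B \<Longrightarrow> w x = s0 (\<beta> x)" by (simp add: w_def sB_B)

lemma w_permutes: "w permutes E"
  unfolding permutes_def
proof (intro conjI allI impI)
  show "x \<notin> E \<Longrightarrow> w x = x" for x by (simp add: w_def \<beta>_not_E sB_not_B B_def)
  show "\<exists>!x. w x = y" for y
    by (rule ex1I[of _ "\<beta> (sB y)"]) (auto simp: w_def sB_sB \<beta>_\<beta>)
qed

text \<open>As a product of the involutions \<open>sB\<close> and \<open>\<beta>\<close>,
  \<open>w\<close> is inverted by conjugation with \<open>sB\<close>. All facts about walking back
  rest on this.\<close>

lemma w_fold: "w (sB (w z)) = sB z" by (simp add: w_def sB_sB \<beta>_\<beta>)

lemma funpow_w_fold: "(w ^^ i) (sB ((w ^^ i) z)) = sB z"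
proof (induction i arbitrary: z)
  case (Suc i)
  have "(w ^^ Suc i) (sB ((w ^^ Suc i) z)) = (w ^^ i) (w (sB (w ((w ^^ i) z))))"
    by (simp add: funpow_swap1)
  also have "\<dots> = sB z" unfolding w_fold by (rule Suc)
  finally show ?case .
qed simp

lemma hits_R: "x \<in> R \<Longrightarrow> hits w R x" by (rule permutes_hits_self[OF w_permutes finite_E])

lemma t_R: "hits w R y \<Longrightarrow> t y \<in> R" by (rule hit_time_hits(2))

text \<open>Walking back from the far end of a chain of bivalent vertices retraces the walk, with the
  two half edges at each bivalent vertex exchanged.\<close>

lemma walk_back:
  assumes "hits w R y" "i \<le> hit_time w R y"
  shows "(w ^^ i) (t y) = sB ((w ^^ (hit_time w R y - i)) y)"
proof -
  have "sB (t y) = t y" using t_R[OF assms(1)] by (simp add: sB_not_B R_B)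
  moreover have "t y = (w ^^ i) ((w ^^ (hit_time w R y - i)) y)"
    using funpow_split[of "hit_time w R y - i" "hit_time w R y" w y] assms(2) by (simp add: hit_def)
  ultimately show ?thesis using funpow_w_fold by metis
qed

text \<open>The walk back ends at \<open>y\<close> after equally many steps; meeting
  \<open>R\<close> earlier would mean that the walk from \<open>y\<close> had met \<open>R\<close>
  on its way.\<close>

lemma t_t:
  assumes "y \<in> R"
  shows "t (t y) = y" "hit_time w R (t y) = hit_time w R y"
proof -
  let ?n = "hit_time w R y"
  note h = hits_R[OF assms]
  have e: "(w ^^ ?n) (t y) = y" using walk_back[OF h, of ?n] assms by (simp add: sB_not_B R_B)
  show n: "hit_time w R (t y) = ?n"
  proof (rule hit_time_unique)
    show "0 < ?n" using hit_time_hits(1)[OF h] .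
    show "(w ^^ ?n) (t y) \<in> R" using e assms by simp
    show "(w ^^ i) (t y) \<notin> R" if "0 < i" "i < ?n" for i
      using walk_back[OF h, of i] that before_hit_time[of "?n - i" w R y] by (simp add: sB_in)
  qed
  show "t (t y) = y" unfolding hit_def[of _ _ "t y"] n by (rule e)
qed

text \<open>The two half edges at a bivalent vertex lead to opposite ends of the chain: the walk
  back from \<open>t y\<close> passes through \<open>s0 y\<close> before it meets \<open>R\<close>,
  and continuing it leads to \<open>t (t y)\<close>.\<close>

lemma t_s0:
  assumes "y \<in> B" "hits w R y"
  shows "hits w R (s0 y)" "t (s0 y) = t (t y)"
proof -
  let ?n = "hit_time w R y"
  have e: "(w ^^ ?n) (t y) = s0 y" using walk_back[OF assms(2), of ?n] assms(1) by (simp add: sB_B)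
  have "(w ^^ i) (t y) \<notin> R" if "0 < i" "i \<le> ?n" for i
  proof (cases "i = ?n")
    case True then show ?thesis using e assms(1) B_s0 R_B by metis
  next
    case False
    then show ?thesis
      using walk_back[OF assms(2), of i] that before_hit_time[of "?n - i" w R y] by (simp add: sB_in)
  qed
  then show "hits w R (s0 y)" "t (s0 y) = t (t y)"
    using hit_skip[OF hits_R[OF t_R[OF assms(2)]], of ?n] unfolding e by blast+
qed

lemma K_sel: "half_edges K = R" "vperm K = perm_restrict s0 R" "einv K = first_return w R"
proof -
  have c: "half_edges (contract G H) = E" "vperm (contract G H) = s0" "einv (contract G H) = \<beta>"
    by (simp_all add: contract_def s0_def \<beta>_def)
  have "{x \<in> E. card (orbit s0 x) = 2} = B" by (simp add: B_def)
  then show "half_edges K = R" "vperm K = perm_restrict s0 R" "einv K = first_return w R"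
    unfolding K_def delete_bivalent_def c by (simp_all add: Let_def R_def w_def sB_def)
qed

lemma einv_K: "x \<in> R \<Longrightarrow> einv K x = t x" by (simp add: K_sel first_return_eq_hit)

lemma vperm_K: "x \<in> R \<Longrightarrow> vperm K x = s0 x" by (simp add: K_sel perm_restrict_def)

lemma rib_K: "ribbon_graph K"
  unfolding ribbon_graph_def K_sel
proof (intro conjI allI)
  show "finite R" by (rule finite_R)
  show "perm_restrict s0 R permutes R"
    using perm_restrict_permutes[OF s0_permutes finite_E R_E] R_s0 by blast
  show "first_return w R permutes R" by (rule first_return_permutes[OF w_permutes finite_E R_E])
  show "first_return w R (first_return w R x) = x" for x
    using t_R[OF hits_R] t_t(1) by (cases "x \<in> R") (simp_all add: first_return_eq_hit first_return_outside)
qed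

lemma card_orbit_K: "x \<in> R \<Longrightarrow> card (orbit (vperm K) x) = 4"
proof -
  assume x: "x \<in> R"
  have "orbit (vperm K) x = orbit s0 x"
    by (rule orbit_cong0[where A = R]) (use x R_s0 vperm_K in auto)
  then show ?thesis using card_orbit_R[OF x] by simp
qed

lemma card_orbit_vperm: "x \<in> S \<Longrightarrow> card (orbit (vperm G) x) = 4"
proof -
  assume x: "x \<in> S"
  note C = component_data[OF component_in[OF x]]
  have "x \<in> half_edges (induced_graph H (component_of H x))"
    using component_of_self by (simp add: induced_graph_def)
  from n_point_generatingD(6)[OF C(8) this] show ?thesis
    using graph_closed_induced_orbits(3)[OF H_sel(1) C(1) component_of_self] H_sel(3) by simp
qed

section \<open>Faces of the quotient\<close>

abbreviation f0 :: "'a \<Rightarrow> 'a" where "f0 \<equiv> inv s0 \<circ> \<beta>"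

lemma inv_s0_permutes: "inv s0 permutes E" by (rule permutes_inv[OF s0_permutes])

text \<open>From \<open>x\<close> in \<open>E\<close> the face of \<open>G\<close> crosses to
  \<open>\<beta> x\<close> and from there follows a face of \<open>H\<close> until it meets
  \<open>E\<close> again, since the involutions agree off \<open>E\<close>. By \<open>inv_s0\<close>
  this amounts to one step of the inverse rotation of the quotient.\<close>

lemma f0_eq: "f0 = first_return (face_perm G) E"
proof
  fix x
  show "f0 x = first_return (face_perm G) E x"
  proof (cases "x \<in> E")
    case True
    have "hit (face_perm G) E x = hit (face_perm H) E (\<beta> x)"
    proof (rule hit_change_start(2))
      show "hits (face_perm G) E x"
        by (rule permutes_hits_self[OF face_perm_permutes[OF rib] r(1) True])
      have "\<beta> x \<in> E" using True \<beta>_in by simp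
      then show "face_perm G x = face_perm H (\<beta> x)" using True E_iff by (simp add: \<beta>_E H_sel)
      show "face_perm G z = face_perm H z" if "z \<notin> E" for z
        using einv_outside[OF that] by (simp add: H_sel)
    qed
    then show ?thesis using True \<beta>_in by (simp add: inv_s0 first_return_eq_hit)
  next
    case False
    then show ?thesis using permutes_not_in[OF inv_s0_permutes] by (simp add: \<beta>_not_E first_return_outside)
  qed
qed

lemma f0_permutes: "f0 permutes E"
  unfolding f0_eq by (rule first_return_permutes[OF face_perm_permutes[OF rib] r(1) E_sub])

lemma inv_s0_R: "x \<in> R \<Longrightarrow> inv s0 x \<in> R"
  using R_s0[of "inv s0 x"] permutes_inverses(1)[OF s0_permutes] by simp

text \<open>At a bivalent vertex the rotation is its own inverse, so a face of the quotient passes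
  it just as \<open>w\<close> does; the two differ only on arrival in \<open>R\<close>.\<close>

lemma hit_f0:
  assumes "hits w R x"
  shows "hits f0 R x" "hit f0 R x = inv s0 (t x)"
proof -
  have 1: "f0 z = w z" if "w z \<notin> R" for z
  proof (cases "z \<in> E")
    case True
    then have "\<beta> z \<in> B" using that w_R E_un \<beta>_in by blast
    then show ?thesis by (simp add: w_eq_B s0_B(4))
  next
    case False
    then show ?thesis
      using permutes_not_in[OF w_permutes] permutes_not_in[OF inv_s0_permutes] by (simp add: \<beta>_not_E)
  qed
  have 2: "f0 z = inv s0 (w z) \<and> f0 z \<in> R" if "w z \<in> R" for z
    using that w_R w_eq_R inv_s0_R by simp
  show "hits f0 R x" "hit f0 R x = inv s0 (t x)"
    using hit_twist[of w R x f0 "inv s0"] assms 1 2 by blast+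
qed

text \<open>The face permutation of \<open>K\<close> is a first return of a first return, to
  \<open>E\<close> by shrinking components and to \<open>R\<close> by deleting bivalent vertices.
  First returns merely restrict cycles.\<close>

lemma orbit_face_K: "x \<in> R \<Longrightarrow> orbit (face_perm K) x = orbit (face_perm G) x \<inter> R"
proof -
  assume x: "x \<in> R"
  have "face_perm K y = first_return f0 R y \<and> face_perm K y \<in> R" if y: "y \<in> R" for y
  proof -
    let ?y = "inv s0 (t y)"
    have ty: "t y \<in> R" using t_R[OF hits_R[OF y]] .
    have "vperm K ?y = t y"
      using inv_s0_R[OF ty] by (simp add: vperm_K permutes_inverses(1)[OF s0_permutes])
    then have "inv (vperm K) (t y) = ?y" using permutes_inverses(2)[OF ribbon_graphD(2)[OF rib_K]] by metis
    then show ?thesis using hit_f0(2)[OF hits_R[OF y]] y inv_s0_R[OF ty]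
      by (simp add: einv_K first_return_eq_hit)
  qed
  then have "face_perm K \<in> R \<rightarrow> R" "\<And>y. y \<in> R \<Longrightarrow> face_perm K y = first_return f0 R y" by blast+
  with x have "orbit (face_perm K) x = orbit (first_return f0 R) x" by (rule orbit_cong0)
  also have "\<dots> = orbit f0 x \<inter> R" by (rule first_return_orbit[OF f0_permutes finite_E R_E x])
  also have "orbit f0 x = orbit (face_perm G) x \<inter> E"
    unfolding f0_eq using x R_E by (intro first_return_orbit[OF face_perm_permutes[OF rib] r(1) E_sub]) blast
  finally show ?thesis using R_E by blast
qed

section \<open>Lifting closed sets from the quotient\<close>

definition lift :: "'a set \<Rightarrow> 'a set" where "lift Z = (\<Union>z\<in>Z. component_of H z)"

lemma lift_closed: "Z \<subseteq> S \<Longrightarrow> graph_closed H (lift Z)"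
  using component_of_closed[OF H_sel(1)] H_sel(2) unfolding lift_def graph_closed_def by blast

lemma lift_sup: "Z \<subseteq> lift Z"
proof
  fix x assume "x \<in> Z"
  then show "x \<in> lift Z" using component_of_self[of x H] unfolding lift_def by blast
qed

text \<open>A component of \<open>H\<close> meets \<open>E\<close> in one cycle of
  \<open>s0\<close>, so filling in the components of a union of cycles adds no element of
  \<open>E\<close>.\<close>

lemma lift_E:
  assumes "Z \<subseteq> E" "\<And>z. z \<in> Z \<Longrightarrow> s0 z \<in> Z"
  shows "lift Z \<inter> E = Z"
proof -
  have "y \<in> Z" if "z \<in> Z" "y \<in> component_of H z" "y \<in> E" for z y
  proof -
    have "y \<in> orbit s0 z" using orbit_s0 that assms(1) by blast
    then show "y \<in> Z" by induction (use that assms in auto)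
  qed
  then have "lift Z \<inter> E \<subseteq> Z" unfolding lift_def by blast
  then show ?thesis using lift_sup assms(1) by blast
qed

text \<open>\<open>X\<close> collects the half edges whose edge need not stay inside: none for
  connectedness, one end of the cut edge for bridges.\<close>

lemma lift_step:
  assumes "Z \<subseteq> E" "\<And>z. z \<in> Z \<Longrightarrow> s0 z \<in> Z" "\<And>z. z \<in> Z \<Longrightarrow> z \<notin> X \<Longrightarrow> \<beta> z \<in> Z"
    and "z \<in> lift Z"
  shows "z \<in> S" "vperm G z \<in> lift Z" "z \<notin> X \<Longrightarrow> einv G z \<in> lift Z"
proof -
  note c = graph_closedD[OF lift_closed, of Z, unfolded H_sel]
  have Z: "Z \<subseteq> S" using assms(1) E_sub by blast
  show "z \<in> S" "vperm G z \<in> lift Z" using c[OF Z] assms(4) by blast+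
  show "einv G z \<in> lift Z" if "z \<notin> X"
  proof (cases "z \<in> E")
    case True
    then have "z \<in> Z" using lift_E[OF assms(1,2)] assms(4) by blast
    then have "\<beta> z \<in> Z" using assms(3) that by blast
    then show ?thesis using lift_sup \<beta>_E[OF True] by auto
  next
    case False
    then show ?thesis using c(3)[OF Z assms(4)] einv_outside by simp
  qed
qed

lemma lift_closed_G:
  assumes "Z \<subseteq> E" "\<And>z. z \<in> Z \<Longrightarrow> s0 z \<in> Z" "\<And>z. z \<in> Z \<Longrightarrow> \<beta> z \<in> Z"
  shows "graph_closed G (lift Z)"
  using lift_step[of Z "{}", OF assms] unfolding graph_closed_def by blast

lemma s0_closed:
  assumes "graph_closed H Z" "z \<in> Z" "z \<in> E"
  shows "s0 z \<in> Z"
proof -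
  have "s0 z \<in> component_of H z" using orbit_s0[OF assms(3)] orbit.base[of s0 z] by blast
  then show ?thesis using component_of_least[OF H_sel(1) assms(1,2)] by blast
qed

lemma external_E: "external G \<subseteq> E"
proof
  fix x assume x: "x \<in> external G"
  then have "x \<in> S" "einv G x = x" by (simp_all add: external_iff)
  then show "x \<in> E" using einv_outside[of x] by (cases "x \<in> E") (auto simp: E_iff)
qed

text \<open>For a component with m external and h half edges, 4F + 2m = h + 4. It has 2m - 4 half
  edges in \<open>R\<close>, namely 0 for m = 2 and 4 for m = 4, and the equations add up over
  components.\<close>

lemma loop_H: "4 * loop_order H + card R = card S"
proof -
  have "4 * loop_order (induced_graph H C) + card (R \<inter> C) = card (S \<inter> C)" if C: "C \<in> components H" for C
  proof -
    note d = component_data[OF C]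
    have h: "half_edges (induced_graph H C) = C" by (simp add: induced_graph_def)
    have o: "card (orbit s0 x) = card (E \<inter> C)" if "x \<in> E \<inter> C" for x using d(5)[OF that] by simp
    have "R \<inter> C = (if card (E \<inter> C) = 2 then {} else E \<inter> C)" using o by (auto simp: R_def B_def)
    then have "card (R \<inter> C) = 2 * card (E \<inter> C) - 4" using d(7) by auto
    moreover have "S \<inter> C = C" using d(2) by blast
    ultimately show ?thesis using n_point_generatingD(7)[OF d(8)] d(7) unfolding h by auto
  qed
  then have "(\<Sum>C\<in>components H. 4 * loop_order (induced_graph H C) + card (R \<inter> C))
      = (\<Sum>C\<in>components H. card (S \<inter> C))" by simp
  then show ?thesis
    using sum_card_components[OF H_sel(1), of S] sum_card_components[OF H_sel(1), of R]
      loop_order_components[OF H_sel(1)] H_sel(2) R_E E_sub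
    by (simp add: sum.distrib sum_distrib_left)
qed

end

text \<open>Excludes what deleting bivalent vertices would lose: chains that never meet
  \<open>R\<close>, and external half edges at bivalent vertices. Both conditions are automatic for
  generating \<open>G\<close> with \<open>R\<close> nonempty.\<close>

locale full_contraction = contraction +
  assumes hits_E: "\<And>y. y \<in> E \<Longrightarrow> hits w R y"
    and external_R: "external G \<subseteq> R"
begin

lemma t_in_R: "y \<in> E \<Longrightarrow> t y \<in> R" using t_R hits_E by blast

lemma t_w: "y \<in> E \<Longrightarrow> t y = (if w y \<in> R then w y else t (w y))"
  using hit_base(2)[of w y R] hit_step(2)[OF hits_E, of y] by simp

lemma t_s0': "y \<in> B \<Longrightarrow> t (s0 y) = t (t y)"
  using t_s0(2) hits_E B_E by blast

text \<open>The two halves of an edge of the quotient lead to the two ends of its chain: either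
  \<open>\<beta> y\<close> already is the end reached from \<open>y\<close>, or the walk goes on
  from the other half edge of a bivalent vertex, where \<open>t_s0\<close> applies.\<close>

lemma t_\<beta>: "y \<in> E \<Longrightarrow> t (\<beta> y) = t (t y)"
proof -
  assume y: "y \<in> E"
  show ?thesis
  proof (cases "\<beta> y \<in> R")
    case True
    then have "w y = \<beta> y" by (rule w_eq_R)
    then show ?thesis using t_w[OF y] True by simp
  next
    case False
    then have b: "\<beta> y \<in> B" using y \<beta>_in[of y] E_un by blast
    then have wy: "w y = s0 (\<beta> y)" "w y \<notin> R" using w_eq_B[OF b] False w_R[of y] by blast+
    have "t y = t (t (\<beta> y))" using t_w[OF y] wy t_s0'[OF b] by simp
    moreover have "t (\<beta> y) \<in> R" using t_in_R y \<beta>_in by blast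
    ultimately show ?thesis using t_t(1) by simp
  qed
qed

text \<open>A walk returning to its own start is a palindrome. Of even length, it would have a
  bivalent half edge fixed by \<open>s0\<close> in the middle, which is impossible. Of odd length,
  its middle edge is fixed by \<open>\<beta>\<close>, hence external in \<open>G\<close>, hence in
  \<open>R\<close>, so the walk has only one step.\<close>

lemma external_K: "external K = external G"
proof (rule set_eqI, rule iffI)
  fix x assume "x \<in> external G"
  then have x: "x \<in> R" "einv G x = x" using external_R by (auto simp: external_iff)
  then have b: "\<beta> x = x" using R_E \<beta>_E by auto
  have "w x = x" using w_eq_R[of x] x(1) unfolding b by simp
  then have "t x = x" using x(1) by (simp add: hit_base)
  then show "x \<in> external K" using x(1) by (simp add: external_iff K_sel(1) einv_K)
next
  fix x assume "x \<in> external K"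
  then have x: "x \<in> R" "t x = x" using einv_K by (auto simp: external_iff K_sel(1))
  let ?n = "hit_time w R x"
  have h: "hits w R x" by (rule hits_R[OF x(1)])
  have n: "0 < ?n" by (rule hit_time_hits(1)[OF h])
  have mid: "(w ^^ i) x = sB ((w ^^ (?n - i)) x)" if "i \<le> ?n" for i
    using walk_back[OF h that] x(2) by simp
  have inE: "(w ^^ i) x \<in> E" for i
    by (induction i) (use x(1) R_E w_in in auto)
  show "x \<in> external G"
  proof (cases "even ?n")
    case True
    then obtain m where m: "?n = 2 * m" by (elim evenE)
    have "(w ^^ m) x \<notin> R" by (rule before_hit_time) (use m n in auto)
    then have "(w ^^ m) x \<in> B" using inE E_un by blast
    moreover have "(w ^^ m) x = sB ((w ^^ m) x)" using mid[of m] m by simp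
    ultimately show ?thesis using s0_B(2) sB_B by metis
  next
    case False
    then obtain m where m: "?n = 2 * m + 1" by (elim oddE)
    let ?y = "(w ^^ m) x"
    have "?y = sB (w ?y)" using mid[of m] m by simp
    then have "\<beta> ?y = ?y" by (simp add: w_def sB_sB)
    then have "?y \<in> external G" using inE[of m] E_sub \<beta>_E by (auto simp: external_iff)
    then have "?y \<in> R" using external_R by blast
    then have "m = 0" using before_hit_time[of m w R x] m by auto
    then show ?thesis using \<open>?y \<in> external G\<close> by simp
  qed
qed

text \<open>Extends a set of half edges of \<open>K\<close> by the bivalent vertices on the chains joining two of
  its elements.\<close>

definition extend :: "'a set \<Rightarrow> 'a set" where
  "extend Z = Z \<union> {y \<in> B. t y \<in> Z \<and> t (t y) \<in> Z}"

text \<open>Only chains with both ends in \<open>Z\<close> are added. A chain leading from an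
  element of \<open>X\<close> out of \<open>Z\<close> stays outside entirely, so closure can fail
  only at \<open>X\<close> itself.\<close>

lemma extend:
  assumes "Z \<subseteq> R" "\<And>z. z \<in> Z \<Longrightarrow> s0 z \<in> Z" "\<And>z. z \<in> Z \<Longrightarrow> z \<notin> X \<Longrightarrow> t z \<in> Z"
  shows "extend Z \<subseteq> E" "z \<in> extend Z \<Longrightarrow> s0 z \<in> extend Z"
    "z \<in> extend Z \<Longrightarrow> z \<notin> X \<Longrightarrow> \<beta> z \<in> extend Z" "extend Z \<inter> R = Z"
proof -
  show "extend Z \<subseteq> E" using assms(1) R_E B_E by (auto simp: extend_def)
  show "extend Z \<inter> R = Z" using assms(1) R_B by (auto simp: extend_def)
  show "s0 z \<in> extend Z" if z: "z \<in> extend Z"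
  proof (cases "z \<in> B")
    case True
    then have "z \<notin> Z" using assms(1) R_B by blast
    then have "t z \<in> Z" "t (t z) \<in> Z" using z by (auto simp: extend_def)
    then show ?thesis using t_s0'[OF True] t_t(1)[of "t z"] assms(1) True B_s0 by (auto simp: extend_def)
  next
    case False
    then show ?thesis using z assms(2) by (auto simp: extend_def)
  qed
  show "\<beta> z \<in> extend Z" if z: "z \<in> extend Z" "z \<notin> X"
  proof -
    have zE: "z \<in> E" using z(1) \<open>extend Z \<subseteq> E\<close> by blast
    have tz: "t z \<in> Z" using z assms(3) by (auto simp: extend_def)
    have ttz: "t (t z) \<in> Z" using z(1) t_t(1)[of z] assms(1) by (auto simp: extend_def)
    show ?thesis
    proof (cases "\<beta> z \<in> R")
      case True
      then have "t z = \<beta> z" using t_w[OF zE] w_eq_R by simp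
      then show ?thesis using tz by (simp add: extend_def)
    next
      case False
      then have "\<beta> z \<in> B" using zE \<beta>_in[of z] E_un by blast
      moreover have "t (t (\<beta> z)) = t z" using t_\<beta>[OF zE] t_t(1)[OF t_in_R[OF zE]] by simp
      ultimately show ?thesis using tz ttz t_\<beta>[OF zE] by (simp add: extend_def)
    qed
  qed
qed

text \<open>A closed set of \<open>K\<close> is enlarged by chains and by components of
  \<open>H\<close> without gaining elements of \<open>R\<close>. Conversely, a nonempty closed set
  of \<open>G\<close> contains a component of \<open>H\<close>, hence meets \<open>E\<close>, and
  walks from there stay inside until they reach \<open>R\<close>.\<close>

lemma connected_iff: "connected_graph G \<longleftrightarrow> connected_graph K"
proof
  assume c: "connected_graph G"
  show "connected_graph K" unfolding connected_graph_iff[OF rib_K]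
  proof (intro allI impI)
    fix Z assume Z: "graph_closed K Z" "Z \<noteq> {}"
    note cl = graph_closedD[OF Z(1), unfolded K_sel(1)]
    have Zs: "s0 z \<in> Z" "t z \<in> Z" if "z \<in> Z" for z
      using cl(2,3)[OF that] cl(1) that vperm_K[of z] einv_K[of z] by auto
    note e = extend[of Z "{}", OF cl(1) Zs]
    have "graph_closed G (lift (extend Z))" by (rule lift_closed_G[OF e(1,2)]) (simp_all add: e(3))
    moreover have "extend Z \<noteq> {}" using Z(2) by (simp add: extend_def)
    then have "lift (extend Z) \<noteq> {}" using lift_sup by blast
    ultimately have "lift (extend Z) = S" using c connected_graph_iff[OF rib] by blast
    then have "extend Z = E" using lift_E[OF e(1,2)] E_sub by blast
    then show "Z = half_edges K" using e(4) R_E unfolding K_sel(1) by blast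
  qed
next
  assume c: "connected_graph K"
  have R: "R \<subseteq> Z \<and> R \<noteq> {}" if Z: "graph_closed G Z" "Z \<noteq> {}" for Z
  proof -
    note cl = graph_closedD[OF Z(1)]
    have "einv H z \<in> Z" if "z \<in> Z" for z
      using cl(3)[OF that] einv_outside[of z] that by (cases "z \<in> E") (auto simp: E_iff)
    then have ZH: "graph_closed H Z" using cl by (auto simp: graph_closed_def H_sel)
    have s: "s0 z \<in> Z" if "z \<in> Z" "z \<in> E" for z using s0_closed[OF ZH that] .
    have wz: "w z \<in> Z \<and> w z \<in> E" if "z \<in> Z \<and> z \<in> E" for z
      using that s[of "\<beta> z"] cl(3)[of z] \<beta>_in[of z] \<beta>_E[of z] w_in[of z] by (auto simp: w_def sB_def perm_restrict_def)
    have tz: "t z \<in> Z" if "z \<in> Z" "z \<in> E" for z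
      using hit_invariant[OF hits_E, of z "\<lambda>z. z \<in> Z \<and> z \<in> E"] that wz by blast
    obtain z where z: "z \<in> Z" using Z(2) by blast
    have zS: "z \<in> S" using z cl(1) by blast
    obtain y where y: "y \<in> E" "y \<in> component_of H z"
      using component_data(4)[OF component_in[OF zS]] by blast
    have yZ: "y \<in> Z" using y(2) component_of_least[OF H_sel(1) ZH z] by blast
    have "graph_closed K (Z \<inter> R)"
      unfolding graph_closed_def K_sel(1)
      using s tz t_in_R R_s0 R_E by (auto simp: vperm_K einv_K)
    moreover have "t y \<in> Z \<inter> R" using tz[OF yZ y(1)] t_in_R[OF y(1)] by blast
    ultimately have "Z \<inter> R = R" using c connected_graph_iff[OF rib_K] K_sel(1) by blast
    then show ?thesis using \<open>t y \<in> Z \<inter> R\<close> by blast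
  qed
  show "connected_graph G" unfolding connected_graph_iff[OF rib]
  proof (intro allI impI)
    fix Z assume Z: "graph_closed G Z" "Z \<noteq> {}"
    \<comment> \<open>Otherwise \<open>Z\<close> and its complement, both closed, would both contain
      the nonempty set \<open>R\<close>.\<close>
    have "S - Z = {}" using R[OF graph_closed_Diff[OF rib Z(1)]] R[OF Z] by blast
    then show "Z = S" using graph_closedD(1)[OF Z(1)] by blast
  qed
qed

text \<open>Carries membership in \<open>Y\<close> along a walk that avoids the one edge at which
  closure under \<open>\<beta>\<close> is not assumed.\<close>

lemma walk:
  assumes "y \<in> Y" "y \<in> E" "\<And>z. z \<in> Y \<Longrightarrow> z \<in> E \<Longrightarrow> s0 z \<in> Y"
    and "\<And>z. z \<in> Y \<Longrightarrow> z \<in> E \<Longrightarrow> z \<noteq> x \<Longrightarrow> z \<noteq> \<beta> x \<Longrightarrow> \<beta> z \<in> Y"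
    and "\<And>i. i < hit_time w R y \<Longrightarrow> (w ^^ i) y \<noteq> x \<and> (w ^^ i) y \<noteq> \<beta> x"
  shows "t y \<in> Y"
proof -
  have "(w ^^ i) y \<in> Y \<and> (w ^^ i) y \<in> E" if "i \<le> hit_time w R y" for i
    using that
  proof (induction i)
    case (Suc i)
    let ?z = "(w ^^ i) y"
    have z: "?z \<in> Y" "?z \<in> E" using Suc by auto
    have "\<beta> ?z \<in> Y" using assms(4)[OF z] assms(5)[of i] Suc.prems by auto
    moreover have "\<beta> ?z \<in> E" using z(2) \<beta>_in by simp
    ultimately have "w ?z \<in> Y" using assms(3) by (simp add: w_def sB_def perm_restrict_def)
    then show ?case using z(2) w_in by simp
  qed (use assms in simp)
  then show ?thesis by (simp add: hit_def)
qed

lemma t_along: "y \<in> E \<Longrightarrow> i < hit_time w R y \<Longrightarrow> t ((w ^^ i) y) = t y"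
  using hit_skip(2)[OF hits_E, of y i] before_hit_time[of _ w R y] by simp

text \<open>The walk from \<open>x\<close> crosses the exempted edge at once, which the assumption
  on \<open>\<beta> x\<close> makes up for. The point is that it never uses this edge again.\<close>

lemma walk_across:
  assumes "x \<in> E" "\<beta> x \<noteq> x" "\<beta> x \<in> Y" "\<And>z. z \<in> Y \<Longrightarrow> z \<in> E \<Longrightarrow> s0 z \<in> Y"
    and "\<And>z. z \<in> Y \<Longrightarrow> z \<in> E \<Longrightarrow> z \<noteq> x \<Longrightarrow> z \<noteq> \<beta> x \<Longrightarrow> \<beta> z \<in> Y"
  shows "t x \<in> Y"
proof -
  let ?n = "hit_time w R x"
  have bx: "\<beta> x \<in> E" using assms(1) \<beta>_in by simp
  have wx: "w x \<in> Y" using assms(3) assms(4)[OF assms(3) bx] by (simp add: w_def sB_def perm_restrict_def)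
  show ?thesis
  proof (cases "w x \<in> R")
    case True
    then show ?thesis using wx t_w[OF assms(1)] by simp
  next
    case False
    note h = hits_E[OF assms(1)]
    have n: "?n = Suc (hit_time w R (w x))" by (rule hit_step(1)[OF h False])
    have "(w ^^ j) x \<noteq> x \<and> (w ^^ j) x \<noteq> \<beta> x" if j: "0 < j" "j < ?n" for j
    proof (intro conjI notI)
      assume "(w ^^ j) x = x"
      then have "(w ^^ ?n) x = (w ^^ (?n - j)) x"
        using funpow_split[of j ?n w x] j by simp
      then show False using hit_time_hits(2)[OF h] before_hit_time[of "?n - j" w R x] j by (simp add: hit_def)
    next
      \<comment> \<open>A walk meeting its first edge from the other side is folded, so its end
        would be external. But \<open>w\<close> fixes an external element of \<open>R\<close>, and
        by injectivity the walk would have been there one step earlier.\<close>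
      assume e: "(w ^^ j) x = \<beta> x"
      have "t (t x) = t x" using t_along[OF assms(1) j(2)] t_\<beta>[OF assms(1)] unfolding e by simp
      moreover have tR: "t x \<in> R" by (rule t_in_R[OF assms(1)])
      ultimately have "t x \<in> external K" by (simp add: external_iff K_sel(1) einv_K)
      then have "einv G (t x) = t x" unfolding external_K by (simp add: external_iff)
      then have "\<beta> (t x) = t x" using tR R_E \<beta>_E by auto
      then have "w (t x) = t x" using w_eq_R[of "t x"] tR by simp
      moreover have "t x = w ((w ^^ hit_time w R (w x)) x)" using n by (simp add: hit_def)
      ultimately have "(w ^^ hit_time w R (w x)) x = t x"
        using injD[OF permutes_inj[OF w_permutes]] by metis
      moreover have "0 < hit_time w R (w x)" using hit_time_hits(1) h hits_step False by metis
      ultimately show False using before_hit_time[of "hit_time w R (w x)" w R x] n tR by simp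
    qed
    then have "(w ^^ i) (w x) \<noteq> x \<and> (w ^^ i) (w x) \<noteq> \<beta> x" if "i < hit_time w R (w x)" for i
      using that n by (metis Suc_less_eq comp_apply funpow_Suc_right zero_less_Suc)
    then have "t (w x) \<in> Y" using wx assms(1,4,5) w_in by (intro walk) auto
    then show ?thesis using t_w[OF assms(1)] False by simp
  qed
qed

text \<open>A set closed in \<open>K\<close> apart from the edge at \<open>x\<close> extends and
  lifts to one closed in \<open>G\<close> apart from the edge at \<open>x\<close>. Once the latter
  contains \<open>\<beta> x\<close>, the chain through that edge must have its other end
  \<open>t x\<close> in the set.\<close>

lemma bridgeless_K: "bridgeless G \<Longrightarrow> bridgeless K"
  unfolding bridgeless_iff[OF rib_K] K_sel(1)
proof (intro ballI allI impI)
  fix x Z assume b: "bridgeless G" and x: "x \<in> R" and Z: "cut_closed K x Z" "x \<in> Z"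
  have ZR: "Z \<subseteq> R" using Z(1) by (simp add: cut_closed_def K_sel(1))
  have Zs: "s0 z \<in> Z" if "z \<in> Z" for z
    using Z(1) vperm_K[OF subsetD[OF ZR that]] that by (auto simp: cut_closed_def)
  \<comment> \<open>Only \<open>x\<close> has to be exempted: the other end \<open>t x\<close> of
    the cut edge is sent to \<open>x\<close>, which lies in \<open>Z\<close> anyway.\<close>
  have Zt: "t z \<in> Z" if "z \<in> Z" "z \<notin> {x}" for z
  proof (cases "z = t x")
    case True
    then show ?thesis using t_t(1)[OF x] Z(2) by simp
  next
    case False
    then show ?thesis
      using Z(1) that einv_K[OF subsetD[OF ZR that(1)]] einv_K[OF x] by (auto simp: cut_closed_def)
  qed
  note e = extend[of Z "{x}", OF ZR Zs Zt]
  note l = lift_step[of "extend Z" "{x}", OF e(1-3)]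
  have "cut_closed G x (lift (extend Z))" using l by (auto simp: cut_closed_def)
  moreover have "x \<in> extend Z" using Z(2) by (simp add: extend_def)
  then have "x \<in> lift (extend Z)" using lift_sup by blast
  moreover have xE: "x \<in> E" using x R_E by blast
  ultimately have "einv G x \<in> lift (extend Z)" using b E_sub bridgeless_iff[OF rib] by blast
  then have bx: "\<beta> x \<in> extend Z" using lift_E[OF e(1,2)] einv_E \<beta>_E xE by auto
  have "t x \<in> Z"
  proof (cases "\<beta> x \<in> R")
    case True
    then have "t x = \<beta> x" using t_w[OF xE] w_eq_R by simp
    then show ?thesis using bx True R_B by (auto simp: extend_def)
  next
    case False
    then have "t (t (\<beta> x)) \<in> Z" using bx ZR by (auto simp: extend_def)
    then show ?thesis using t_\<beta>[OF xE] t_t(1)[OF x] by simp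
  qed
  then show "einv K x \<in> Z" using einv_K[OF x] by simp
qed

text \<open>An edge inside a component of \<open>H\<close> is no bridge since the component is a
  generator. For an edge of the quotient, the walks from its two halves start by crossing it, so a
  separating \<open>Z\<close> would contain exactly one end of its chain, and
  \<open>Z \<inter> R\<close> would make the merged edge a bridge of \<open>K\<close>.\<close>

lemma bridgeless_G: "bridgeless K \<Longrightarrow> bridgeless G"
  unfolding bridgeless_iff[OF rib]
proof (intro ballI allI impI)
  fix x Z assume b: "bridgeless K" and x: "x \<in> S" and Z: "cut_closed G x Z" "x \<in> Z"
  have ZS: "Z \<subseteq> S" and Zv: "\<And>z. z \<in> Z \<Longrightarrow> vperm G z \<in> Z"
    and Ze: "\<And>z. z \<in> Z \<Longrightarrow> z \<noteq> x \<Longrightarrow> z \<noteq> einv G x \<Longrightarrow> einv G z \<in> Z"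
    using Z(1) by (auto simp: cut_closed_def)
  show "einv G x \<in> Z"
  proof (cases "x \<in> E")
    case False
    let ?C = "component_of H x"
    let ?I = "induced_graph H ?C"
    note C = component_data[OF component_in[OF x]]
    note cl = graph_closedD[OF C(1)]
    have Isel: "half_edges ?I = ?C" "\<And>z. z \<in> ?C \<Longrightarrow> vperm ?I z = vperm G z"
      "\<And>z. z \<in> ?C \<Longrightarrow> einv ?I z = einv H z"
      by (simp_all add: induced_graph_def perm_restrict_def H_sel)
    have xC: "x \<in> ?C" by (rule component_of_self)
    have "cut_closed ?I x (Z \<inter> ?C)"
      unfolding cut_closed_def
    proof (intro conjI ballI impI)
      fix z assume z: "z \<in> Z \<inter> ?C"
      show "vperm ?I z \<in> Z \<inter> ?C" using z Isel Zv cl(2) by (simp add: H_sel)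
      assume "z \<noteq> x" "z \<noteq> einv ?I x"
      then have "z \<noteq> x" "z \<noteq> einv G x" using Isel(3)[OF xC] einv_outside[OF False] by auto
      then show "einv ?I z \<in> Z \<inter> ?C"
        using z Isel(3)[of z] cl(3)[of z] Ze[of z] einv_outside[of z] E_iff[of z] by (cases "z \<in> E") auto
    qed (simp add: Isel)
    moreover have "ribbon_graph ?I" "bridgeless ?I" using n_point_generatingD(1,3)[OF C(8)] by auto
    ultimately have "einv ?I x \<in> Z" using Z(2) xC bridgeless_iff[of ?I] Isel(1) by blast
    then show ?thesis using Isel(3)[OF xC] einv_outside[OF False] by simp
  next
    case True
    show ?thesis
    proof (rule ccontr)
      assume "einv G x \<notin> Z"
      then have bx: "\<beta> x \<notin> Z" "\<beta> x \<noteq> x" using \<beta>_E[OF True] Z(2) by auto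
      have bE: "\<beta> x \<in> E" using True \<beta>_in by simp
      have "einv H z \<in> Z" if "z \<in> Z" for z
      proof (cases "z \<in> E")
        case False
        then show ?thesis using Ze[OF that] einv_outside[OF False] True einv_E by metis
      qed (use that E_iff in auto)
      then have ZH: "graph_closed H Z" using ZS Zv by (simp add: graph_closed_def H_sel)
      have Zs: "s0 z \<in> Z" if "z \<in> Z" "z \<in> E" for z using s0_closed[OF ZH that] .
      have Z\<beta>: "\<beta> z \<in> Z" if "z \<in> Z" "z \<in> E" "z \<noteq> x" "z \<noteq> \<beta> x" for z
        using Ze[of z] that \<beta>_E True by simp
      let ?Y = "S - Z"
      have YH: "graph_closed H ?Y" using graph_closed_Diff[OF H_sel(1) ZH] H_sel(2) by simp
      have Ys: "s0 z \<in> ?Y" if "z \<in> ?Y" "z \<in> E" for z using s0_closed[OF YH that] .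
      have Y\<beta>: "\<beta> z \<in> ?Y" if z: "z \<in> ?Y" "z \<in> E" "z \<noteq> x" "z \<noteq> \<beta> x" for z
      proof -
        have "\<beta> z \<in> Z \<Longrightarrow> \<beta> (\<beta> z) \<in> Z"
          using Z\<beta>[of "\<beta> z"] z \<beta>_in \<beta>_\<beta> by metis
        then show ?thesis using z \<beta>_\<beta> \<beta>_in E_sub by auto
      qed
      have "t x \<in> ?Y" using walk_across[OF True bx(2), of ?Y] Ys Y\<beta> bx(1) bE E_sub by blast
      then have r: "t x \<notin> Z" by blast
      have "t (\<beta> x) \<in> Z"
        by (rule walk_across) (use bE bx \<beta>_\<beta> Z(2) Zs Z\<beta> in auto)
      then have u: "t (t x) \<in> Z" using t_\<beta>[OF True] by simp
      have tR: "t x \<in> R" "t (t x) \<in> R" using t_in_R[OF True] t_in_R R_E by blast+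
      have "cut_closed K (t (t x)) (Z \<inter> R)" unfolding cut_closed_def K_sel(1)
      proof (intro conjI ballI impI)
        fix z assume z: "z \<in> Z \<inter> R"
        then have zE: "z \<in> E" using R_E by blast
        show "vperm K z \<in> Z \<inter> R" using z Zs[OF _ zE] R_s0 by (simp add: vperm_K)
        assume "z \<noteq> t (t x)" "z \<noteq> einv K (t (t x))"
        then have ne: "z \<noteq> t (t x)" "z \<noteq> t x" using einv_K[OF tR(2)] t_t(1)[OF tR(1)] by auto
        have zz: "t (t z) = z" using z t_t(1) by blast
        \<comment> \<open>A walk using the cut edge ends where the walks from the two halves of that
          edge end, at \<open>t x\<close> or \<open>t (t x)\<close>; then \<open>z\<close> would be
          one of these.\<close>
        have "(w ^^ i) z \<noteq> x \<and> (w ^^ i) z \<noteq> \<beta> x" if "i < hit_time w R z" for i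
          using t_along[OF zE that] ne zz t_\<beta>[OF True] t_t(1)[OF tR(1)] by metis
        then have "t z \<in> Z" using z zE Zs Z\<beta> by (intro walk[of z Z x]) auto
        then show "einv K z \<in> Z \<inter> R" using z t_in_R[OF zE] by (simp add: einv_K)
      qed blast
      then have "einv K (t (t x)) \<in> Z"
        using b tR(2) u unfolding bridgeless_iff[OF rib_K] K_sel(1) by blast
      then show False using einv_K[OF tR(2)] t_t(1)[OF tR(1)] r by simp
    qed
  qed
qed

lemma single_boundary_iff: "single_boundary G \<longleftrightarrow> single_boundary K"
proof -
  have "y \<in> orbit (face_perm K) x \<longleftrightarrow> y \<in> orbit (face_perm G) x"
    if "x \<in> external G" "y \<in> external G" for x y
    using that external_R orbit_face_K[of x] by blast
  then show ?thesis unfolding single_boundary_def external_K by blast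
qed

text \<open>Internal faces of \<open>G\<close> meeting \<open>R\<close> restrict bijectively to
  those of \<open>K\<close>. A face missing \<open>R\<close> misses \<open>E\<close> too, because
  every walk from \<open>E\<close> reaches \<open>R\<close>; off \<open>E\<close> the face
  permutations of \<open>G\<close> and \<open>H\<close> agree, so these faces are the internal faces
  of \<open>H\<close>.\<close>

lemma loop_order_eq: "loop_order G = loop_order K + loop_order H"
proof -
  let ?X = "external G"
  note pG = face_perm_permutes[OF rib]
  have XR: "?X \<subseteq> R" by (rule external_R)
  have self: "x \<in> orbit (face_perm G) x" for x by (rule permutes_self_in_orbit[OF pG r(1)])
  define F1 where "F1 = {c \<in> internal_faces G. c \<inter> R \<noteq> {}}"
  define F2 where "F2 = {c \<in> internal_faces G. c \<inter> R = {}}"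
  have fin: "finite (internal_faces G)" using r(1) by (simp add: internal_faces_def faces_def cycles_def)
  have split: "internal_faces G = F1 \<union> F2" "F1 \<inter> F2 = {}" by (auto simp: F1_def F2_def)
  have F1K: "internal_faces K = (\<lambda>c. c \<inter> R) ` F1"
  proof (intro equalityI subsetI)
    fix c assume "c \<in> internal_faces K"
    then obtain x where x: "x \<in> R" "c = orbit (face_perm K) x" "c \<inter> ?X = {}"
      by (auto simp: internal_faces_def faces_def cycles_def K_sel(1) external_K)
    let ?d = "orbit (face_perm G) x"
    have c: "c = ?d \<inter> R" using x orbit_face_K by simp
    moreover have "?d \<inter> ?X = {}" using c x(3) XR by blast
    moreover have "x \<in> S" using x(1) R_E E_sub by blast
    ultimately show "c \<in> (\<lambda>c. c \<inter> R) ` F1"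
      using self[of x] x(1) unfolding F1_def internal_faces_def faces_def cycles_def by blast
  next
    fix c assume "c \<in> (\<lambda>c. c \<inter> R) ` F1"
    then obtain d x where d: "c = d \<inter> R" "x \<in> S" "d = orbit (face_perm G) x" "d \<inter> ?X = {}" "d \<inter> R \<noteq> {}"
      unfolding F1_def internal_faces_def faces_def cycles_def by blast
    obtain y where y: "y \<in> d" "y \<in> R" using d(5) by blast
    have "d = orbit (face_perm G) y" using permutes_orbit_eq[OF pG r(1)] y(1) d(3) by simp
    then have "c = orbit (face_perm K) y" using d(1) orbit_face_K[OF y(2)] by simp
    then show "c \<in> internal_faces K"
      using y(2) d(1,4) by (auto simp: internal_faces_def faces_def cycles_def K_sel(1) external_K)
  qed
  have inj: "inj_on (\<lambda>c. c \<inter> R) F1"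
  proof (rule inj_onI)
    fix c d assume cd: "c \<in> F1" "d \<in> F1" "c \<inter> R = d \<inter> R"
    then obtain y where y: "y \<in> c" "y \<in> d" unfolding F1_def by blast
    have "c = orbit (face_perm G) y" if "c \<in> F1" "y \<in> c" for c
    proof -
      obtain x where "c = orbit (face_perm G) x"
        using \<open>c \<in> F1\<close> by (auto simp: F1_def internal_faces_def faces_def cycles_def)
      then show ?thesis using permutes_orbit_eq[OF pG r(1)] \<open>y \<in> c\<close> by simp
    qed
    then show "c = d" using cd y by metis
  qed
  have noE: "orbit (face_perm G) x \<inter> E = {}" if "orbit (face_perm G) x \<inter> R = {}" for x
  proof (rule ccontr)
    assume "orbit (face_perm G) x \<inter> E \<noteq> {}"
    then obtain y where y: "y \<in> orbit (face_perm G) x" "y \<in> E" by blast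
    have "hits f0 R y" using hit_f0(1) hits_E[OF y(2)] .
    then have "orbit f0 y \<inter> R \<noteq> {}" by (simp add: hits_iff_orbit)
    moreover have "orbit f0 y = orbit (face_perm G) y \<inter> E"
      unfolding f0_eq by (rule first_return_orbit[OF pG r(1) E_sub y(2)])
    ultimately show False using that permutes_orbit_eq[OF pG r(1) y(1)] by blast
  qed
  have agree: "orbit (face_perm H) x = orbit (face_perm G) x"
    if "orbit p x \<inter> E = {}" "p = face_perm G \<or> p = face_perm H" for p x
  proof -
    have e: "face_perm G y = face_perm H y" if "y \<notin> E" for y
      using einv_outside[OF that] by (simp add: H_sel)
    have pH: "face_perm H permutes S" using face_perm_permutes[OF H_sel(1)] H_sel(2) by simp
    have "x \<in> orbit p x" using that(2) permutes_self_in_orbit[OF pG r(1)] permutes_self_in_orbit[OF pH r(1)] by blast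
    moreover have "q y = p y" if "y \<in> orbit p x" "q = face_perm G \<or> q = face_perm H" for q y
      using e[of y] that \<open>orbit p x \<inter> E = {}\<close> \<open>p = face_perm G \<or> p = face_perm H\<close> by (metis disjoint_iff)
    ultimately have "orbit q x = orbit p x" if "q = face_perm G \<or> q = face_perm H" for q
      using that by (intro orbit_cong) auto
    then show ?thesis by blast
  qed
  have F2H: "F2 = internal_faces H"
  proof (intro equalityI subsetI)
    fix c assume "c \<in> F2"
    then obtain x where x: "x \<in> S" "c = orbit (face_perm G) x" "c \<inter> R = {}"
      unfolding F2_def internal_faces_def faces_def cycles_def by blast
    then show "c \<in> internal_faces H"
      using noE[of x] agree[of "face_perm G" x] unfolding internal_faces_def faces_def cycles_def H_sel(2) by blast
  next
    fix c assume "c \<in> internal_faces H"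
    then obtain x where x: "x \<in> S" "c = orbit (face_perm H) x" "c \<inter> E = {}"
      unfolding internal_faces_def faces_def cycles_def H_sel(2) by blast
    then show "c \<in> F2"
      using agree[of "face_perm H" x] XR R_E unfolding F2_def internal_faces_def faces_def cycles_def by blast
  qed
  have "loop_order G = card F1 + card F2"
    unfolding loop_order_def split(1) using fin split by (intro card_Un_disjoint) auto
  moreover have "loop_order K = card F1" unfolding loop_order_def F1K by (rule card_image[OF inj])
  ultimately show ?thesis unfolding F2H loop_order_def by simp
qed

text \<open>Passing from \<open>G\<close> to \<open>K\<close> subtracts the loop order of
  \<open>H\<close> and changes the number of half edges from \<open>card S\<close> to
  \<open>card R\<close>; by \<open>loop_H\<close> this leaves the relation for genus zero
  intact.\<close>

lemma n_point_generating_iff_K: "n_point_generating n G \<longleftrightarrow> n_point_generating n K"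
proof -
  have "(4 * loop_order G + 2 * n = card S + 4) \<longleftrightarrow> (4 * loop_order K + 2 * n = card R + 4)"
    using loop_order_eq loop_H by linarith
  then show ?thesis
    unfolding n_point_generating_iff
    using rib rib_K connected_iff bridgeless_K bridgeless_G single_boundary_iff card_orbit_K
      card_orbit_vperm by (auto simp: external_K K_sel(1))
qed

end

section \<open>Excluding degenerate chains\<close>

context contraction
begin

text \<open>The 2-point component at \<open>x\<close> is closed in \<open>G\<close> apart from the
  edge at \<open>s0 x\<close>. As this edge is no bridge, its other half lies in the component too;
  it is not the external \<open>x\<close>, so \<open>s0 x\<close> is external as well.\<close>

lemma bivalent_external_closed:
  assumes b: "bridgeless G" and x: "x \<in> external G" "x \<in> B"
  shows "\<beta> (s0 x) = s0 x" "graph_closed G (lift {x, s0 x})" "lift {x, s0 x} \<inter> E = {x, s0 x}"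
proof -
  let ?y = "s0 x"
  have y: "?y \<in> B" "?y \<noteq> x" "s0 ?y = x" using x B_s0 s0_B by auto
  have sub: "{x, ?y} \<subseteq> E" using x(2) y(1) B_E by blast
  have s: "s0 z \<in> {x, ?y}" if "z \<in> {x, ?y}" for z using that y by auto
  have bx: "\<beta> x = x" using x sub \<beta>_E by (auto simp: external_iff)
  show l: "lift {x, ?y} \<inter> E = {x, ?y}" by (rule lift_E[OF sub s])
  have st: "\<beta> z \<in> {x, ?y}" if "z \<in> {x, ?y}" "z \<notin> {?y}" for z using that bx by auto
  note ls = lift_step[of "{x, ?y}" "{?y}", OF sub s st]
  have "cut_closed G ?y (lift {x, ?y})" using ls by (auto simp: cut_closed_def)
  moreover have "?y \<in> lift {x, ?y}" using lift_sup by blast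
  moreover have "?y \<in> S" using sub E_sub by blast
  ultimately have "einv G ?y \<in> lift {x, ?y}" using b bridgeless_iff[OF rib] by blast
  then have "\<beta> ?y \<in> {x, ?y}" using l sub einv_E \<beta>_E by auto
  moreover have "\<beta> ?y \<noteq> x" using bx y(2) \<beta>_\<beta> by metis
  ultimately show \<beta>y: "\<beta> ?y = ?y" by blast
  show "graph_closed G (lift {x, ?y})" by (rule lift_closed_G[OF sub s]) (use bx \<beta>y in auto)
qed

text \<open>Either defect yields a nonempty closed set of \<open>G\<close> that meets
  \<open>E\<close> only in bivalent half edges: the component of a bivalent external half edge, or
  all components at which walks never reach \<open>R\<close>. By connectedness it is the whole
  graph, contradicting \<open>R \<noteq> {}\<close>.\<close>

lemma full_contraction:
  assumes "n_point_generating n G" "R \<noteq> {}"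
  shows "full_contraction G H"
proof unfold_locales
  note d = n_point_generatingD[OF assms(1)]
  have conn: "Z = S" if "graph_closed G Z" "Z \<noteq> {}" for Z
    using d(2) that connected_graph_iff[OF rib] by blast
  show "external G \<subseteq> R"
  proof (rule ccontr)
    assume "\<not> external G \<subseteq> R"
    then obtain x where x: "x \<in> external G" "x \<in> B" using external_E E_un by blast
    have "lift {x, s0 x} = S"
      using bivalent_external_closed(2)[OF d(3) x] conn lift_sup[of "{x, s0 x}"] by blast
    then have "E = {x, s0 x}" using bivalent_external_closed(3)[OF d(3) x] E_sub by blast
    then have "E \<subseteq> B" using x(2) B_s0 by auto
    then show False using assms(2) E_un R_B by blast
  qed
  show "hits w R y" if "y \<in> E" for y
  proof (rule ccontr)
    assume "\<not> hits w R y"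
    define Z where "Z = {y \<in> E. \<not> hits w R y}"
    have ZB: "Z \<subseteq> B" using hits_R E_un by (auto simp: Z_def)
    have Zw: "w z \<in> Z" if "z \<in> Z" for z
    proof -
      have "w z \<notin> R"
      proof
        assume "w z \<in> R"
        then have "hits w R z" unfolding hits_def by (intro exI[of _ 1]) simp
        then show False using that by (simp add: Z_def)
      qed
      then show ?thesis using that hits_step[of w z R] w_in by (auto simp: Z_def)
    qed
    have Zs: "s0 z \<in> Z" if z: "z \<in> Z" for z
    proof (rule ccontr)
      assume "s0 z \<notin> Z"
      have zB: "z \<in> B" "s0 z \<in> B" "s0 (s0 z) = z" using z ZB B_s0 s0_B by auto
      then have h: "hits w R (s0 z)" using \<open>s0 z \<notin> Z\<close> B_E by (auto simp: Z_def)
      then have "hits w R z" using t_s0(1)[OF zB(2) h] zB(3) by simp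
      then show False using z by (simp add: Z_def)
    qed
    have Z\<beta>: "\<beta> z \<in> Z" if "z \<in> Z" for z
    proof -
      have "\<beta> z = sB (w z)" by (simp add: w_def sB_sB)
      also have "\<dots> = s0 (w z)" using Zw[OF that] ZB sB_B by blast
      finally show ?thesis using Zs[OF Zw[OF that]] by simp
    qed
    have ZE: "Z \<subseteq> E" by (auto simp: Z_def)
    have "y \<in> Z" using that \<open>\<not> hits w R y\<close> by (simp add: Z_def)
    then have "lift Z = S" using conn[OF lift_closed_G[OF ZE Zs Z\<beta>]] lift_sup by blast
    then have "E \<subseteq> B" using lift_E[OF ZE Zs] ZB E_sub by blast
    then show False using assms(2) E_un R_B by blast
  qed
qed

text \<open>An external half edge is now bivalent, so its 2-point component is closed and exhausts
  the graph. Both elements of \<open>E\<close> are external in \<open>G\<close>, and no edge is left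
  outside \<open>H\<close>.\<close>

lemma no_four_point_component:
  assumes "n_point_generating n G" "R = {}"
  shows "n = 2" "H = G"
proof -
  note d = n_point_generatingD[OF assms(1)]
  obtain x where x: "x \<in> external G" using d(4) by (auto simp: single_boundary_def)
  have xB: "x \<in> B" using x external_E E_un assms(2) by blast
  note c = bivalent_external_closed[OF d(3) x xB]
  have "lift {x, s0 x} = S"
    using c(2) d(2) connected_graph_iff[OF rib] lift_sup[of "{x, s0 x}"] by blast
  then have E: "E = {x, s0 x}" using c(3) E_sub by blast
  have ext: "einv G z = z" if "z \<in> E" for z
    using that c(1) x \<beta>_E[OF that] E by (auto simp: external_iff)
  have "external G = E" using external_E ext E_sub by (auto simp: external_iff)
  then show "n = 2" using d(5) E s0_B(2)[OF xB] by simp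
  have "einv H = einv G"
    using ext einv_outside E_iff by (metis HOL.ext)
  then show "H = G" using H_sel by (intro ribbon_graph.equality) simp_all
qed

text \<open>Accounts for the one term in the coproduct of a 2-point graph whose right factor is the
  open edge.\<close>

lemma whole_graph_K_empty: "n_point_generating 2 G \<Longrightarrow> H = G \<Longrightarrow> R = {}"
proof -
  assume g: "n_point_generating 2 G" and H: "H = G"
  note d = n_point_generatingD[OF g]
  have "components H = {S}" unfolding H
    by (rule connected_components[OF rib d(2) n_point_generating_nonempty[OF g]])
  then have "card (E \<inter> S) = 2 \<and> (\<forall>x\<in>E \<inter> S. orbit s0 x = E \<inter> S)"
    using component_data(5)[of S] d(5) E_sub H by (auto simp: Int_absorb2)
  then show "R = {}" using E_sub by (auto simp: R_def B_def)
qed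

end

section \<open>Decorations\<close>

definition component_class :: "nat \<Rightarrow> nat ribbon_graph \<Rightarrow> nat \<Rightarrow> (nat ribbon_graph \<times> nat) set" where
  "component_class n H x = label_class n (induced_graph H (component_of H x)) x"

text \<open>A chart identifies the contracted graph with \<open>\<Gamma>\<close> via \<open>\<psi>\<close>. The vertices and edges of \<open>\<Gamma>\<close> are
  marked by their least half edges; a vertex is decorated by the class of the component of \<open>H\<close>
  inserted there, an edge by the list of classes met on the walk along it.\<close>

definition edge_length :: "nat ribbon_graph \<Rightarrow> nat ribbon_graph \<Rightarrow> (nat \<Rightarrow> nat) \<Rightarrow> nat set \<Rightarrow> nat" where
  "edge_length G H \<psi> e = hit_time (contraction.w G H) (contraction.R G H) (\<psi> (Min e)) - 1"

text \<open>The half edge by which the walk enters the next bivalent vertex, used as root of the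
  2-point piece there. The walk to \<open>R\<close> takes one step more than it passes such
  vertices, whence the subtraction in \<open>edge_length\<close>.\<close>

definition edge_point :: "nat ribbon_graph \<Rightarrow> nat ribbon_graph \<Rightarrow> (nat \<Rightarrow> nat) \<Rightarrow> nat set \<Rightarrow> nat \<Rightarrow> nat" where
  "edge_point G H \<psi> e i = contraction.\<beta> G H ((contraction.w G H ^^ i) (\<psi> (Min e)))"

definition vertex_deco ::
    "nat ribbon_graph \<Rightarrow> (nat \<Rightarrow> nat) \<Rightarrow> nat set \<Rightarrow> (nat ribbon_graph \<times> nat) set" where
  "vertex_deco H \<psi> c = component_class 4 H (\<psi> (Min c))"

definition edge_deco ::
    "nat ribbon_graph \<Rightarrow> nat ribbon_graph \<Rightarrow> (nat \<Rightarrow> nat) \<Rightarrow> nat set \<Rightarrow> (nat ribbon_graph \<times> nat) set list" where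
  "edge_deco G H \<psi> e = map (\<lambda>i. component_class 2 H (edge_point G H \<psi> e i)) [0..<edge_length G H \<psi> e]"

lemma vertex_Min:
  assumes "ribbon_graph \<Gamma>" "c \<in> vertices \<Gamma>"
  shows "Min c \<in> c" "c \<subseteq> half_edges \<Gamma>" "c = orbit (vperm \<Gamma>) (Min c)"
proof -
  note r = ribbon_graphD[OF assms(1)]
  obtain x where x: "x \<in> half_edges \<Gamma>" "c = orbit (vperm \<Gamma>) x"
    using assms(2) by (auto simp: vertices_def cycles_def)
  show s: "c \<subseteq> half_edges \<Gamma>" using permutes_orbit_subset[OF r(2) x(1)] x(2) by simp
  have "finite c" using s r(1) by (rule finite_subset)
  then show m: "Min c \<in> c" using x(2) orbit_nonempty[of "vperm \<Gamma>" x] by (intro Min_in) auto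
  show "c = orbit (vperm \<Gamma>) (Min c)" using permutes_orbit_eq[OF r(2,1), of "Min c" x] m x(2) by simp
qed

lemma edge_Min:
  assumes "ribbon_graph \<Gamma>" "e \<in> internal_edges \<Gamma>"
  shows "Min e \<in> half_edges \<Gamma>" "e = {Min e, einv \<Gamma> (Min e)}" "einv \<Gamma> (Min e) \<noteq> Min e"
proof -
  note r = ribbon_graphD[OF assms(1)]
  obtain x where x: "x \<in> half_edges \<Gamma>" "einv \<Gamma> x \<noteq> x" "e = {x, einv \<Gamma> x}"
    using assms(2) by (auto simp: internal_edges_def)
  have "Min e = x \<or> Min e = einv \<Gamma> x" unfolding x(3) by (auto simp: min_def)
  then show "Min e \<in> half_edges \<Gamma>" "e = {Min e, einv \<Gamma> (Min e)}" "einv \<Gamma> (Min e) \<noteq> Min e"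
    using x r(4)[of x] r(6)[of x] by auto
qed

lemma internal_edgeI: "x \<in> half_edges \<Gamma> \<Longrightarrow> einv \<Gamma> x \<noteq> x \<Longrightarrow> {x, einv \<Gamma> x} \<in> internal_edges \<Gamma>"
  by (auto simp: internal_edges_def)

locale chart = full_contraction G H for G H :: "nat ribbon_graph" +
  fixes \<Gamma> :: "nat ribbon_graph" and \<psi> :: "nat \<Rightarrow> nat"
  assumes rib_\<Gamma>: "ribbon_graph \<Gamma>" and \<psi>: "graph_iso \<psi> \<Gamma> K"
begin

sublocale \<psi>: graph_isomorphism \<psi> \<Gamma> K
  by unfold_locales (rule \<psi> rib_\<Gamma> rib_K)+

lemma \<psi>_R: "y \<in> half_edges \<Gamma> \<Longrightarrow> \<psi> y \<in> R"
  using graph_isoD(4)[OF \<psi>] K_sel(1) by simp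

lemma \<psi>_surj: "z \<in> R \<Longrightarrow> \<exists>y \<in> half_edges \<Gamma>. z = \<psi> y"
  using graph_isoD(3)[OF \<psi>] K_sel(1) by auto

lemma \<psi>_inj: "x \<in> half_edges \<Gamma> \<Longrightarrow> y \<in> half_edges \<Gamma> \<Longrightarrow> \<psi> x = \<psi> y \<Longrightarrow> x = y"
  using graph_isoD(2)[OF \<psi>] by (auto dest: inj_onD)

lemma \<psi>_vperm: "y \<in> half_edges \<Gamma> \<Longrightarrow> \<psi> (vperm \<Gamma> y) = s0 (\<psi> y)"
  using graph_isoD(5)[OF \<psi>] vperm_K[OF \<psi>_R] by simp

lemma \<psi>_einv: "y \<in> half_edges \<Gamma> \<Longrightarrow> \<psi> (einv \<Gamma> y) = t (\<psi> y)"
  using graph_isoD(6)[OF \<psi>] einv_K[OF \<psi>_R] by simp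

lemma external_\<Gamma>: "y \<in> half_edges \<Gamma> \<Longrightarrow> \<psi> y \<in> external G \<longleftrightarrow> einv \<Gamma> y = y"
  using \<psi>.external[of y] by (simp add: external_iff flip: external_K)

abbreviation len :: "nat set \<Rightarrow> nat" where "len e \<equiv> edge_length G H \<psi> e"
abbreviation ep :: "nat set \<Rightarrow> nat \<Rightarrow> nat" where "ep e i \<equiv> edge_point G H \<psi> e i"

lemma ep_eq: "ep e i = \<beta> ((w ^^ i) (\<psi> (Min e)))" by (simp add: edge_point_def)

lemma hit_time_len: "e \<in> internal_edges \<Gamma> \<Longrightarrow> hit_time w R (\<psi> (Min e)) = Suc (len e)"
  using hit_time_hits(1)[OF hits_R[OF \<psi>_R[OF edge_Min(1)[OF rib_\<Gamma>]]]] by (simp add: edge_length_def)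

lemma walk_in_B:
  assumes "e \<in> internal_edges \<Gamma>" "i < len e"
  shows "ep e i \<in> B" "(w ^^ Suc i) (\<psi> (Min e)) \<in> B" "(w ^^ Suc i) (\<psi> (Min e)) = s0 (ep e i)"
proof -
  have "(w ^^ k) (\<psi> (Min e)) \<in> E" for k
    using \<psi>_R[OF edge_Min(1)[OF rib_\<Gamma> assms(1)]] R_E by (induction k) (auto simp: w_in)
  moreover have "(w ^^ Suc i) (\<psi> (Min e)) \<notin> R"
    using assms hit_time_len by (intro before_hit_time) auto
  ultimately show *: "(w ^^ Suc i) (\<psi> (Min e)) \<in> B" using E_un by blast
  then show "ep e i \<in> B" unfolding ep_eq using w_B by simp
  then show "(w ^^ Suc i) (\<psi> (Min e)) = s0 (ep e i)" unfolding ep_eq using w_eq_B by simp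
qed

lemma walk_end: "e \<in> internal_edges \<Gamma> \<Longrightarrow> \<beta> ((w ^^ len e) (\<psi> (Min e))) = \<psi> (einv \<Gamma> (Min e))"
proof -
  assume e: "e \<in> internal_edges \<Gamma>"
  note m = edge_Min(1)[OF rib_\<Gamma> e]
  have t: "t (\<psi> (Min e)) = w ((w ^^ len e) (\<psi> (Min e)))"
    using hit_time_len[OF e] by (simp add: hit_def)
  have "w ((w ^^ len e) (\<psi> (Min e))) \<in> R" using t_R[OF hits_R[OF \<psi>_R[OF m]]] t by simp
  then have "w ((w ^^ len e) (\<psi> (Min e))) = \<beta> ((w ^^ len e) (\<psi> (Min e)))"
    using w_R w_eq_R by blast
  then show ?thesis using t \<psi>_einv[OF m] by simp
qed

text \<open>A half edge in \<open>R\<close> is the marked or the other end of its edge. A bivalent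
  one is found by walking to some end in \<open>R\<close> and back; whether it occurs as left or as
  entered depends on which end is the marked one.\<close>

lemma walk_cover:
  assumes z: "z \<in> E" "z \<notin> external G"
  obtains e i where "e \<in> internal_edges \<Gamma>" "i \<le> len e"
    "z = (w ^^ i) (\<psi> (Min e)) \<or> z = \<beta> ((w ^^ i) (\<psi> (Min e)))"
proof -
  have h: "hits w R z" using hits_E z(1) .
  let ?n = "hit_time w R z"
  have n: "0 < ?n" by (rule hit_time_hits(1)[OF h])
  show ?thesis
  proof (cases "z \<in> R")
    case True
    obtain y where y: "y \<in> half_edges \<Gamma>" "z = \<psi> y" using \<psi>_surj[OF True] by blast
    let ?e = "{y, einv \<Gamma> y}"
    have "einv \<Gamma> y \<noteq> y" using external_\<Gamma>[OF y(1)] z(2) y(2) by simp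
    then have e: "?e \<in> internal_edges \<Gamma>" by (rule internal_edgeI[OF y(1)])
    have "Min ?e = y \<or> Min ?e = einv \<Gamma> y" by (auto simp: min_def)
    then show ?thesis
    proof
      assume "Min ?e = y"
      then show ?thesis using that[OF e, of 0] y(2) by simp
    next
      assume m: "Min ?e = einv \<Gamma> y"
      have X: "\<psi> (Min ?e) = t z" using m \<psi>_einv[OF y(1)] y(2) by simp
      have "\<psi> (einv \<Gamma> (Min ?e)) = z" using m ribbon_graphD(4)[OF rib_\<Gamma>] y(2) by simp
      then show ?thesis using that[OF e, of "len ?e"] walk_end[OF e] by simp
    qed
  next
    case False
    then have zB: "z \<in> B" using z(1) E_un by blast
    let ?r = "t z"
    have r: "?r \<in> R" by (rule t_R[OF h])
    have wr: "(w ^^ ?n) ?r = s0 z" using walk_back[OF h, of ?n] zB by (simp add: sB_B)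
    \<comment> \<open>Seen from \<open>?r\<close>, the vertex of \<open>z\<close> comes before the
      next element of \<open>R\<close>: on the way back only images under \<open>sB\<close> of
      points outside \<open>R\<close> are met.\<close>
    have N: "?n < hit_time w R ?r"
    proof (rule ccontr)
      let ?N = "hit_time w R ?r"
      assume "\<not> ?n < ?N"
      then have N: "?N \<le> ?n" by simp
      have "(w ^^ ?N) ?r = sB ((w ^^ (?n - ?N)) z)" by (rule walk_back[OF h N])
      moreover have "(w ^^ (?n - ?N)) z \<notin> R"
        using before_hit_time[of "?n - ?N" w R z] False hit_time_hits(1)[OF hits_R[OF r]]
        by (cases "?n - ?N = 0") auto
      ultimately show False using hit_time_hits(2)[OF hits_R[OF r]] sB_in(3) by (simp add: hit_def)
    qed
    obtain y where y: "y \<in> half_edges \<Gamma>" "?r = \<psi> y" using \<psi>_surj[OF r] by blast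
    have "einv \<Gamma> y \<noteq> y"
    proof
      assume "einv \<Gamma> y = y"
      then have "\<psi> y \<in> external G" using external_\<Gamma>[OF y(1)] by simp
      then have "\<beta> ?r = ?r" using y(2) external_E \<beta>_E by (auto simp: external_iff)
      then have "w ?r = ?r" using w_eq_R[of ?r] r by simp
      then have "(w ^^ k) ?r = ?r" for k by (induction k) simp_all
      then show False using wr r zB B_s0 R_B by metis
    qed
    then have e: "{y, einv \<Gamma> y} \<in> internal_edges \<Gamma>" (is "?e \<in> _") by (rule internal_edgeI[OF y(1)])
    have "Min ?e = y \<or> Min ?e = einv \<Gamma> y" by (auto simp: min_def)
    then show ?thesis
    proof
      assume m: "Min ?e = y"
      obtain k where k: "?n = Suc k" using n gr0_implies_Suc by blast
      have "s0 z = w ((w ^^ k) ?r)" using wr k by simp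
      then have "sB z = sB (\<beta> ((w ^^ k) ?r))" using zB by (simp add: sB_B w_def)
      then have "z = \<beta> ((w ^^ k) ?r)" using sB_sB by metis
      moreover have "k \<le> len ?e" using hit_time_len[OF e] N k m y(2) by simp
      ultimately show ?thesis using that[OF e, of k] m y(2) by simp
    next
      assume m: "Min ?e = einv \<Gamma> y"
      have X: "\<psi> (Min ?e) = t ?r" using m \<psi>_einv[OF y(1)] y(2) by simp
      let ?N = "hit_time w R ?r"
      have "(w ^^ (?N - ?n)) (t ?r) = sB ((w ^^ ?n) ?r)"
        using walk_back[OF hits_R[OF r], of "?N - ?n"] N by simp
      also have "\<dots> = z" using wr zB by (simp add: sB_B B_s0 s0_B(1))
      finally have "z = (w ^^ (?N - ?n)) (\<psi> (Min ?e))" using X by simp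
      moreover have "?N - ?n \<le> len ?e" using hit_time_len[OF e] n t_t(2)[OF r] X by simp
      ultimately show ?thesis using that[OF e, of "?N - ?n"] by blast
    qed
  qed
qed

text \<open>The positions of the pieces: one for each vertex of \<Gamma> and one for each bivalent
  vertex along its edges.\<close>

definition index_set :: "(nat set + nat set \<times> nat) set" where
  "index_set = Inl ` vertices \<Gamma> \<union> Inr ` Sigma (internal_edges \<Gamma>) (\<lambda>e. {..<len e})"

definition base_point :: "nat set + nat set \<times> nat \<Rightarrow> nat" where
  "base_point j = (case j of Inl c \<Rightarrow> \<psi> (Min c) | Inr (e, i) \<Rightarrow> ep e i)"

lemma vertex_point: "c \<in> vertices \<Gamma> \<Longrightarrow> \<psi> (Min c) \<in> R"
  using \<psi>_R vertex_Min[OF rib_\<Gamma>] by blast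

lemma base_point_E: "j \<in> index_set \<Longrightarrow> base_point j \<in> E"
  using vertex_point walk_in_B(1) R_E B_E by (fastforce simp: index_set_def base_point_def)

lemma same_component_orbit:
  assumes "x \<in> E" "y \<in> E"
  shows "component_of H x = component_of H y \<longleftrightarrow> orbit s0 x = orbit s0 y"
proof
  assume "orbit s0 x = orbit s0 y"
  then have "x \<in> component_of H y" using orbit_s0[OF assms(2)] self_orbit_s0[of x] by blast
  then show "component_of H x = component_of H y" by (rule component_of_eq)
qed (simp add: orbit_s0 assms)

lemma orbit_\<psi>: "y \<in> half_edges \<Gamma> \<Longrightarrow> orbit s0 (\<psi> y) = \<psi> ` orbit (vperm \<Gamma>) y"
  by (rule orbit_intertwine[where S = "half_edges \<Gamma>"])
    (use \<psi>_vperm ribbon_graphD(5)[OF rib_\<Gamma>] in auto)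

text \<open>Components correspond to cycles of \<open>s0\<close>. Positions at vertices give cycles
  in \<open>R\<close>, positions on edges cycles in \<open>B\<close>, and two of the latter are told
  apart because walks from different starting points in \<open>R\<close> do not overlap.\<close>

lemma base_point_bij: "bij_betw (\<lambda>j. component_of H (base_point j)) index_set (components H)"
  unfolding bij_betw_def
proof
  have R: "orbit s0 y \<subseteq> R" if "y \<in> R" for y
  proof
    fix z assume "z \<in> orbit s0 y"
    then show "z \<in> R" by induction (use that R_s0 in auto)
  qed
  have vv: "c = c'" if c: "c \<in> vertices \<Gamma>" "c' \<in> vertices \<Gamma>"
    and o: "orbit s0 (\<psi> (Min c)) = orbit s0 (\<psi> (Min c'))" for c c'
  proof -
    note m = vertex_Min[OF rib_\<Gamma> c(1)] and m' = vertex_Min[OF rib_\<Gamma> c(2)]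
    have "Min c \<in> half_edges \<Gamma>" "Min c' \<in> half_edges \<Gamma>" using m m' by blast+
    then have "\<psi> ` c = \<psi> ` c'" using o orbit_\<psi> m(3) m'(3) by metis
    then show ?thesis using inj_on_image_eq_iff[OF graph_isoD(2)[OF \<psi>] m(2) m'(2)] by simp
  qed
  have ve: "orbit s0 (\<psi> (Min c)) \<noteq> orbit s0 (ep e i)"
    if "c \<in> vertices \<Gamma>" "e \<in> internal_edges \<Gamma>" "i < len e" for c e i
    using R[OF vertex_point[OF that(1)]] walk_in_B(1)[OF that(2,3)] self_orbit_s0[of "ep e i"] R_B by blast
  have ee: "e = e' \<and> i = i'" if e: "e \<in> internal_edges \<Gamma>" "i < len e" "e' \<in> internal_edges \<Gamma>" "i' < len e'"
    and o: "orbit s0 (ep e i) = orbit s0 (ep e' i')" for e i e' i'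
  proof -
    note m = edge_Min[OF rib_\<Gamma> e(1)] and m' = edge_Min[OF rib_\<Gamma> e(3)]
    let ?X = "\<psi> (Min e)" and ?X' = "\<psi> (Min e')"
    let ?y = "(w ^^ Suc i) ?X" and ?y' = "(w ^^ Suc i') ?X'"
    note b = walk_in_B[OF e(1,2)] and b' = walk_in_B[OF e(3,4)]
    have XR: "?X \<in> R" "?X' \<in> R" using \<psi>_R m(1) m'(1) by auto
    have "orbit s0 ?y = orbit s0 ?y'"
      using o orbit_s0_eq[OF orbit.base, of "ep e i"] orbit_s0_eq[OF orbit.base, of "ep e' i'"] b(3) b'(3) by simp
    then have "?y = ?y' \<or> ?y = s0 ?y'"
      using s0_B(3)[OF b(2)] s0_B(3)[OF b'(2)] by auto
    then show ?thesis
    proof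
      assume "?y = ?y'"
      then have X: "?X = ?X' \<and> Suc i = Suc i'"
        using XR hit_time_len[OF e(1)] hit_time_len[OF e(3)] e(2,4)
        by (intro inj_hit_time_eq[OF permutes_inj[OF w_permutes]]) auto
      then have "Min e = Min e'" using \<psi>_inj m(1) m'(1) by blast
      then show ?thesis using m(2) m'(2) X by auto
    next
      \<comment> \<open>Here the same chain would be walked in opposite directions, so the marked
        ends would be the two distinct ends of one edge.\<close>
      assume y: "?y = s0 ?y'"
      have "t ?y = t ?X"
        using XR R_E hit_time_len[OF e(1)] e(2) by (intro t_along) auto
      moreover have "t ?y' = t ?X'"
        using XR R_E hit_time_len[OF e(3)] e(4) by (intro t_along) auto
      ultimately have "t ?X = ?X'" using t_s0'[OF b'(2)] t_t(1)[OF XR(2)] y by simp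
      then have "\<psi> (einv \<Gamma> (Min e)) = \<psi> (Min e')" using \<psi>_einv[OF m(1)] by simp
      then have f: "einv \<Gamma> (Min e) = Min e'" using \<psi>_inj m(1) m'(1) ribbon_graphD(6)[OF rib_\<Gamma>] by blast
      have "e' = {Min e', Min e}" using m'(2) f[symmetric] ribbon_graphD(4)[OF rib_\<Gamma>] by simp
      then have "e' = e" using m(2) f by auto
      then show ?thesis using f m(3) by simp
    qed
  qed
  show "inj_on (\<lambda>j. component_of H (base_point j)) index_set"
  proof (rule inj_onI)
    fix j k assume jk: "j \<in> index_set" "k \<in> index_set"
      and "component_of H (base_point j) = component_of H (base_point k)"
    then have o: "orbit s0 (base_point j) = orbit s0 (base_point k)"
      using same_component_orbit base_point_E by blast
    have "(\<exists>c\<in>vertices \<Gamma>. j = Inl c) \<or> (\<exists>e\<in>internal_edges \<Gamma>. \<exists>i<len e. j = Inr (e, i))"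
      "(\<exists>c\<in>vertices \<Gamma>. k = Inl c) \<or> (\<exists>e\<in>internal_edges \<Gamma>. \<exists>i<len e. k = Inr (e, i))"
      using jk by (auto simp: index_set_def)
    then show "j = k"
    proof (elim disjE bexE exE conjE)
      fix c c' assume "c \<in> vertices \<Gamma>" "c' \<in> vertices \<Gamma>" "j = Inl c" "k = Inl c'"
      then show "j = k" using o vv[of c c'] by (simp add: base_point_def)
    next
      fix c e i assume "c \<in> vertices \<Gamma>" "e \<in> internal_edges \<Gamma>" "i < len e" "j = Inl c" "k = Inr (e, i)"
      then show "j = k" using o ve[of c e i] by (simp add: base_point_def)
    next
      fix c e i assume "c \<in> vertices \<Gamma>" "e \<in> internal_edges \<Gamma>" "i < len e" "k = Inl c" "j = Inr (e, i)"
      then show "j = k" using o ve[of c e i] by (simp add: base_point_def)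
    next
      fix e i e' i' assume "e \<in> internal_edges \<Gamma>" "i < len e" "j = Inr (e, i)"
        "e' \<in> internal_edges \<Gamma>" "i' < len e'" "k = Inr (e', i')"
      then show "j = k" using o ee[of e i e' i'] by (simp add: base_point_def)
    qed
  qed
  show "(\<lambda>j. component_of H (base_point j)) ` index_set = components H"
  proof (intro equalityI subsetI)
    fix C assume "C \<in> (\<lambda>j. component_of H (base_point j)) ` index_set"
    then show "C \<in> components H" using base_point_E E_sub component_in by blast
  next
    fix C assume C: "C \<in> components H"
    obtain z where z: "z \<in> E" "C = component_of H z"
      using component_data(4,6)[OF C] by blast
    have "\<exists>j\<in>index_set. orbit s0 z = orbit s0 (base_point j)"
    proof (cases "z \<in> R")
      case True
      then obtain y where y: "y \<in> half_edges \<Gamma>" "z = \<psi> y" using \<psi>_surj by blast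
      let ?c = "orbit (vperm \<Gamma>) y"
      have c: "?c \<in> vertices \<Gamma>" using y(1) by (auto simp: vertices_def cycles_def)
      note m = vertex_Min[OF rib_\<Gamma> c]
      have "orbit s0 z = orbit s0 (\<psi> (Min ?c))" using orbit_\<psi>[OF y(1)] orbit_\<psi>[of "Min ?c"] m y(2) by auto
      then show ?thesis using c by (intro bexI[of _ "Inl ?c"]) (auto simp: index_set_def base_point_def)
    next
      case False
      then have zB: "z \<in> B" using z(1) E_un by blast
      have "z \<notin> external G" using False external_R by blast
      then obtain e i where ei: "e \<in> internal_edges \<Gamma>" "i \<le> len e"
        "z = (w ^^ i) (\<psi> (Min e)) \<or> z = \<beta> ((w ^^ i) (\<psi> (Min e)))" using walk_cover[OF z(1)] by metis
      have XR: "\<psi> (Min e) \<in> R" using \<psi>_R[OF edge_Min(1)[OF rib_\<Gamma> ei(1)]] .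
      have "\<exists>i<len e. orbit s0 z = orbit s0 (ep e i)" using ei(3)
      proof
        assume zi: "z = (w ^^ i) (\<psi> (Min e))"
        then have "i \<noteq> 0" using XR False by (cases i) auto
        then obtain k where k: "i = Suc k" by (cases i) auto
        then have "z = s0 (ep e k)" using walk_in_B(3)[OF ei(1), of k] ei(2) zi by simp
        then show ?thesis using orbit_s0_eq[OF orbit.base] k ei(2) by (intro exI[of _ k]) auto
      next
        assume zi: "z = \<beta> ((w ^^ i) (\<psi> (Min e)))"
        have "i \<noteq> len e"
          using zi walk_end[OF ei(1)] False \<psi>_R edge_Min(1)[OF rib_\<Gamma> ei(1)] ribbon_graphD(6)[OF rib_\<Gamma>] by auto
        then show ?thesis using zi ei(2) ep_eq[of e i] by (intro exI[of _ i]) auto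
      qed
      then show ?thesis using ei(1) by (force simp: index_set_def base_point_def)
    qed
    then show "C \<in> (\<lambda>j. component_of H (base_point j)) ` index_set"
      using same_component_orbit[OF z(1) base_point_E] z(2) by auto
  qed
qed

lemma component_labelled:
  assumes "x \<in> E"
  shows "x \<in> R \<Longrightarrow> (induced_graph H (component_of H x), x) \<in> labelled 4"
    "x \<in> B \<Longrightarrow> (induced_graph H (component_of H x), x) \<in> labelled 2"
proof -
  have "x \<in> S" using assms E_sub by blast
  note C = component_data[OF component_in[OF this]]
  have o: "orbit s0 x = E \<inter> component_of H x" by (rule orbit_s0[OF assms])
  have e: "x \<in> external (induced_graph H (component_of H x))"
    unfolding C(3) using assms component_of_self by simp
  show "x \<in> R \<Longrightarrow> (induced_graph H (component_of H x), x) \<in> labelled 4"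
    using C(8) card_orbit_R[of x] e by (simp add: labelled_def flip: o)
  show "x \<in> B \<Longrightarrow> (induced_graph H (component_of H x), x) \<in> labelled 2"
    using C(8) e by (simp add: labelled_def B_def flip: o)
qed

lemma vertex_labelled: "c \<in> vertices \<Gamma> \<Longrightarrow>
    (induced_graph H (component_of H (\<psi> (Min c))), \<psi> (Min c)) \<in> labelled 4"
  using component_labelled(1) vertex_point R_E by blast

lemma edge_labelled: "e \<in> internal_edges \<Gamma> \<Longrightarrow> i < len e \<Longrightarrow>
    (induced_graph H (component_of H (ep e i)), ep e i) \<in> labelled 2"
  using component_labelled(2) walk_in_B(1) B_E by blast

lemma vertex_deco_in: "c \<in> vertices \<Gamma> \<Longrightarrow> vertex_deco H \<psi> c \<in> labelled_classes 4"
  unfolding vertex_deco_def component_class_def by (rule label_class_in[OF vertex_labelled])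

lemma edge_deco_in: "e \<in> internal_edges \<Gamma> \<Longrightarrow> edge_deco G H \<psi> e \<in> lists (labelled_classes 2)"
  unfolding edge_deco_def component_class_def using label_class_in[OF edge_labelled] by auto

text \<open>Used twice, with values in multisets for the monomial of \<open>H\<close> and with
  natural numbers for its loop order.\<close>

lemma sum_components:
  fixes f :: "ck_generator \<Rightarrow> 'b::comm_monoid_add"
  shows "(\<Sum>C\<in>components H. f (abs_ck_generator (induced_graph H C))) =
    (\<Sum>c\<in>vertices \<Gamma>. f (forget_label (vertex_deco H \<psi> c))) +
    (\<Sum>e\<in>internal_edges \<Gamma>. \<Sum>L\<leftarrow>edge_deco G H \<psi> e. f (forget_label L))"
proof -
  let ?f = "\<lambda>x. f (abs_ck_generator (induced_graph H (component_of H x)))"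
  have "(\<Sum>C\<in>components H. f (abs_ck_generator (induced_graph H C))) = (\<Sum>j\<in>index_set. ?f (base_point j))"
    by (rule sum.reindex_bij_betw[OF base_point_bij, symmetric])
  also have "\<dots> = (\<Sum>j\<in>Inl ` vertices \<Gamma>. ?f (base_point j)) +
      (\<Sum>j\<in>Inr ` Sigma (internal_edges \<Gamma>) (\<lambda>e. {..<len e}). ?f (base_point j))"
    unfolding index_set_def using finite_vertices[OF rib_\<Gamma>] finite_internal_edges[OF rib_\<Gamma>] by (intro sum.union_disjoint) auto
  also have "(\<Sum>j\<in>Inl ` vertices \<Gamma>. ?f (base_point j)) = (\<Sum>c\<in>vertices \<Gamma>. f (forget_label (vertex_deco H \<psi> c)))"
    by (subst sum.reindex) (auto simp: base_point_def vertex_deco_def component_class_def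
        forget_label_class[OF vertex_labelled] intro!: sum.cong)
  also have "(\<Sum>j\<in>Inr ` Sigma (internal_edges \<Gamma>) (\<lambda>e. {..<len e}). ?f (base_point j)) =
      (\<Sum>(e, i)\<in>Sigma (internal_edges \<Gamma>) (\<lambda>e. {..<len e}). ?f (ep e i))"
    by (subst sum.reindex) (auto simp: base_point_def intro!: sum.cong)
  also have "\<dots> = (\<Sum>e\<in>internal_edges \<Gamma>. \<Sum>i<len e. ?f (ep e i))"
    using finite_internal_edges[OF rib_\<Gamma>] by (subst sum.Sigma) auto
  also have "\<dots> = (\<Sum>e\<in>internal_edges \<Gamma>. \<Sum>L\<leftarrow>edge_deco G H \<psi> e. f (forget_label L))"
    by (rule sum.cong) (auto simp: edge_deco_def component_class_def interv_sum_list_conv_sum_set_nat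
        comp_def forget_label_class[OF edge_labelled] atLeast0LessThan intro!: sum.cong)
  finally show ?thesis .
qed

end

text \<open>Only \<open>H\<close> is respected, not the edges of \<open>G\<close> that are cut. This
  determines \<open>s0\<close>, \<open>B\<close> and \<open>R\<close> but not
  \<open>\<beta>\<close>: a map assembled from isomorphisms of components is known to respect
  \<open>H\<close> before anything is known about \<open>\<beta>\<close>.\<close>

locale contraction_isomorphism =
  dom: contraction G H + cod: contraction G' H' + H: graph_isomorphism \<phi> H H'
  for G H :: "'a ribbon_graph" and G' H' :: "'b ribbon_graph" and \<phi>
begin

lemma s0:
  assumes "x \<in> external H"
  shows "cod.s0 (\<phi> x) = \<phi> (dom.s0 x)" "\<phi> x \<in> external H'"
proof -
  have xS: "x \<in> half_edges G" using assms dom.E_sub by blast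
  have "hit (einv H' \<circ> vperm G') (external H') (\<phi> x) = \<phi> (hit (einv H \<circ> vperm G) (external H) x)"
  proof (rule hit_intertwine(3)[where S = "half_edges G"])
    show "x \<in> half_edges G" by (rule xS)
    fix z assume "z \<in> half_edges G"
    then have z: "z \<in> half_edges H" using dom.H_sel(2) by simp
    show "(einv H \<circ> vperm G) z \<in> half_edges G \<and> (einv H' \<circ> vperm G') (\<phi> z) = \<phi> ((einv H \<circ> vperm G) z)"
      using H.vperm_step[OF z] H.einv_step[of "vperm H z"] dom.H_sel cod.H_sel by simp
    show "\<phi> z \<in> external H' \<longleftrightarrow> z \<in> external H" by (rule H.external[OF z])
  qed
  moreover show x': "\<phi> x \<in> external H'" using H.external[of x] xS assms dom.H_sel(2) by simp
  ultimately show "cod.s0 (\<phi> x) = \<phi> (dom.s0 x)"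
    using assms unfolding cod.s0_def dom.s0_def by (simp add: first_return_eq_hit)
qed

lemma card_orbit: "x \<in> external H \<Longrightarrow> card (orbit cod.s0 (\<phi> x)) = card (orbit dom.s0 x)"
proof -
  assume x: "x \<in> external H"
  have o: "orbit cod.s0 (\<phi> x) = \<phi> ` orbit dom.s0 x"
    by (rule orbit_intertwine[where S = "external H"]) (use x s0(1) dom.s0_E in auto)
  have "orbit dom.s0 x \<subseteq> half_edges H"
    using permutes_orbit_subset[OF dom.s0_permutes x] dom.E_sub dom.H_sel(2) by blast
  then show ?thesis unfolding o by (intro card_image inj_on_subset[OF H.i(2)])
qed

lemma B_R:
  assumes "x \<in> external H"
  shows "\<phi> x \<in> cod.B \<longleftrightarrow> x \<in> dom.B" "\<phi> x \<in> cod.R \<longleftrightarrow> x \<in> dom.R"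
  using assms s0(2)[OF assms] card_orbit[OF assms]
  by (simp_all add: dom.B_def cod.B_def dom.R_def cod.R_def)

lemma component_iso:
  assumes "x \<in> external H"
  shows "graph_iso \<phi> (induced_graph H (component_of H x)) (induced_graph H' (component_of H' (\<phi> x)))"
proof -
  have x: "x \<in> half_edges H" using assms by (simp add: external_def)
  show ?thesis unfolding H.component[OF x]
    by (rule graph_iso_induced[OF H.iso dom.H_sel(1) component_of_closed[OF dom.H_sel(1) x]])
qed

end

text \<open>Glue isomorphisms between the corresponding components.\<close>

lemma chart_unique:
  fixes G H G' H' \<Gamma> :: "nat ribbon_graph"
  assumes "chart G H \<Gamma> \<psi>" "chart G' H' \<Gamma> \<psi>'"
    and v: "\<And>c. c \<in> vertices \<Gamma> \<Longrightarrow> vertex_deco H \<psi> c = vertex_deco H' \<psi>' c"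
    and e: "\<And>e. e \<in> internal_edges \<Gamma> \<Longrightarrow> edge_deco G H \<psi> e = edge_deco G' H' \<psi>' e"
  obtains J where "graph_iso J G G'" "graph_iso J H H'" "\<And>y. y \<in> half_edges \<Gamma> \<Longrightarrow> J (\<psi> y) = \<psi>' y"
proof -
  interpret a: chart G H \<Gamma> \<psi> by fact
  interpret b: chart G' H' \<Gamma> \<psi>' by fact
  have len: "edge_length G' H' \<psi>' x = edge_length G H \<psi> x" if "x \<in> internal_edges \<Gamma>" for x
    using arg_cong[OF e[OF that], of length] by (simp add: edge_deco_def)
  have idx: "b.index_set = a.index_set"
    unfolding a.index_set_def b.index_set_def using len by (auto simp: image_iff)
  let ?C = "\<lambda>j. component_of H (a.base_point j)" and ?C' = "\<lambda>j. component_of H' (b.base_point j)"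
  have ex: "\<exists>\<phi>. graph_iso \<phi> (induced_graph H (?C j)) (induced_graph H' (?C' j)) \<and>
      \<phi> (a.base_point j) = b.base_point j" if j: "j \<in> a.index_set" for j
  proof (cases j)
    case (Inl c)
    then have c: "c \<in> vertices \<Gamma>" using j by (auto simp: a.index_set_def)
    show ?thesis
      using v[OF c] label_class_eq_iff[OF a.vertex_labelled[OF c] b.vertex_labelled[OF c]]
      by (simp add: Inl a.base_point_def b.base_point_def vertex_deco_def component_class_def)
  next
    case (Inr p)
    then obtain x i where p: "p = (x, i)" and x: "x \<in> internal_edges \<Gamma>" "i < a.len x"
      using j by (auto simp: a.index_set_def)
    have "edge_deco G H \<psi> x ! i = edge_deco G' H' \<psi>' x ! i" using e[OF x(1)] by simp
    then have "component_class 2 H (a.ep x i) = component_class 2 H' (b.ep x i)"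
      using x len[OF x(1)] by (simp add: edge_deco_def)
    then show ?thesis
      using label_class_eq_iff[OF a.edge_labelled[OF x] b.edge_labelled[of x i]] x len[OF x(1)]
      by (simp add: Inr p a.base_point_def b.base_point_def component_class_def)
  qed
  define \<phi> where "\<phi> j = (SOME \<phi>. graph_iso \<phi> (induced_graph H (?C j)) (induced_graph H' (?C' j)) \<and>
      \<phi> (a.base_point j) = b.base_point j)" for j
  have \<phi>: "graph_iso (\<phi> j) (induced_graph H (?C j)) (induced_graph H' (?C' j))"
    "\<phi> j (a.base_point j) = b.base_point j" if "j \<in> a.index_set" for j
    using someI_ex[OF ex[OF that]] unfolding \<phi>_def by blast+
  \<comment> \<open>\<open>\<iota> x\<close> is the position of the piece containing
    \<open>x\<close>, and \<open>J\<close> applies the isomorphism chosen for that piece.\<close>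
  define \<iota> where "\<iota> x = inv_into a.index_set ?C (component_of H x)" for x
  define J where "J x = \<phi> (\<iota> x) x" for x
  have \<iota>: "\<iota> x \<in> a.index_set" "?C (\<iota> x) = component_of H x" if "x \<in> half_edges G" for x
  proof -
    have im: "component_of H x \<in> ?C ` a.index_set"
      using bij_betw_imp_surj_on[OF a.base_point_bij] a.component_in[OF that] by simp
    show "\<iota> x \<in> a.index_set" unfolding \<iota>_def by (rule inv_into_into[OF im])
    show "?C (\<iota> x) = component_of H x" unfolding \<iota>_def by (rule f_inv_into_f[OF im])
  qed
  have J_C: "J x = \<phi> j x" if "j \<in> a.index_set" "x \<in> ?C j" for j x
  proof -
    have "component_of H x = ?C j" using component_of_eq[OF that(2)] .
    then have "\<iota> x = j" unfolding \<iota>_def using inv_into_f_f[OF bij_betw_imp_inj_on[OF a.base_point_bij] that(1)] by simp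
    then show ?thesis by (simp add: J_def)
  qed
  have Csub: "?C j \<subseteq> half_edges G" if "j \<in> a.index_set" for j
    using a.component_data(2)[OF a.component_in] a.base_point_E[OF that] a.E_sub by blast
  have I: "half_edges (induced_graph X C) = C" "x \<in> C \<Longrightarrow> vperm (induced_graph X C) x = vperm X x"
    "x \<in> C \<Longrightarrow> einv (induced_graph X C) x = einv X x" for X :: "nat ribbon_graph" and C x
    by (simp_all add: induced_graph_def perm_restrict_def)
  have JC: "J x \<in> ?C' (\<iota> x)" if "x \<in> half_edges G" for x
    using graph_isoD(4)[OF \<phi>(1)[OF \<iota>(1)[OF that]], of x] \<iota>(2)[OF that] component_of_self[of x H]
    by (simp add: I J_def)
  have J_H: "graph_iso J H H'" unfolding graph_iso_def bij_betw_def a.H_sel(2) b.H_sel(2)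
  proof (intro conjI ballI)
    show "inj_on J (half_edges G)"
    proof (rule inj_onI)
      fix x y assume xy: "x \<in> half_edges G" "y \<in> half_edges G" "J x = J y"
      have "?C' (\<iota> x) = ?C' (\<iota> y)"
        using component_of_eq[OF JC[OF xy(1)]] component_of_eq[OF JC[OF xy(2)]] xy(3) by simp
      then have i: "\<iota> x = \<iota> y"
        using b.base_point_bij \<iota>(1) xy(1,2) unfolding idx bij_betw_def by (auto dest: inj_onD)
      show "x = y"
        using graph_isoD(2)[OF \<phi>(1)[OF \<iota>(1)[OF xy(1)]]] xy(3) \<iota>(2) xy(1,2) i component_of_self
        unfolding I J_def by (metis inj_onD)
    qed
    show "J ` half_edges G = half_edges G'"
    proof (intro equalityI subsetI)
      fix y assume "y \<in> J ` half_edges G"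
      then show "y \<in> half_edges G'"
        using JC \<iota>(1) b.component_data(2)[OF b.component_in] b.base_point_E b.E_sub unfolding idx by blast
    next
      fix y assume y: "y \<in> half_edges G'"
      obtain j where j: "j \<in> a.index_set" "component_of H' y = ?C' j"
        using b.base_point_bij b.component_in[OF y] unfolding idx bij_betw_def by auto
      then have "y \<in> \<phi> j ` ?C j"
        using graph_isoD(3)[OF \<phi>(1)[OF j(1)]] component_of_self[of y H'] by (simp add: I)
      then obtain x where x: "x \<in> ?C j" "y = \<phi> j x" by blast
      then have "y = J x" "x \<in> half_edges G" using J_C[OF j(1)] Csub[OF j(1)] by auto
      then show "y \<in> J ` half_edges G" by blast
    qed
    fix x assume x: "x \<in> half_edges G"
    let ?j = "\<iota> x"
    note j = \<iota>[OF x]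
    have xC: "x \<in> ?C ?j" using j(2) component_of_self by simp
    have cl: "vperm H x \<in> ?C ?j" "einv H x \<in> ?C ?j"
      using a.component_data(1)[OF a.component_in[OF x]] xC unfolding j(2) by (auto simp: graph_closed_def)
    have Jx: "J x \<in> ?C' ?j" by (rule JC[OF x])
    note g = graph_isoD(5,6)[OF \<phi>(1)[OF j(1)]]
    show "J (vperm H x) = vperm H' (J x)" "J (einv H x) = einv H' (J x)"
      using g[of x] xC Jx J_C[OF j(1) cl(1)] J_C[OF j(1) cl(2)] J_C[OF j(1) xC] by (simp_all add: I)
  qed
  interpret ci: contraction_isomorphism G H G' H' J
    by unfold_locales (rule J_H a.H_sel b.H_sel)+
  have Jbp: "J (a.base_point j) = b.base_point j" if "j \<in> a.index_set" for j
    using J_C[OF that component_of_self] \<phi>(2)[OF that] by simp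
  \<comment> \<open>Known at the marked half edge of each vertex, where base points correspond; the
    rest follows by rotation, as both charts turn the rotation of \<Gamma> into
    \<open>s0\<close>.\<close>
  have J\<psi>: "J (\<psi> y) = \<psi>' y" if y: "y \<in> half_edges \<Gamma>" for y
  proof -
    let ?c = "orbit (vperm \<Gamma>) y"
    have c: "?c \<in> vertices \<Gamma>" using y by (auto simp: vertices_def cycles_def)
    note m = vertex_Min[OF a.rib_\<Gamma> c]
    have b: "J (\<psi> (Min ?c)) = \<psi>' (Min ?c)"
      using Jbp[of "Inl ?c"] c by (simp add: a.index_set_def a.base_point_def b.base_point_def)
    have st: "J (\<psi> (vperm \<Gamma> z)) = \<psi>' (vperm \<Gamma> z)" if "J (\<psi> z) = \<psi>' z" "z \<in> half_edges \<Gamma>" for z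
    proof -
      have "\<psi> z \<in> external H" using a.\<psi>_R[OF that(2)] a.R_E by blast
      then show ?thesis using ci.s0(1)[of "\<psi> z"] a.\<psi>_vperm b.\<psi>_vperm that by simp
    qed
    have "z \<in> half_edges \<Gamma> \<and> J (\<psi> z) = \<psi>' z" if "z \<in> orbit (vperm \<Gamma>) (Min ?c)" for z
      using that
    proof induction
      case base
      then show ?case using st[OF b] m ribbon_graphD(5)[OF a.rib_\<Gamma>] by blast
    next
      case (step z)
      then show ?case using st[of z] ribbon_graphD(5)[OF a.rib_\<Gamma>] by blast
    qed
    moreover have "y \<in> orbit (vperm \<Gamma>) (Min ?c)"
      using m(3) permutes_self_in_orbit[OF ribbon_graphD(2,1)[OF a.rib_\<Gamma>]] by blast
    ultimately show ?thesis by blast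
  qed
  have Jw: "J ((a.w ^^ i) (\<psi> (Min x))) = (b.w ^^ i) (\<psi>' (Min x)) \<and>
      J (a.\<beta> ((a.w ^^ i) (\<psi> (Min x)))) = b.\<beta> ((b.w ^^ i) (\<psi>' (Min x)))"
    if x: "x \<in> internal_edges \<Gamma>" and i: "i \<le> a.len x" for x i
  proof -
    \<comment> \<open>Before the last position these are base points of pieces; at the last one the
      walk arrives at the other end of the edge, which is covered by the chart.\<close>
    have \<beta>: "J (a.\<beta> ((a.w ^^ i) (\<psi> (Min x)))) = b.\<beta> ((b.w ^^ i) (\<psi>' (Min x)))" if i: "i \<le> a.len x" for i
    proof (cases "i = a.len x")
      case True
      then show ?thesis using a.walk_end[OF x] b.walk_end[OF x] len[OF x] J\<psi>
          edge_Min(1)[OF a.rib_\<Gamma> x] ribbon_graphD(6)[OF a.rib_\<Gamma>] by simp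
    next
      case False
      then have "Inr (x, i) \<in> a.index_set" using i x by (auto simp: a.index_set_def)
      then show ?thesis
        using Jbp[of "Inr (x, i)"] by (simp add: a.base_point_def b.base_point_def a.ep_eq b.ep_eq)
    qed
    have "J ((a.w ^^ i) (\<psi> (Min x))) = (b.w ^^ i) (\<psi>' (Min x))"
    proof (cases i)
      case 0
      then show ?thesis using J\<psi> edge_Min(1)[OF a.rib_\<Gamma> x] by simp
    next
      case (Suc k)
      have k: "k < a.len x" "k < b.len x" using i Suc len[OF x] by auto
      have "J (a.s0 (a.ep x k)) = b.s0 (b.ep x k)"
        using ci.s0(1)[of "a.ep x k"] a.walk_in_B(1)[OF x k(1)] a.B_E \<beta>[of k] k
        by (auto simp: a.ep_eq b.ep_eq)
      then show ?thesis unfolding Suc using a.walk_in_B(3)[OF x k(1)] b.walk_in_B(3)[OF x k(2)] by simp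
    qed
    then show ?thesis using \<beta>[OF i] by blast
  qed
  \<comment> \<open>Every element of \<open>E\<close> is either external in \<open>G\<close>, hence
    in the image of the chart, or occurs on the walk along some edge.\<close>
  have J\<beta>: "J (a.\<beta> z) = b.\<beta> (J z)" if z: "z \<in> external H" for z
  proof (cases "z \<in> external G")
    case True
    then obtain y where y: "y \<in> half_edges \<Gamma>" "z = \<psi> y" using a.external_R a.\<psi>_surj by blast
    then have "\<psi>' y \<in> external G'" using True a.external_\<Gamma> b.external_\<Gamma> by simp
    then have "b.\<beta> (\<psi>' y) = \<psi>' y" using b.external_E b.\<beta>_E by (auto simp: external_iff)
    moreover have "a.\<beta> z = z" using True a.external_E a.\<beta>_E by (auto simp: external_iff)
    ultimately show ?thesis using y J\<psi> by simp
  next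
    case False
    obtain x i where xi: "x \<in> internal_edges \<Gamma>" "i \<le> a.len x"
      "z = (a.w ^^ i) (\<psi> (Min x)) \<or> z = a.\<beta> ((a.w ^^ i) (\<psi> (Min x)))"
      using a.walk_cover[OF z False] by metis
    from xi(3) show ?thesis
    proof
      assume "z = (a.w ^^ i) (\<psi> (Min x))"
      then show ?thesis using Jw[OF xi(1,2)] by simp
    next
      assume "z = a.\<beta> ((a.w ^^ i) (\<psi> (Min x)))"
      then show ?thesis using Jw[OF xi(1,2)] by (simp add: a.\<beta>_\<beta> b.\<beta>_\<beta>)
    qed
  qed
  have "graph_iso J G G'" unfolding graph_iso_def
  proof (intro conjI ballI)
    show "bij_betw J (half_edges G) (half_edges G')"
      using graph_isoD(1)[OF J_H] by (simp add: a.H_sel b.H_sel)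
    fix x assume x: "x \<in> half_edges G"
    show "J (vperm G x) = vperm G' (J x)" using graph_isoD(5)[OF J_H, of x] x by (simp add: a.H_sel b.H_sel)
    show "J (einv G x) = einv G' (J x)"
    proof (cases "x \<in> external H")
      case True
      then show ?thesis using J\<beta>[OF True] ci.s0(2)[OF True] by (simp add: a.\<beta>_E b.\<beta>_E)
    next
      case False
      then have "J x \<notin> external H'" using ci.H.external[of x] x a.H_sel by simp
      then show ?thesis
        using False graph_isoD(6)[OF J_H, of x] x a.einv_outside b.einv_outside by (simp add: a.H_sel)
    qed
  qed
  then show ?thesis using that J_H J\<psi> by blast
qed

lemma involution_permutes:
  assumes "\<And>x. f (f x) = x" "\<And>x. x \<notin> S \<Longrightarrow> f x = x"
  shows "f permutes S"
  using assms unfolding permutes_def by metis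

locale full_isomorphism =
  contraction_isomorphism G H G' H' \<phi> + G: graph_isomorphism \<phi> G G'
  for G H :: "'a ribbon_graph" and G' H' :: "'b ribbon_graph" and \<phi>
begin

lemma \<beta>: "x \<in> external H \<Longrightarrow> cod.\<beta> (\<phi> x) = \<phi> (dom.\<beta> x)"
  using s0(2)[of x] G.einv_step[of x] dom.E_sub by (auto simp: dom.\<beta>_E cod.\<beta>_E)

lemma w: "x \<in> external H \<Longrightarrow> dom.w x \<in> external H \<and> cod.w (\<phi> x) = \<phi> (dom.w x)"
proof -
  assume x: "x \<in> external H"
  then have bx: "dom.\<beta> x \<in> external H" by (simp add: dom.\<beta>_in)
  have "cod.sB (\<phi> (dom.\<beta> x)) = \<phi> (dom.sB (dom.\<beta> x))"
    using s0(1)[OF bx] B_R(1)[OF bx] by (cases "dom.\<beta> x \<in> dom.B")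
      (simp_all add: dom.sB_B cod.sB_B dom.sB_not_B cod.sB_not_B)
  then show ?thesis using x \<beta>[OF x] dom.w_in[of x] by (simp add: dom.w_def cod.w_def)
qed

lemma walk: "x \<in> external H \<Longrightarrow> (cod.w ^^ n) (\<phi> x) = \<phi> ((dom.w ^^ n) x) \<and> (dom.w ^^ n) x \<in> external H"
  using funpow_intertwine[of x "external H" dom.w cod.w \<phi> n] w by blast

lemma hit:
  assumes "x \<in> external H"
  shows "hits cod.w cod.R (\<phi> x) \<longleftrightarrow> hits dom.w dom.R x"
    "hit_time cod.w cod.R (\<phi> x) = hit_time dom.w dom.R x"
    "hit cod.w cod.R (\<phi> x) = \<phi> (hit dom.w dom.R x)"
  using hit_intertwine[of x "external H" dom.w cod.w \<phi> cod.R dom.R] assms w B_R(2) by blast+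

lemma E_image: "external H' = \<phi> ` external H" by (rule H.external_image)

lemma R_image: "cod.R = \<phi> ` dom.R"
proof (intro equalityI subsetI)
  fix y assume y: "y \<in> cod.R"
  then obtain x where x: "y = \<phi> x" "x \<in> external H" using cod.R_E unfolding E_image by blast
  then show "y \<in> \<phi> ` dom.R" using y B_R(2) by blast
next
  fix y assume "y \<in> \<phi> ` dom.R"
  then obtain x where x: "y = \<phi> x" "x \<in> dom.R" by blast
  then have "x \<in> external H" using dom.R_E by blast
  then show "y \<in> cod.R" using x B_R(2) by blast
qed

lemma K_iso: "graph_iso \<phi> dom.K cod.K"
  unfolding graph_iso_def dom.K_sel(1) cod.K_sel(1)
proof (intro conjI ballI)
  have "inj_on \<phi> dom.R"
    by (rule inj_on_subset[OF G.i(2)]) (use dom.R_E dom.E_sub in blast)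
  then show "bij_betw \<phi> dom.R cod.R" by (simp add: bij_betw_def R_image)
  fix x assume x: "x \<in> dom.R"
  then have xE: "x \<in> external H" and x': "\<phi> x \<in> cod.R" using dom.R_E R_image by auto
  show "\<phi> (vperm dom.K x) = vperm cod.K (\<phi> x)"
    using s0(1)[OF xE] by (simp add: dom.vperm_K[OF x] cod.vperm_K[OF x'])
  show "\<phi> (einv dom.K x) = einv cod.K (\<phi> x)"
    using hit(3)[OF xE] by (simp add: dom.einv_K[OF x] cod.einv_K[OF x'])
qed

end

text \<open>The glued graph is only isomorphic to the representative of its class, so subgraph and
  chart have to be moved along. Decorations do not change, as they record isomorphism classes of
  rooted components.\<close>

lemma chart_transport:
  assumes "chart G H \<Gamma> \<psi>" and iso: "graph_iso \<phi> G G'" and rib': "ribbon_graph G'"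
  obtains H' where "chart G' H' \<Gamma> (\<phi> \<circ> \<psi>)"
    "\<And>c. c \<in> vertices \<Gamma> \<Longrightarrow> vertex_deco H' (\<phi> \<circ> \<psi>) c = vertex_deco H \<psi> c"
    "\<And>e. e \<in> internal_edges \<Gamma> \<Longrightarrow> edge_deco G' H' (\<phi> \<circ> \<psi>) e = edge_deco G H \<psi> e"
proof -
  interpret a: chart G H \<Gamma> \<psi> by fact
  interpret g: graph_isomorphism \<phi> G G' by unfold_locales (rule iso a.rib rib')+
  define H' where "H' = transport \<phi> H"
  note t = transport_iso[OF a.H_sel(1), of \<phi>, unfolded a.H_sel(2), OF g.i(2), folded H'_def]
  interpret h: graph_isomorphism \<phi> H H' by unfold_locales (rule t a.H_sel)+
  have half: "half_edges H' = half_edges G'" using t(3) g.i(3) by simp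
  have vp: "vperm H' = vperm G'"
  proof
    fix y
    show "vperm H' y = vperm G' y"
    proof (cases "y \<in> half_edges G'")
      case True
      then obtain x where x: "y = \<phi> x" "x \<in> half_edges G" unfolding g.i(3)[symmetric] by blast
      then show ?thesis using g.i(5)[of x] h.i(5)[of x] a.H_sel by simp
    next
      case False
      then show ?thesis
        using permutes_not_in[OF g.r'(2)] permutes_not_in[OF h.r'(2)] half by simp
    qed
  qed
  have sub: "H' \<in> ribbon_subgraphs G'" unfolding ribbon_subgraphs_def
  proof (intro CollectI conjI subsetI)
    fix d assume "d \<in> internal_edges H'"
    then obtain y where y: "y \<in> half_edges G'" "einv H' y \<noteq> y" "d = {y, einv H' y}"
      by (auto simp: internal_edges_def half)
    obtain x where x: "y = \<phi> x" "x \<in> half_edges G" using y(1) unfolding g.i(3)[symmetric] by blast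
    have "einv H x \<noteq> x" using y(2) h.i(6)[of x] x a.H_sel(2) by auto
    then have "einv G x = einv H x" using a.einv_outside a.E_iff by blast
    then have "einv G' y = einv H' y" using g.i(6)[of x] h.i(6)[of x] x a.H_sel(2) by simp
    then show "d \<in> internal_edges G'" using y by (auto simp: internal_edges_def)
  qed (use t(1) half vp in auto)
  have "generating (induced_graph H' C)" if C: "C \<in> components H'" for C
  proof -
    obtain y where y: "y \<in> half_edges H'" "C = component_of H' y" using C by (auto simp: components_eq)
    obtain x where x: "y = \<phi> x" "x \<in> half_edges H" using y(1) unfolding h.i(3)[symmetric] by blast
    have C': "C = \<phi> ` component_of H x" using y(2) x h.component by simp
    note cl = component_of_closed[OF a.H_sel(1) x(2)]
    have "component_of H x \<in> components H" using x(2) by (simp add: components_eq)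
    from generating_iso[OF graph_iso_induced[OF t(2) a.H_sel(1) cl] _ a.gen[OF this]]
    show ?thesis using ribbon_graph_induced[OF t(1) components_closed[OF t(1) C]] C' by simp
  qed
  then interpret b: contraction G' H' using rib' sub by unfold_locales
  interpret f: full_isomorphism G H G' H' \<phi> by unfold_locales
  interpret b: full_contraction G' H'
  proof unfold_locales
    show "hits b.w b.R y" if "y \<in> external H'" for y
      using that f.hit(1) a.hits_E unfolding f.E_image by auto
    show "external G' \<subseteq> b.R" unfolding g.external_image f.R_image using a.external_R by blast
  qed
  interpret b: chart G' H' \<Gamma> "\<phi> \<circ> \<psi>"
    by unfold_locales (rule a.rib_\<Gamma>, rule graph_iso_comp[OF a.\<psi> f.K_iso])
  have cls: "component_class n H' (\<phi> x) = component_class n H x"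
    if "(induced_graph H (component_of H x), x) \<in> labelled n" "x \<in> external H" for n x
  proof -
    have "\<phi> x \<in> half_edges H'" using that(2) f.E_image by (auto simp: external_def)
    then have "ribbon_graph (induced_graph H' (component_of H' (\<phi> x)))"
      by (rule ribbon_graph_induced[OF t(1) component_of_closed[OF t(1)]])
    from label_class_iso[OF that(1) f.component_iso[OF that(2)] this] show ?thesis
      by (simp add: component_class_def)
  qed
  have "vertex_deco H' (\<phi> \<circ> \<psi>) c = vertex_deco H \<psi> c" if "c \<in> vertices \<Gamma>" for c
    using cls[OF a.vertex_labelled[OF that]] a.vertex_point[OF that] a.R_E
    by (auto simp: vertex_deco_def)
  moreover have "edge_deco G' H' (\<phi> \<circ> \<psi>) e = edge_deco G H \<psi> e" if e: "e \<in> internal_edges \<Gamma>" for e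
  proof -
    have X: "\<psi> (Min e) \<in> external H" using a.\<psi>_R[OF edge_Min(1)[OF a.rib_\<Gamma> e]] a.R_E by blast
    have len: "edge_length G' H' (\<phi> \<circ> \<psi>) e = edge_length G H \<psi> e"
      using f.hit(2)[OF X] by (simp add: edge_length_def)
    have ep: "edge_point G' H' (\<phi> \<circ> \<psi>) e i = \<phi> (edge_point G H \<psi> e i)" for i
      using f.walk[OF X, of i] f.\<beta> by (simp add: edge_point_def)
    have "component_class 2 H' (edge_point G' H' (\<phi> \<circ> \<psi>) e i) = component_class 2 H (edge_point G H \<psi> e i)"
      if "i < edge_length G H \<psi> e" for i
      using cls[OF a.edge_labelled[OF e that]] a.walk_in_B(1)[OF e that] a.B_E by (auto simp: ep)
    then show ?thesis by (simp add: edge_deco_def len)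
  qed
  ultimately show ?thesis using that b.chart_axioms by blast
qed


section \<open>Gluing\<close>

text \<open>Tagging half edges with the index of their piece by the pairing function keeps the
  result a graph on natural numbers, as generators require.\<close>

definition disjoint_union :: "nat set \<Rightarrow> (nat \<Rightarrow> nat ribbon_graph) \<Rightarrow> nat ribbon_graph" where
  "disjoint_union I g =
     \<lparr>half_edges = (\<Union>i\<in>I. (\<lambda>y. prod_encode (i, y)) ` half_edges (g i)),
      vperm = (\<lambda>z. let (i, y) = prod_decode z in if i \<in> I then prod_encode (i, vperm (g i) y) else z),
      einv = (\<lambda>z. let (i, y) = prod_decode z in if i \<in> I then prod_encode (i, einv (g i) y) else z)\<rparr>"

locale graph_family =
  fixes I :: "nat set" and g :: "nat \<Rightarrow> nat ribbon_graph"
  assumes fin: "finite I" and rib: "\<And>i. i \<in> I \<Longrightarrow> ribbon_graph (g i)"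
    and conn: "\<And>i. i \<in> I \<Longrightarrow> connected_graph (g i)"
begin

abbreviation "U \<equiv> disjoint_union I g"
abbreviation P :: "nat \<Rightarrow> nat \<Rightarrow> nat" where "P i y \<equiv> prod_encode (i, y)"

lemma U_vperm: "i \<in> I \<Longrightarrow> vperm U (P i y) = P i (vperm (g i) y)"
  and U_einv: "i \<in> I \<Longrightarrow> einv U (P i y) = P i (einv (g i) y)"
  by (simp_all add: disjoint_union_def)

lemma U_half: "P i y \<in> half_edges U \<longleftrightarrow> i \<in> I \<and> y \<in> half_edges (g i)"
  by (auto simp: disjoint_union_def)

lemma U_ex: "z \<in> half_edges U \<Longrightarrow> \<exists>i y. z = P i y \<and> i \<in> I \<and> y \<in> half_edges (g i)"
  by (auto simp: disjoint_union_def)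

lemma lifted_permutes:
  assumes "\<And>i. i \<in> I \<Longrightarrow> p i permutes half_edges (g i)"
  shows "(\<lambda>z. let (i, y) = prod_decode z in if i \<in> I then P i (p i y) else z) permutes half_edges U"
    (is "?f permutes _")
  unfolding permutes_def
proof (intro conjI allI impI)
  fix z assume z: "z \<notin> half_edges U"
  obtain i y where iy: "z = P i y" by (metis prod_decode_inverse surj_pair)
  show "?f z = z" using z permutes_not_in[OF assms, of i y] by (auto simp: iy U_half)
next
  fix z
  obtain i y where iy: "z = P i y" by (metis prod_decode_inverse surj_pair)
  show "\<exists>!x. ?f x = z"
  proof (rule ex1I[of _ "if i \<in> I then P i (inv (p i) y) else z"])
    show "?f (if i \<in> I then P i (inv (p i) y) else z) = z"
      using permutes_inverses(1)[OF assms, of i y] by (simp add: iy)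
    fix x assume x: "?f x = z"
    obtain j u where ju: "x = P j u" by (metis prod_decode_inverse surj_pair)
    show "x = (if i \<in> I then P i (inv (p i) y) else z)"
      using x permutes_inverses(2)[OF assms, of i u] by (auto simp: iy ju split: if_splits)
  qed
qed

lemma U_ribbon: "ribbon_graph U"
  unfolding ribbon_graph_def
proof (intro conjI allI)
  show "finite (half_edges U)"
    using fin ribbon_graphD(1)[OF rib] by (simp add: disjoint_union_def)
  show "vperm U permutes half_edges U"
    using lifted_permutes[of "\<lambda>i. vperm (g i)"] ribbon_graphD(2)[OF rib] by (simp add: disjoint_union_def)
  show "einv U permutes half_edges U"
    using lifted_permutes[of "\<lambda>i. einv (g i)"] ribbon_graphD(3)[OF rib] by (simp add: disjoint_union_def)
  fix z
  obtain i y where iy: "z = P i y" by (metis prod_decode_inverse surj_pair)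
  show "einv U (einv U z) = z"
    using ribbon_graphD(4)[OF rib, of i y] U_einv by (cases "i \<in> I") (simp_all add: iy, simp add: disjoint_union_def)
qed

lemma U_component:
  assumes "i \<in> I" "y \<in> half_edges (g i)"
  shows "component_of U (P i y) = P i ` half_edges (g i)"
proof
  note r = ribbon_graphD[OF rib[OF assms(1)]]
  have "graph_closed U (P i ` half_edges (g i))"
    using assms(1) U_half U_vperm[OF assms(1)] U_einv[OF assms(1)] r(5,6) by (auto simp: graph_closed_def)
  then show "component_of U (P i y) \<subseteq> P i ` half_edges (g i)"
    using assms(2) by (intro component_of_least[OF U_ribbon]) auto
  have yU: "P i y \<in> half_edges U" using U_half assms by simp
  note cl = component_of_closed[OF U_ribbon yU]
  have "graph_closed (g i) {x \<in> half_edges (g i). P i x \<in> component_of U (P i y)}"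
    using graph_closedD(2,3)[OF cl] U_vperm[OF assms(1)] U_einv[OF assms(1)] r(5,6)
    by (fastforce simp: graph_closed_def)
  moreover have "y \<in> {x \<in> half_edges (g i). P i x \<in> component_of U (P i y)}"
    using assms(2) component_of_self[of "P i y" U] by simp
  ultimately have "{x \<in> half_edges (g i). P i x \<in> component_of U (P i y)} = half_edges (g i)"
    using conn[OF assms(1)] connected_graph_iff[OF rib[OF assms(1)]] by blast
  then show "P i ` half_edges (g i) \<subseteq> component_of U (P i y)" by blast
qed

lemma U_iso: "i \<in> I \<Longrightarrow> graph_iso (P i) (g i) (induced_graph U (P i ` half_edges (g i)))"
  by (auto simp: graph_iso_def bij_betw_def inj_on_def induced_graph_def perm_restrict_def U_vperm U_einv)

lemma U_external: "P i y \<in> external U \<longleftrightarrow> i \<in> I \<and> y \<in> external (g i)"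
  using U_half U_einv by (auto simp: external_iff)

end

locale gluing =
  fixes \<Gamma> :: "nat ribbon_graph"
    and \<omega> :: "nat set \<Rightarrow> (nat ribbon_graph \<times> nat) set"
    and \<mu> :: "nat set \<Rightarrow> (nat ribbon_graph \<times> nat) set list"
  assumes rib_\<Gamma>: "ribbon_graph \<Gamma>"
    and degree: "\<And>y. y \<in> half_edges \<Gamma> \<Longrightarrow> card (orbit (vperm \<Gamma>) y) = 4"
    and \<omega>: "\<And>c. c \<in> vertices \<Gamma> \<Longrightarrow> \<omega> c \<in> labelled_classes 4"
    and \<mu>: "\<And>e. e \<in> internal_edges \<Gamma> \<Longrightarrow> \<mu> e \<in> lists (labelled_classes 2)"
begin

text \<open>The pieces are indexed by \<open>vi c\<close> for the one at the vertex \<open>c\<close> and \<open>ei e k\<close> for the \<open>k\<close>-th one on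
  the edge \<open>e\<close>; a half edge \<open>y\<close> of the piece \<open>i\<close> becomes \<open>prod_encode (i, y)\<close>.\<close>

definition vi :: "nat set \<Rightarrow> nat" where "vi c = prod_encode (Min c, 0)"
definition ei :: "nat set \<Rightarrow> nat \<Rightarrow> nat" where "ei e k = prod_encode (Min e, Suc k)"

text \<open>The vertex or edge is recovered from its least half edge. The second component 0 is
  reserved for vertices, which explains the shift of the list position by one.\<close>

definition D :: "nat \<Rightarrow> (nat ribbon_graph \<times> nat) set" where
  "D i = (case prod_decode i of (m, k) \<Rightarrow>
     if k = 0 then \<omega> (orbit (vperm \<Gamma>) m) else \<mu> {m, einv \<Gamma> m} ! (k - 1))"

definition I :: "nat set" where
  "I = vi ` vertices \<Gamma> \<union> (\<lambda>(e, k). ei e k) ` Sigma (internal_edges \<Gamma>) (\<lambda>e. {..<length (\<mu> e)})"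

abbreviation g :: "nat \<Rightarrow> nat ribbon_graph" where "g i \<equiv> class_graph (D i)"
abbreviation h :: "nat \<Rightarrow> nat" where "h i \<equiv> class_root (D i)"

lemma D_vi: "c \<in> vertices \<Gamma> \<Longrightarrow> D (vi c) = \<omega> c"
  using vertex_Min(3)[OF rib_\<Gamma>, of c] by (simp add: D_def vi_def)

lemma D_ei: "e \<in> internal_edges \<Gamma> \<Longrightarrow> D (ei e k) = \<mu> e ! k"
  using edge_Min(2)[OF rib_\<Gamma>, of e] by (simp add: D_def ei_def)

lemma I_cases:
  assumes "i \<in> I"
  obtains c where "c \<in> vertices \<Gamma>" "i = vi c" | e k where "e \<in> internal_edges \<Gamma>" "k < length (\<mu> e)" "i = ei e k"
  using assms by (auto simp: I_def)

lemma vi_I: "c \<in> vertices \<Gamma> \<Longrightarrow> vi c \<in> I" and ei_I: "e \<in> internal_edges \<Gamma> \<Longrightarrow> k < length (\<mu> e) \<Longrightarrow> ei e k \<in> I"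
  by (auto simp: I_def)

lemma vi_inj: "c \<in> vertices \<Gamma> \<Longrightarrow> c' \<in> vertices \<Gamma> \<Longrightarrow> vi c = vi c' \<Longrightarrow> c = c'"
  using vertex_Min(3)[OF rib_\<Gamma>, of c] vertex_Min(3)[OF rib_\<Gamma>, of c'] by (simp add: vi_def)

lemma ei_inj: "e \<in> internal_edges \<Gamma> \<Longrightarrow> e' \<in> internal_edges \<Gamma> \<Longrightarrow> ei e k = ei e' k' \<Longrightarrow> e = e' \<and> k = k'"
  using edge_Min(2)[OF rib_\<Gamma>, of e] edge_Min(2)[OF rib_\<Gamma>, of e'] by (simp add: ei_def)

lemma D_vertex: "c \<in> vertices \<Gamma> \<Longrightarrow> (g (vi c), h (vi c)) \<in> labelled 4"
  "c \<in> vertices \<Gamma> \<Longrightarrow> label_class 4 (g (vi c)) (h (vi c)) = \<omega> c"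
  using class_graph[OF \<omega>] D_vi by auto

lemma D_edge:
  assumes "e \<in> internal_edges \<Gamma>" "k < length (\<mu> e)"
  shows "(g (ei e k), h (ei e k)) \<in> labelled 2" "label_class 2 (g (ei e k)) (h (ei e k)) = \<mu> e ! k"
proof -
  have "\<mu> e ! k \<in> labelled_classes 2" using \<mu>[OF assms(1)] assms(2) by (auto simp: in_lists_conv_set)
  then show "(g (ei e k), h (ei e k)) \<in> labelled 2" "label_class 2 (g (ei e k)) (h (ei e k)) = \<mu> e ! k"
    using class_graph D_ei[OF assms(1)] by auto
qed

lemma D_labelled: "i \<in> I \<Longrightarrow> (g i, h i) \<in> labelled 2 \<or> (g i, h i) \<in> labelled 4"
  using D_vertex D_edge by (elim I_cases) auto

sublocale graph_family I g
proof
  show "finite I" unfolding I_def using finite_vertices[OF rib_\<Gamma>] finite_internal_edges[OF rib_\<Gamma>] by blast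
  fix i assume "i \<in> I"
  then show "ribbon_graph (g i)" "connected_graph (g i)"
    using D_labelled[of i] labelledD(1) n_point_generatingD(1,2) by blast+
qed

lemma U_components: "C \<in> components U \<Longrightarrow> \<exists>i\<in>I. C = P i ` half_edges (g i)"
  using U_ex U_component unfolding components_eq by fastforce

text \<open>Regarding \<open>U\<close> as a subgraph of itself provides \<open>s0\<close>,
  \<open>B\<close> and \<open>R\<close> before anything is glued. They depend only on
  \<open>U\<close>, so they remain the same for the glued graph (\<open>c_s0\<close>,
  \<open>c_BR\<close>).\<close>

sublocale base: contraction U U
proof
  show "ribbon_graph U" by (rule U_ribbon)
  then show "U \<in> ribbon_subgraphs U" by (simp add: ribbon_subgraphs_def)
  fix C assume C: "C \<in> components U"
  then obtain i where i: "i \<in> I" "C = P i ` half_edges (g i)" using U_components by blast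
  have "generating (g i)" using D_labelled[OF i(1)] labelledD(1) by (auto simp: generating_def)
  then show "generating (induced_graph U C)"
    using generating_iso[OF U_iso[OF i(1)]] ribbon_graph_induced[OF U_ribbon components_closed[OF U_ribbon C]] i(2)
    by simp
qed

abbreviation u :: "nat \<Rightarrow> nat" where "u \<equiv> base.s0"
definition bv :: "nat set \<Rightarrow> nat" where "bv c = P (vi c) (h (vi c))"
definition be :: "nat set \<Rightarrow> nat \<Rightarrow> nat" where "be e k = P (ei e k) (h (ei e k))"
definition cidx :: "nat \<Rightarrow> nat" where "cidx z = fst (prod_decode z)"

lemma cidx: "cidx (bv c) = vi c" "cidx (be e k) = ei e k" "cidx (P i y) = i"
  by (simp_all add: cidx_def bv_def be_def)

lemma orbit_u: "z \<in> external U \<Longrightarrow> orbit u z = {x \<in> external U. cidx x = cidx z}"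
proof -
  assume z: "z \<in> external U"
  then obtain i y where iy: "z = P i y" "i \<in> I" "y \<in> half_edges (g i)"
    using U_ex[of z] by (auto simp: external_def)
  have "component_of U z = {x \<in> half_edges U. cidx x = cidx z}"
    unfolding iy(1) U_component[OF iy(2,3)] cidx
    using U_ex U_half iy(2) by (fastforce simp: cidx)
  then show ?thesis using base.orbit_s0[OF z] by (auto simp: external_def)
qed

lemma card_external_component: "i \<in> I \<Longrightarrow> card {x \<in> external U. cidx x = i} = card (external (g i))"
proof -
  assume i: "i \<in> I"
  have "{x \<in> external U. cidx x = i} = P i ` external (g i)"
  proof (intro equalityI subsetI)
    fix x assume "x \<in> {x \<in> external U. cidx x = i}"
    then have x: "x \<in> external U" "cidx x = i" by auto
    obtain y where y: "x = P i y" using U_ex[of x] x by (auto simp: external_iff cidx)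
    then show "x \<in> P i ` external (g i)" using x(1) U_external by blast
  next
    fix x assume "x \<in> P i ` external (g i)"
    then show "x \<in> {x \<in> external U. cidx x = i}" using U_external i by (auto simp: cidx)
  qed
  then show ?thesis by (simp add: card_image inj_on_def)
qed

lemma cidx_u: "z \<in> external U \<Longrightarrow> cidx (u z) = cidx z"
  using orbit_u[of z] orbit.base[of u z] by blast

lemma bv: "c \<in> vertices \<Gamma> \<Longrightarrow> bv c \<in> external U" "c \<in> vertices \<Gamma> \<Longrightarrow> card (orbit u (bv c)) = 4"
  "c \<in> vertices \<Gamma> \<Longrightarrow> bv c \<in> base.R"
proof -
  assume c: "c \<in> vertices \<Gamma>"
  note d = labelledD[OF D_vertex(1)[OF c]]
  show e: "bv c \<in> external U" using d(2) vi_I[OF c] by (simp add: bv_def U_external)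
  show "card (orbit u (bv c)) = 4"
    using orbit_u[OF e] card_external_component[OF vi_I[OF c]] n_point_generatingD(5)[OF d(1)] by (simp add: cidx)
  then show "bv c \<in> base.R" using e by (simp add: base.R_def base.B_def)
qed

lemma be:
  assumes "e \<in> internal_edges \<Gamma>" "k < length (\<mu> e)"
  shows "be e k \<in> external U" "be e k \<in> base.B"
proof -
  note d = labelledD[OF D_edge(1)[OF assms]]
  show e: "be e k \<in> external U" using d(2) ei_I[OF assms] by (simp add: be_def U_external)
  show "be e k \<in> base.B"
    using orbit_u[OF e] card_external_component[OF ei_I[OF assms]] n_point_generatingD(5)[OF d(1)] e
    by (simp add: cidx base.B_def)
qed

lemma external_U_cases:
  assumes "z \<in> external U"
  obtains c where "c \<in> vertices \<Gamma>" "z \<in> orbit u (bv c)"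
    | e k where "e \<in> internal_edges \<Gamma>" "k < length (\<mu> e)" "z = be e k \<or> z = u (be e k)"
proof -
  obtain i y where iy: "z = P i y" "i \<in> I" using assms U_ex[of z] by (auto simp: external_def)
  from iy(2) show ?thesis
  proof (cases rule: I_cases)
    case (1 c)
    then have "z \<in> orbit u (bv c)" using orbit_u[OF bv(1)[OF 1(1)]] assms iy(1) by (simp add: cidx)
    then show ?thesis using that(1) 1 by blast
  next
    case (2 e k)
    have "z \<in> orbit u (be e k)" using orbit_u[OF be(1)[OF 2(1,2)]] assms iy(1) 2 by (simp add: cidx)
    then show ?thesis using that(2) 2 base.s0_B(3)[OF be(2)[OF 2(1,2)]] by blast
  qed
qed

definition legs :: "nat set \<Rightarrow> nat \<Rightarrow> nat" where
  "legs c = (SOME \<psi>. bij_betw \<psi> c (orbit u (bv c)) \<and> \<psi> (Min c) = bv c \<and> (\<forall>x\<in>c. \<psi> (vperm \<Gamma> x) = u (\<psi> x)))"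

text \<open>The vertex and the legs of the 4-point piece put there are both cycles of length 4, and
  matching the least half edge with the root fixes the identification.\<close>

lemma legs:
  assumes c: "c \<in> vertices \<Gamma>"
  shows "bij_betw (legs c) c (orbit u (bv c))" "legs c (Min c) = bv c"
    "x \<in> c \<Longrightarrow> legs c (vperm \<Gamma> x) = u (legs c x)"
proof -
  note m = vertex_Min[OF rib_\<Gamma> c]
  have "Min c \<in> orbit (vperm \<Gamma>) (Min c)" using m by simp
  moreover have "card (orbit (vperm \<Gamma>) (Min c)) = card (orbit u (bv c))"
    using degree[of "Min c"] m(1,2) bv(2)[OF c] by auto
  ultimately obtain \<psi> where "bij_betw \<psi> (orbit (vperm \<Gamma>) (Min c)) (orbit u (bv c))" "\<psi> (Min c) = bv c"
    "\<And>x. x \<in> orbit (vperm \<Gamma>) (Min c) \<Longrightarrow> \<psi> (vperm \<Gamma> x) = u (\<psi> x)"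
    using cycle_intertwiner[of "Min c" "vperm \<Gamma>" "bv c" u] base.self_orbit_s0 by metis
  then have "\<exists>\<psi>. bij_betw \<psi> c (orbit u (bv c)) \<and> \<psi> (Min c) = bv c \<and> (\<forall>x\<in>c. \<psi> (vperm \<Gamma> x) = u (\<psi> x))"
    using m(3) by auto
  from someI_ex[OF this, folded legs_def]
  show "bij_betw (legs c) c (orbit u (bv c))" "legs c (Min c) = bv c"
    "x \<in> c \<Longrightarrow> legs c (vperm \<Gamma> x) = u (legs c x)" by auto
qed

definition \<psi> :: "nat \<Rightarrow> nat" where "\<psi> y = legs (orbit (vperm \<Gamma>) y) y"

lemma vertex_of: "y \<in> half_edges \<Gamma> \<Longrightarrow> orbit (vperm \<Gamma>) y \<in> vertices \<Gamma>"
  by (auto simp: vertices_def cycles_def)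

lemma self_\<Gamma>: "y \<in> orbit (vperm \<Gamma>) y"
  using permutes_self_in_orbit ribbon_graphD(1,2)[OF rib_\<Gamma>] by metis

lemma vertex_unique: "c \<in> vertices \<Gamma> \<Longrightarrow> y \<in> c \<Longrightarrow> orbit (vperm \<Gamma>) y = c"
  using permutes_orbit_eq[OF ribbon_graphD(2,1)[OF rib_\<Gamma>]] by (auto simp: vertices_def cycles_def)

lemma \<psi>_orbit: "y \<in> half_edges \<Gamma> \<Longrightarrow> \<psi> y \<in> orbit u (bv (orbit (vperm \<Gamma>) y))"
  unfolding \<psi>_def using legs(1)[OF vertex_of] self_\<Gamma> by (blast dest: bij_betwE)

lemma R_orbit: "y \<in> base.R \<Longrightarrow> z \<in> orbit u y \<Longrightarrow> z \<in> base.R"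
proof -
  assume "y \<in> base.R" and z: "z \<in> orbit u y"
  from z show "z \<in> base.R" by induction (use \<open>y \<in> base.R\<close> base.R_s0 in auto)
qed

lemma \<psi>_R: "y \<in> half_edges \<Gamma> \<Longrightarrow> \<psi> y \<in> base.R"
  using R_orbit[OF bv(3)[OF vertex_of] \<psi>_orbit] .

lemma \<psi>_Min: "c \<in> vertices \<Gamma> \<Longrightarrow> \<psi> (Min c) = bv c"
  using legs(2)[of c] vertex_Min(3)[OF rib_\<Gamma>, of c] by (simp add: \<psi>_def)

lemma \<psi>_vperm: "y \<in> half_edges \<Gamma> \<Longrightarrow> \<psi> (vperm \<Gamma> y) = u (\<psi> y)"
  using legs(3)[OF vertex_of self_\<Gamma>, of y] vertex_unique[OF vertex_of orbit.base, of y]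
  by (simp add: \<psi>_def)

lemma \<psi>_inj: "inj_on \<psi> (half_edges \<Gamma>)"
proof (rule inj_onI)
  fix x y assume xy: "x \<in> half_edges \<Gamma>" "y \<in> half_edges \<Gamma>" "\<psi> x = \<psi> y"
  let ?c = "orbit (vperm \<Gamma>) x" and ?d = "orbit (vperm \<Gamma>) y"
  have "cidx (\<psi> x) = vi ?c" "cidx (\<psi> y) = vi ?d"
    using \<psi>_orbit[OF xy(1)] \<psi>_orbit[OF xy(2)] orbit_u[OF bv(1)[OF vertex_of]] xy by (auto simp: cidx)
  then have "?c = ?d" using vi_inj vertex_of xy by metis
  then show "x = y"
    using legs(1)[OF vertex_of[OF xy(1)]] xy(3) self_\<Gamma>[of x] self_\<Gamma>[of y]
    by (auto simp: \<psi>_def bij_betw_def dest: inj_onD)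
qed

lemma \<psi>_surj: "z \<in> base.R \<Longrightarrow> \<exists>y\<in>half_edges \<Gamma>. z = \<psi> y"
proof -
  assume z: "z \<in> base.R"
  then have "z \<in> external U" using base.R_E by blast
  then show ?thesis
  proof (cases rule: external_U_cases)
    case (1 c)
    then obtain y where "y \<in> c" "z = legs c y" using legs(1) by (auto simp: bij_betw_def)
    then show ?thesis using 1(1) vertex_unique vertex_Min(2)[OF rib_\<Gamma> 1(1)] by (auto simp: \<psi>_def)
  next
    case (2 e k)
    then have "z \<in> base.B" using be(2) base.B_s0 by auto
    then show ?thesis using z base.R_B by blast
  qed
qed

text \<open>Along an edge \<open>e\<close> decorated by a list of length \<open>l\<close>, the half edge \<open>near e j\<close> leaving the
  \<open>j\<close>-th piece is glued to the half edge \<open>far e j\<close> entering the next one, for \<open>j \<le> l\<close>.\<close>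

definition near :: "nat set \<Rightarrow> nat \<Rightarrow> nat" where
  "near e j = (if j = 0 then \<psi> (Min e) else u (be e (j - 1)))"

definition far :: "nat set \<Rightarrow> nat \<Rightarrow> nat" where
  "far e j = (if j = length (\<mu> e) then \<psi> (einv \<Gamma> (Min e)) else be e j)"

definition pairs :: "(nat set \<times> nat) set" where
  "pairs = Sigma (internal_edges \<Gamma>) (\<lambda>e. {..length (\<mu> e)})"

lemma pair_in:
  assumes "e \<in> internal_edges \<Gamma>"
  shows "near e 0 \<in> base.R" "far e (length (\<mu> e)) \<in> base.R"
    "0 < j \<Longrightarrow> j \<le> length (\<mu> e) \<Longrightarrow> near e j \<in> base.B"
    "j < length (\<mu> e) \<Longrightarrow> far e j \<in> base.B"
    "0 < j \<Longrightarrow> j \<le> length (\<mu> e) \<Longrightarrow> cidx (near e j) = ei e (j - 1)"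
    "j < length (\<mu> e) \<Longrightarrow> cidx (far e j) = ei e j"
  using \<psi>_R edge_Min(1)[OF rib_\<Gamma> assms] ribbon_graphD(6)[OF rib_\<Gamma>] be[OF assms] base.B_s0 cidx_u
  by (auto simp: near_def far_def cidx)

lemma Min_inj: "e \<in> internal_edges \<Gamma> \<Longrightarrow> e' \<in> internal_edges \<Gamma> \<Longrightarrow> Min e = Min e' \<Longrightarrow> e = e'"
  using edge_Min(2)[OF rib_\<Gamma>, of e] edge_Min(2)[OF rib_\<Gamma>, of e'] by simp

text \<open>Membership in \<open>R\<close> or \<open>B\<close> tells whether \<open>j\<close> is 0.
  In the first case \<open>\<psi>\<close> recovers the edge, in the second the index of the piece
  recovers edge and position.\<close>

lemma near_inj: "inj_on (\<lambda>(e, j). near e j) pairs"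
proof (rule inj_onI, clarsimp simp: pairs_def)
  fix e j e' j' assume e: "e \<in> internal_edges \<Gamma>" "j \<le> length (\<mu> e)" "e' \<in> internal_edges \<Gamma>"
    "j' \<le> length (\<mu> e')" and n: "near e j = near e' j'"
  have z: "j = 0 \<longleftrightarrow> j' = 0"
  proof -
    have "j = 0 \<longleftrightarrow> near e j \<in> base.R" using pair_in(1)[OF e(1)] pair_in(3)[OF e(1), of j] e(2) base.R_B by blast
    moreover have "j' = 0 \<longleftrightarrow> near e' j' \<in> base.R" using pair_in(1)[OF e(3)] pair_in(3)[OF e(3), of j'] e(4) base.R_B by blast
    ultimately show ?thesis using n by simp
  qed
  show "e = e' \<and> j = j'"
  proof (cases "j = 0")
    case True
    then have "\<psi> (Min e) = \<psi> (Min e')" using z n by (simp add: near_def)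
    then have "Min e = Min e'" using inj_onD[OF \<psi>_inj] edge_Min(1)[OF rib_\<Gamma>] e by blast
    then have "e = e'" using Min_inj e by blast
    then show ?thesis using z True by simp
  next
    case False
    then have "ei e (j - 1) = ei e' (j' - 1)" using pair_in(5)[OF e(1), of j] pair_in(5)[OF e(3), of j'] e n z by simp
    then have "e = e' \<and> j - 1 = j' - 1" by (rule ei_inj[OF e(1,3)])
    moreover have "j' \<noteq> 0" using z False by simp
    ultimately show ?thesis using False by (cases j; cases j') auto
  qed
qed

lemma far_inj: "inj_on (\<lambda>(e, j). far e j) pairs"
proof (rule inj_onI, clarsimp simp: pairs_def)
  fix e j e' j' assume e: "e \<in> internal_edges \<Gamma>" "j \<le> length (\<mu> e)" "e' \<in> internal_edges \<Gamma>"
    "j' \<le> length (\<mu> e')" and n: "far e j = far e' j'"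
  have z: "j = length (\<mu> e) \<longleftrightarrow> j' = length (\<mu> e')"
    using pair_in(2)[OF e(1)] pair_in(2)[OF e(3)] pair_in(4)[OF e(1), of j] pair_in(4)[OF e(3), of j'] e n base.R_B by (cases "j = length (\<mu> e)"; cases "j' = length (\<mu> e')") auto
  show "e = e' \<and> j = j'"
  proof (cases "j = length (\<mu> e)")
    case True
    then have "\<psi> (einv \<Gamma> (Min e)) = \<psi> (einv \<Gamma> (Min e'))" using z n by (simp add: far_def)
    then have "einv \<Gamma> (Min e) = einv \<Gamma> (Min e')"
      using inj_onD[OF \<psi>_inj] edge_Min(1)[OF rib_\<Gamma>] ribbon_graphD(6)[OF rib_\<Gamma>] e by blast
    then have "Min e = Min e'" using ribbon_graphD(4)[OF rib_\<Gamma>] by metis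
    then have "e = e'" using Min_inj e by blast
    then show ?thesis using z True by simp
  next
    case False
    then have "ei e j = ei e' j'" using pair_in(6)[OF e(1), of j] pair_in(6)[OF e(3), of j'] e n z by simp
    then show ?thesis using ei_inj e by blast
  qed
qed

text \<open>A coincidence in \<open>R\<close> would identify the two ends of one edge of \<Gamma>;
  one in \<open>B\<close> would identify the two legs of one 2-point piece.\<close>

lemma near_far:
  assumes "e \<in> internal_edges \<Gamma>" "j \<le> length (\<mu> e)" "e' \<in> internal_edges \<Gamma>" "j' \<le> length (\<mu> e')"
  shows "near e j \<noteq> far e' j'"
proof
  assume n: "near e j = far e' j'"
  show False
  proof (cases "j = 0")
    case True
    then have l: "j' = length (\<mu> e')"
      using pair_in(1)[OF assms(1)] pair_in(4)[OF assms(3), of j'] assms n base.R_B by fastforce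
    then have "\<psi> (Min e) = \<psi> (einv \<Gamma> (Min e'))" using True n by (simp add: near_def far_def)
    then have m: "Min e = einv \<Gamma> (Min e')"
      using inj_onD[OF \<psi>_inj] edge_Min(1)[OF rib_\<Gamma>] ribbon_graphD(6)[OF rib_\<Gamma>] assms by blast
    have "e = {Min e, Min e'}" using edge_Min(2)[OF rib_\<Gamma> assms(1)] m ribbon_graphD(4)[OF rib_\<Gamma>] by simp
    then have "e = e'" using edge_Min(2)[OF rib_\<Gamma> assms(3)] m by auto
    then show False using edge_Min(3)[OF rib_\<Gamma> assms(3)] m by simp
  next
    case False
    then have B: "near e j \<in> base.B" using pair_in(3)[OF assms(1)] assms by simp
    then have l: "j' \<noteq> length (\<mu> e')" using pair_in(2)[OF assms(3)] n base.R_B by auto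
    then have "ei e (j - 1) = ei e' j'"
      using pair_in(5)[OF assms(1), of j] pair_in(6)[OF assms(3), of j'] False assms n by simp
    then have "e = e'" "j' = j - 1" using ei_inj assms by blast+
    then have "u (be e j') = be e j'" using n False l by (simp add: near_def far_def)
    then show False using base.s0_B(2)[OF be(2)[OF assms(1), of j']] \<open>e = e'\<close> l assms by simp
  qed
qed

definition \<beta> :: "nat \<Rightarrow> nat" where
  "\<beta> z = (if z \<in> (\<lambda>(e, j). near e j) ` pairs then case_prod far (inv_into pairs (\<lambda>(e, j). near e j) z)
     else if z \<in> (\<lambda>(e, j). far e j) ` pairs then case_prod near (inv_into pairs (\<lambda>(e, j). far e j) z)
     else z)"

lemma \<beta>_near: "e \<in> internal_edges \<Gamma> \<Longrightarrow> j \<le> length (\<mu> e) \<Longrightarrow> \<beta> (near e j) = far e j"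
proof -
  assume "e \<in> internal_edges \<Gamma>" "j \<le> length (\<mu> e)"
  then have p: "(e, j) \<in> pairs" by (simp add: pairs_def)
  have "inv_into pairs (\<lambda>(e, j). near e j) (near e j) = (e, j)"
    using inv_into_f_f[OF near_inj p] by simp
  then show ?thesis using p by (force simp: \<beta>_def)
qed

lemma \<beta>_far: "e \<in> internal_edges \<Gamma> \<Longrightarrow> j \<le> length (\<mu> e) \<Longrightarrow> \<beta> (far e j) = near e j"
proof -
  assume e: "e \<in> internal_edges \<Gamma>" "j \<le> length (\<mu> e)"
  then have p: "(e, j) \<in> pairs" by (simp add: pairs_def)
  have "far e j \<notin> (\<lambda>(e, j). near e j) ` pairs"
    using near_far[of _ _ e j] e by (auto simp: pairs_def) metis
  moreover have "inv_into pairs (\<lambda>(e, j). far e j) (far e j) = (e, j)"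
    using inv_into_f_f[OF far_inj p] by simp
  ultimately show ?thesis using p by (force simp: \<beta>_def)
qed

lemma \<beta>_else: "(\<And>e j. e \<in> internal_edges \<Gamma> \<Longrightarrow> j \<le> length (\<mu> e) \<Longrightarrow> z \<noteq> near e j \<and> z \<noteq> far e j) \<Longrightarrow> \<beta> z = z"
  by (auto simp: \<beta>_def pairs_def)

lemma glue_cases:
  obtains e j where "e \<in> internal_edges \<Gamma>" "j \<le> length (\<mu> e)" "z = near e j \<or> z = far e j"
    | "\<beta> z = z" "\<And>e j. e \<in> internal_edges \<Gamma> \<Longrightarrow> j \<le> length (\<mu> e) \<Longrightarrow> z \<noteq> near e j \<and> z \<noteq> far e j"
  using \<beta>_else by blast

lemma \<beta>_\<beta>: "\<beta> (\<beta> z) = z"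
  by (cases z rule: glue_cases) (auto simp: \<beta>_near \<beta>_far)

lemma pair_E: "e \<in> internal_edges \<Gamma> \<Longrightarrow> j \<le> length (\<mu> e) \<Longrightarrow> near e j \<in> external U \<and> far e j \<in> external U"
  using pair_in(1,2)[of e] pair_in(3,4)[of e j] base.R_E base.B_E
  by (cases "j = 0"; cases "j = length (\<mu> e)") auto

lemma \<beta>_E: "\<beta> z \<in> external U \<longleftrightarrow> z \<in> external U"
  by (cases z rule: glue_cases) (auto simp: \<beta>_near \<beta>_far pair_E)

lemma \<beta>_outside: "z \<notin> external U \<Longrightarrow> \<beta> z = z"
  by (cases z rule: glue_cases) (auto simp: pair_E)

text \<open>Both legs of every 2-point piece are glued, one as \<open>far\<close> and the other as
  \<open>near\<close>, so only images of external half edges of \<Gamma> remain free.\<close>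

lemma unglued:
  assumes "z \<in> external U" "\<beta> z = z"
  shows "\<exists>y\<in>half_edges \<Gamma>. z = \<psi> y \<and> einv \<Gamma> y = y"
proof -
  have n: "z \<noteq> near e j \<and> z \<noteq> far e j" if "e \<in> internal_edges \<Gamma>" "j \<le> length (\<mu> e)" for e j
    using assms(2) near_far[OF that that] \<beta>_near[OF that] \<beta>_far[OF that] by metis
  have "z \<notin> base.B"
  proof
    assume zB: "z \<in> base.B"
    from assms(1) show False
    proof (cases rule: external_U_cases)
      case (1 c)
      then show False using R_orbit[OF bv(3)] zB base.R_B by blast
    next
      case (2 e k)
      then show False using n[of e k] n[of e "Suc k"] by (auto simp: near_def far_def)
    qed
  qed
  then have "z \<in> base.R" using assms(1) base.E_un by blast
  then obtain y where y: "y \<in> half_edges \<Gamma>" "z = \<psi> y" using \<psi>_surj by blast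
  have "einv \<Gamma> y = y"
  proof (rule ccontr)
    assume "einv \<Gamma> y \<noteq> y"
    then have e: "{y, einv \<Gamma> y} \<in> internal_edges \<Gamma>" (is "?e \<in> _") by (rule internal_edgeI[OF y(1)])
    have "Min ?e = y \<or> Min ?e = einv \<Gamma> y" by (auto simp: min_def)
    then show False
      using n[OF e, of 0] n[OF e, of "length (\<mu> ?e)"] y(2) ribbon_graphD(4)[OF rib_\<Gamma>]
      by (auto simp: near_def far_def)
  qed
  then show ?thesis using y by blast
qed

section \<open>The glued graph and its chart\<close>

definition glued :: "nat ribbon_graph" where
  "glued = \<lparr>half_edges = half_edges U, vperm = vperm U,
     einv = (\<lambda>z. if z \<in> external U then \<beta> z else einv U z)\<rparr>"

lemma glued_sel: "half_edges glued = half_edges U" "vperm glued = vperm U"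
  "z \<in> external U \<Longrightarrow> einv glued z = \<beta> z" "z \<notin> external U \<Longrightarrow> einv glued z = einv U z"
  by (simp_all add: glued_def)

lemma glued_ribbon: "ribbon_graph glued"
proof -
  note r = ribbon_graphD[OF U_ribbon]
  have E: "einv U z \<in> external U \<longleftrightarrow> z \<in> external U" for z
    using r(4)[of z] r(6)[of z] by (auto simp: external_iff)
  have i: "einv glued (einv glued z) = z" for z
    using E[of z] \<beta>_E[of z] \<beta>_\<beta>[of z] r(4)[of z] by (cases "z \<in> external U") (simp_all add: glued_sel)
  have "einv glued permutes half_edges U"
  proof (rule involution_permutes[OF i])
    fix z assume "z \<notin> half_edges U"
    then show "einv glued z = z"
      using permutes_not_in[OF r(3)] by (simp add: glued_sel external_iff)
  qed
  then show ?thesis using r(1,2) i by (simp add: ribbon_graph_def glued_sel)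
qed

sublocale c: contraction glued U
proof
  show "ribbon_graph glued" by (rule glued_ribbon)
  have "d \<in> internal_edges glued" if d: "d \<in> internal_edges U" for d
  proof -
    obtain z where z: "z \<in> half_edges U" "einv U z \<noteq> z" "d = {z, einv U z}"
      using d by (auto simp: internal_edges_def)
    then have "einv glued z = einv U z" by (simp add: glued_sel external_iff)
    then show ?thesis using z by (auto simp: internal_edges_def glued_sel(1))
  qed
  then show "U \<in> ribbon_subgraphs glued"
    using U_ribbon by (auto simp: ribbon_subgraphs_def glued_sel)
  show "generating (induced_graph U C)" if "C \<in> components U" for C by (rule base.gen[OF that])
qed

lemma c_s0: "c.s0 = u" by (simp add: c.s0_def base.s0_def glued_sel)

lemma c_BR: "c.B = base.B" "c.R = base.R" by (simp_all add: c.B_def base.B_def c.R_def base.R_def c_s0)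

lemma c_\<beta>: "c.\<beta> = \<beta>"
  by (rule ext) (simp add: c.\<beta>_def perm_restrict_def glued_sel \<beta>_outside)

lemma w_near: "e \<in> internal_edges \<Gamma> \<Longrightarrow> j < length (\<mu> e) \<Longrightarrow> c.w (near e j) = near e (Suc j)"
proof -
  assume e: "e \<in> internal_edges \<Gamma>" "j < length (\<mu> e)"
  have "c.\<beta> (near e j) = be e j" using \<beta>_near[of e j] e by (simp add: c_\<beta> far_def)
  then show ?thesis using c.w_eq_B[of "near e j"] be(2)[OF e] by (simp add: c_BR c_s0 near_def)
qed

lemma w_last: "e \<in> internal_edges \<Gamma> \<Longrightarrow> c.w (near e (length (\<mu> e))) = \<psi> (einv \<Gamma> (Min e))"
proof -
  assume e: "e \<in> internal_edges \<Gamma>"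
  have "c.\<beta> (near e (length (\<mu> e))) = \<psi> (einv \<Gamma> (Min e))"
    using \<beta>_near[of e "length (\<mu> e)"] e by (simp add: c_\<beta> far_def)
  moreover have "\<psi> (einv \<Gamma> (Min e)) \<in> base.R"
    using \<psi>_R edge_Min(1)[OF rib_\<Gamma> e] ribbon_graphD(6)[OF rib_\<Gamma>] by simp
  ultimately show ?thesis using c.w_eq_R[of "near e (length (\<mu> e))"] by (simp add: c_BR)
qed

lemma walk_near: "e \<in> internal_edges \<Gamma> \<Longrightarrow> j \<le> length (\<mu> e) \<Longrightarrow> (c.w ^^ j) (\<psi> (Min e)) = near e j"
  by (induction j) (simp_all add: w_near, simp add: near_def)

lemma walk_time:
  assumes e: "e \<in> internal_edges \<Gamma>"
  shows "hit_time c.w c.R (\<psi> (Min e)) = Suc (length (\<mu> e))" "c.t (\<psi> (Min e)) = \<psi> (einv \<Gamma> (Min e))"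
proof -
  have l: "(c.w ^^ Suc (length (\<mu> e))) (\<psi> (Min e)) = \<psi> (einv \<Gamma> (Min e))"
    using walk_near[OF e, of "length (\<mu> e)"] w_last[OF e] by simp
  show t: "hit_time c.w c.R (\<psi> (Min e)) = Suc (length (\<mu> e))"
  proof (rule hit_time_unique)
    show "(c.w ^^ Suc (length (\<mu> e))) (\<psi> (Min e)) \<in> c.R"
      unfolding l c_BR using \<psi>_R edge_Min(1)[OF rib_\<Gamma> e] ribbon_graphD(6)[OF rib_\<Gamma>] by simp
    show "(c.w ^^ i) (\<psi> (Min e)) \<notin> c.R" if "0 < i" "i < Suc (length (\<mu> e))" for i
      using walk_near[OF e, of i] pair_in(3)[OF e, of i] that base.R_B by (auto simp: c_BR)
  qed simp
  show "c.t (\<psi> (Min e)) = \<psi> (einv \<Gamma> (Min e))" unfolding hit_def t by (rule l)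
qed

sublocale c: full_contraction glued U
proof
  show "external glued \<subseteq> c.R"
  proof
    fix z assume z: "z \<in> external glued"
    then have zE: "z \<in> external U" using c.external_E by blast
    then have "\<beta> z = z" using z by (simp add: external_iff glued_sel)
    then show "z \<in> c.R" using unglued[OF zE] \<psi>_R by (auto simp: c_BR)
  qed
  have near: "hits c.w c.R (near e j)" if e: "e \<in> internal_edges \<Gamma>" "j \<le> length (\<mu> e)" for e j
  proof -
    have h: "hits c.w c.R (\<psi> (Min e))"
      by (rule c.hits_R) (use \<psi>_R edge_Min(1)[OF rib_\<Gamma> e(1)] in \<open>simp add: c_BR\<close>)
    have "(c.w ^^ i) (\<psi> (Min e)) \<notin> c.R" if "0 < i" "i \<le> j" for i
      using that walk_time(1)[OF e(1)] e(2) by (intro before_hit_time) auto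
    then show ?thesis using hit_skip(1)[OF h, of j] walk_near[OF e] by simp
  qed
  show "hits c.w c.R z" if z: "z \<in> external U" for z
  proof (cases "z \<in> c.R")
    case True then show ?thesis by (rule c.hits_R)
  next
    case False
    then have nB: "z \<in> base.B" using z base.E_un by (auto simp: c_BR)
    from z show ?thesis
    proof (cases rule: external_U_cases)
      case (1 c)
      then show ?thesis using R_orbit[OF bv(3)] nB base.R_B by blast
    next
      case (2 e k)
      have n: "near e (Suc k) = u (be e k)" by (simp add: near_def)
      have h: "hits c.w c.R (u (be e k))" using near[of e "Suc k"] 2 n by simp
      moreover have "u (be e k) \<in> c.B" using be(2)[OF 2(1,2)] base.B_s0 by (simp add: c_BR)
      then have "hits c.w c.R (c.s0 (u (be e k)))" using h by (rule c.t_s0(1))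
      then have "hits c.w c.R (be e k)" using base.s0_B(1)[OF be(2)[OF 2(1,2)]] by (simp add: c_s0)
      ultimately show ?thesis using 2(3) by blast
    qed
  qed
qed

text \<open>On edges, \<open>walk_time\<close> settles the marked end and the other end follows as
  \<open>c.t\<close> is an involution on \<open>R\<close>. External half edges are not glued, so the
  walk from them stops at once.\<close>

lemma \<psi>_iso: "graph_iso \<psi> \<Gamma> c.K"
  unfolding graph_iso_def c.K_sel(1)
proof (intro conjI ballI)
  have "\<psi> ` half_edges \<Gamma> = c.R" using \<psi>_R \<psi>_surj by (auto simp: c_BR)
  then show "bij_betw \<psi> (half_edges \<Gamma>) c.R" using \<psi>_inj by (simp add: bij_betw_def)
  fix y assume y: "y \<in> half_edges \<Gamma>"
  have yR: "\<psi> y \<in> c.R" using \<psi>_R[OF y] by (simp add: c_BR)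
  show "\<psi> (vperm \<Gamma> y) = vperm c.K (\<psi> y)" using \<psi>_vperm[OF y] by (simp add: c.vperm_K[OF yR] c_s0)
  show "\<psi> (einv \<Gamma> y) = einv c.K (\<psi> y)" unfolding c.einv_K[OF yR]
  proof (cases "einv \<Gamma> y = y")
    case True
    have "\<psi> y \<noteq> near e j \<and> \<psi> y \<noteq> far e j" if e: "e \<in> internal_edges \<Gamma>" "j \<le> length (\<mu> e)" for e j
    proof -
      have y': "y \<noteq> Min e" "y \<noteq> einv \<Gamma> (Min e)"
        using True edge_Min(3)[OF rib_\<Gamma> e(1)] ribbon_graphD(4)[OF rib_\<Gamma>] by metis+
      then have "\<psi> y \<noteq> \<psi> (Min e)" "\<psi> y \<noteq> \<psi> (einv \<Gamma> (Min e))"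
        using inj_onD[OF \<psi>_inj] y edge_Min(1)[OF rib_\<Gamma> e(1)] ribbon_graphD(6)[OF rib_\<Gamma>] by metis+
      moreover have "\<psi> y \<notin> base.B" using \<psi>_R[OF y] base.R_B by blast
      ultimately show ?thesis using pair_in(3,4)[OF e(1), of j] e(2)
        by (cases "j = 0"; cases "j = length (\<mu> e)") (auto simp: near_def far_def)
    qed
    then have "c.\<beta> (\<psi> y) = \<psi> y" unfolding c_\<beta> by (rule \<beta>_else)
    then have "c.w (\<psi> y) = \<psi> y" using c.w_eq_R[of "\<psi> y"] yR by simp
    then show "\<psi> (einv \<Gamma> y) = c.t (\<psi> y)" using True yR by (simp add: hit_base)
  next
    case False
    then have e: "{y, einv \<Gamma> y} \<in> internal_edges \<Gamma>" (is "?e \<in> _") by (rule internal_edgeI[OF y])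
    have "Min ?e = y \<or> Min ?e = einv \<Gamma> y" by (auto simp: min_def)
    then show "\<psi> (einv \<Gamma> y) = c.t (\<psi> y)"
    proof
      assume "Min ?e = y"
      then show ?thesis using walk_time(2)[OF e] by simp
    next
      assume m: "Min ?e = einv \<Gamma> y"
      then have "c.t (\<psi> (einv \<Gamma> y)) = \<psi> y" using walk_time(2)[OF e] ribbon_graphD(4)[OF rib_\<Gamma>] by simp
      moreover have "\<psi> (einv \<Gamma> y) \<in> c.R" using \<psi>_R y ribbon_graphD(6)[OF rib_\<Gamma>] by (simp add: c_BR)
      ultimately show ?thesis using c.t_t(1) by metis
    qed
  qed
qed

lemma component_class_U:
  assumes "i \<in> I" "(g i, h i) \<in> labelled n"
  shows "component_class n U (P i (h i)) = label_class n (g i) (h i)"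
proof -
  have h: "h i \<in> half_edges (g i)" using labelledD(3)[OF assms(2)] .
  then have hU: "P i (h i) \<in> half_edges U" using U_half assms(1) by simp
  show ?thesis unfolding component_class_def U_component[OF assms(1) h]
    using label_class_iso[OF assms(2) U_iso[OF assms(1)]]
      ribbon_graph_induced[OF U_ribbon component_of_closed[OF U_ribbon hU]] U_component[OF assms(1) h] by simp
qed

lemma glue_chart:
  "chart glued U \<Gamma> \<psi>"
  "c \<in> vertices \<Gamma> \<Longrightarrow> vertex_deco U \<psi> c = \<omega> c"
  "e \<in> internal_edges \<Gamma> \<Longrightarrow> edge_deco glued U \<psi> e = \<mu> e"
proof -
  show "chart glued U \<Gamma> \<psi>" by unfold_locales (rule rib_\<Gamma> \<psi>_iso)+
  show "vertex_deco U \<psi> c = \<omega> c" if c: "c \<in> vertices \<Gamma>"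
    using component_class_U[OF vi_I[OF c] D_vertex(1)[OF c]] D_vertex(2)[OF c]
    by (simp add: vertex_deco_def \<psi>_Min[OF c] bv_def)
  show "edge_deco glued U \<psi> e = \<mu> e" if e: "e \<in> internal_edges \<Gamma>"
  proof -
    have l: "edge_length glued U \<psi> e = length (\<mu> e)" by (simp add: edge_length_def walk_time(1)[OF e])
    have "component_class 2 U (edge_point glued U \<psi> e k) = \<mu> e ! k" if k: "k < length (\<mu> e)" for k
    proof -
      have "edge_point glued U \<psi> e k = be e k"
        using walk_near[OF e, of k] \<beta>_near[OF e, of k] k by (simp add: edge_point_def c_\<beta> far_def)
      then show ?thesis
        using component_class_U[OF ei_I[OF e k] D_edge(1)[OF e k]] D_edge(2)[OF e k] by (simp add: be_def)
    qed
    then show ?thesis by (intro nth_equalityI) (simp_all add: edge_deco_def l)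
  qed
qed

end

section \<open>The bijection\<close>

definition good_subgraphs :: "nat ribbon_graph \<Rightarrow> nat ribbon_graph set" where
  "good_subgraphs G = {H \<in> ribbon_subgraphs G. \<forall>C \<in> components H. generating (induced_graph H C)}"

definition quotient_graph :: "nat ribbon_graph \<Rightarrow> nat ribbon_graph \<Rightarrow> nat ribbon_graph" where
  "quotient_graph G H = delete_bivalent (contract G H)"

text \<open>An empty quotient stands for the open edge, which is no generator; subgraphs with this
  quotient are treated separately.\<close>

definition inserted :: "nat \<Rightarrow> ((nat ribbon_graph \<times> nat) set \<times> nat ribbon_graph) set" where
  "inserted n = {(L, H). L \<in> labelled_classes n \<and> H \<in> good_subgraphs (class_graph L) \<and>
     half_edges (quotient_graph (class_graph L) H) \<noteq> {}}"

type_synonym decoration =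
  "(nat set \<Rightarrow> (nat ribbon_graph \<times> nat) set) \<times> (nat set \<Rightarrow> (nat ribbon_graph \<times> nat) set list)"

definition decorations :: "nat ribbon_graph \<Rightarrow> decoration set" where
  "decorations \<Gamma> = (vertices \<Gamma> \<rightarrow>\<^sub>E labelled_classes 4) \<times> (internal_edges \<Gamma> \<rightarrow>\<^sub>E lists (labelled_classes 2))"

definition insertions :: "nat \<Rightarrow> ((nat ribbon_graph \<times> nat) set \<times> decoration) set" where
  "insertions n = Sigma (labelled_classes n) (\<lambda>M. decorations (class_graph M))"

text \<open>The external half edges of the quotient are exactly those of the original graph, so the
  same root serves as label.\<close>

definition quotient_class ::
    "nat \<Rightarrow> (nat ribbon_graph \<times> nat) set \<Rightarrow> nat ribbon_graph \<Rightarrow> (nat ribbon_graph \<times> nat) set" where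
  "quotient_class n L H = label_class n (quotient_graph (class_graph L) H) (class_root L)"

text \<open>By rigidity this choice is unique on the half edges of the graph, so nothing depends on
  it.\<close>

definition quotient_chart ::
    "nat \<Rightarrow> (nat ribbon_graph \<times> nat) set \<Rightarrow> nat ribbon_graph \<Rightarrow> nat \<Rightarrow> nat" where
  "quotient_chart n L H = (SOME \<psi>.
     graph_iso \<psi> (class_graph (quotient_class n L H)) (quotient_graph (class_graph L) H) \<and>
     \<psi> (class_root (quotient_class n L H)) = class_root L)"

text \<open>\<open>restrict\<close> makes the decorations extensional, so that equal decorations are
  equal functions.\<close>

definition decompose ::
    "nat \<Rightarrow> (nat ribbon_graph \<times> nat) set \<times> nat ribbon_graph \<Rightarrow> (nat ribbon_graph \<times> nat) set \<times> decoration" where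
  "decompose n = (\<lambda>(L, H).
     let M = quotient_class n L H; \<psi> = quotient_chart n L H
     in (M, restrict (vertex_deco H \<psi>) (vertices (class_graph M)),
         restrict (edge_deco (class_graph L) H \<psi>) (internal_edges (class_graph M))))"

definition deco_sum :: "(ck_generator \<Rightarrow> 'b::comm_monoid_add) \<Rightarrow> nat ribbon_graph \<Rightarrow> decoration \<Rightarrow> 'b" where
  "deco_sum f \<Gamma> = (\<lambda>(\<omega>, l). (\<Sum>c\<in>vertices \<Gamma>. f (forget_label (\<omega> c))) +
     (\<Sum>e\<in>internal_edges \<Gamma>. \<Sum>L\<leftarrow>l e. f (forget_label L)))"

lemma good_contraction:
  "L \<in> labelled_classes n \<Longrightarrow> n = 2 \<or> n = 4 \<Longrightarrow> H \<in> good_subgraphs (class_graph L) \<Longrightarrow>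
    contraction (class_graph L) H"
  using labelledD(4)[OF class_graph(1)] by (auto simp: contraction_def good_subgraphs_def)

lemma good_subgraphs_contraction: "contraction G H \<Longrightarrow> H \<in> good_subgraphs G"
  by (simp add: contraction_def good_subgraphs_def)

lemma contraction_K: "contraction G H \<Longrightarrow> contraction.K G H = quotient_graph G H"
  by (simp add: contraction.K_def quotient_graph_def)

lemma inserted_full:
  assumes n: "n = 2 \<or> n = 4" and LH: "(L, H) \<in> inserted n"
  shows "full_contraction (class_graph L) H"
    "n_point_generating n (quotient_graph (class_graph L) H)"
    "(quotient_graph (class_graph L) H, class_root L) \<in> labelled n"
    "quotient_class n L H \<in> labelled_classes n"
    "chart (class_graph L) H (class_graph (quotient_class n L H)) (quotient_chart n L H)"
    "quotient_chart n L H (class_root (quotient_class n L H)) = class_root L"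
proof -
  let ?G = "class_graph L" and ?h = "class_root L"
  let ?M = "quotient_class n L H"
  have L: "L \<in> labelled_classes n" "H \<in> good_subgraphs ?G" "half_edges (quotient_graph ?G H) \<noteq> {}"
    using LH by (auto simp: inserted_def)
  interpret contraction ?G H by (rule good_contraction[OF L(1) n L(2)])
  have KQ: "K = quotient_graph ?G H" by (simp add: K_def quotient_graph_def)
  note d = labelledD[OF class_graph(1)[OF L(1) n]]
  have "R \<noteq> {}" using L(3) K_sel(1) KQ by simp
  then show "full_contraction ?G H" by (rule full_contraction[OF d(1)])
  then interpret full_contraction ?G H .
  show np: "n_point_generating n (quotient_graph ?G H)" using n_point_generating_iff_K d(1) KQ by simp
  show l: "(quotient_graph ?G H, ?h) \<in> labelled n"
    using np d(2) external_K KQ by (simp add: labelled_def)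
  show M: "?M \<in> labelled_classes n" unfolding quotient_class_def by (rule label_class_in[OF l])
  have "\<exists>\<psi>. graph_iso \<psi> (class_graph ?M) (quotient_graph ?G H) \<and> \<psi> (class_root ?M) = ?h"
    using label_class_eq_iff[OF class_graph(1)[OF M n] l] class_graph(2)[OF M n]
    by (simp add: quotient_class_def)
  from someI_ex[OF this, folded quotient_chart_def]
  have \<psi>: "graph_iso (quotient_chart n L H) (class_graph ?M) (quotient_graph ?G H)"
    "quotient_chart n L H (class_root ?M) = ?h" by auto
  show "quotient_chart n L H (class_root ?M) = ?h" by (rule \<psi>(2))
  show "chart ?G H (class_graph ?M) (quotient_chart n L H)"
    by unfold_locales (use \<psi>(1) KQ labelledD(4)[OF class_graph(1)[OF M n]] in simp_all)
qed

text \<open>Injective: \<open>chart_unique\<close> yields an isomorphism that carries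
  \<open>H\<close> to \<open>H'\<close> and preserves roots, so \<open>L = L'\<close>; by rigidity
  it is the identity, whence \<open>H\<close> and \<open>H'\<close> are equal and not just
  isomorphic. Surjective: the glued graph with its subgraph is moved to the representative of its
  class.\<close>

lemma bij_decompose:
  assumes n: "n = 2 \<or> n = 4"
  shows "bij_betw (decompose n) (inserted n) (insertions n)"
  unfolding bij_betw_def
proof
  show "inj_on (decompose n) (inserted n)"
  proof (rule inj_onI, clarify)
    fix L H L' H' assume LH: "(L, H) \<in> inserted n" "(L', H') \<in> inserted n"
      and e: "decompose n (L, H) = decompose n (L', H')"
    note f = inserted_full[OF n LH(1)] and f' = inserted_full[OF n LH(2)]
    have L: "L \<in> labelled_classes n" "L' \<in> labelled_classes n" using LH by (auto simp: inserted_def)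
    let ?M = "quotient_class n L H"
    let ?\<Gamma> = "class_graph ?M"
    have M: "quotient_class n L' H' = ?M" using e by (simp add: decompose_def Let_def)
    have v: "restrict (vertex_deco H (quotient_chart n L H)) (vertices ?\<Gamma>)
        = restrict (vertex_deco H' (quotient_chart n L' H')) (vertices ?\<Gamma>)"
      and ed: "restrict (edge_deco (class_graph L) H (quotient_chart n L H)) (internal_edges ?\<Gamma>)
        = restrict (edge_deco (class_graph L') H' (quotient_chart n L' H')) (internal_edges ?\<Gamma>)"
      using e M by (simp_all add: decompose_def Let_def)
    have "vertex_deco H (quotient_chart n L H) c = vertex_deco H' (quotient_chart n L' H') c"
      if "c \<in> vertices ?\<Gamma>" for c using fun_cong[OF v, of c] that by simp
    moreover have "edge_deco (class_graph L) H (quotient_chart n L H) c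
        = edge_deco (class_graph L') H' (quotient_chart n L' H') c"
      if "c \<in> internal_edges ?\<Gamma>" for c using fun_cong[OF ed, of c] that by simp
    ultimately obtain J where J: "graph_iso J (class_graph L) (class_graph L')" "graph_iso J H H'"
      "\<And>y. y \<in> half_edges ?\<Gamma> \<Longrightarrow> J (quotient_chart n L H y) = quotient_chart n L' H' y"
      using chart_unique[OF f(5) f'(5)[unfolded M]] by blast
    have root: "class_root ?M \<in> half_edges ?\<Gamma>" using labelledD(3)[OF class_graph(1)[OF f(4) n]] .
    have Jh: "J (class_root L) = class_root L'" using J(3)[OF root] f(6) f'(6) M by simp
    note c = class_graph[OF L(1) n] and c' = class_graph[OF L(2) n]
    have LL: "L = L'" using label_class_eq_iff[OF c(1) c'(1)] J(1) Jh c(2) c'(2) by auto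
    note d = labelledD[OF c(1)]
    have id: "graph_iso id (class_graph L) (class_graph L)" by (simp add: graph_iso_def)
    have Jid: "J x = x" if "x \<in> half_edges (class_graph L)" for x
      using graph_iso_rigid[OF d(4) n_point_generatingD(2)[OF d(1)] _ id d(3) _ that, of J] J(1) Jh LL by simp
    interpret a: full_contraction "class_graph L" H by (rule f(1))
    interpret b: full_contraction "class_graph L" H' using f'(1) LL by simp
    have "einv H x = einv H' x" for x
    proof (cases "x \<in> half_edges (class_graph L)")
      case True
      then show ?thesis
        using graph_isoD(6)[OF J(2), of x] Jid[of x] Jid[of "einv H x"] a.H_sel(2) a.rH(6) by simp
    next
      case False
      then show ?thesis using permutes_not_in[OF a.rH(3)] permutes_not_in[OF b.rH(3)] by simp
    qed
    then have "H = H'" using a.H_sel b.H_sel by (intro ribbon_graph.equality) auto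
    with LL show "L = L' \<and> H = H'" by simp
  qed
  show "decompose n ` inserted n = insertions n"
  proof (intro equalityI subsetI)
    fix b assume "b \<in> decompose n ` inserted n"
    then obtain L H where LH: "(L, H) \<in> inserted n" "b = decompose n (L, H)" by auto
    note f = inserted_full[OF n LH(1)]
    then show "b \<in> insertions n"
      using chart.vertex_deco_in[OF f(5)] chart.edge_deco_in[OF f(5)]
      by (auto simp: LH(2) decompose_def Let_def insertions_def decorations_def)
  next
    fix b assume b: "b \<in> insertions n"
    then obtain M \<omega> \<mu> where M: "b = (M, \<omega>, \<mu>)" "M \<in> labelled_classes n"
      "\<omega> \<in> vertices (class_graph M) \<rightarrow>\<^sub>E labelled_classes 4"
      "\<mu> \<in> internal_edges (class_graph M) \<rightarrow>\<^sub>E lists (labelled_classes 2)"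
      by (auto simp: insertions_def decorations_def)
    let ?\<Gamma> = "class_graph M"
    note cM = class_graph[OF M(2) n]
    note dM = labelledD[OF cM(1)]
    interpret gluing ?\<Gamma> \<omega> \<mu>
      by unfold_locales (use dM(4) n_point_generatingD(6)[OF dM(1)] M(3,4) in auto)
    note gc = glue_chart
    interpret ch: chart glued U ?\<Gamma> \<psi> by (rule gc(1))
    have npG: "n_point_generating n glued"
      using c.n_point_generating_iff_K n_point_generating_iso[OF ch.\<psi> c.rib_K dM(1)] by simp
    have "\<psi> (class_root M) \<in> external glued"
      using ch.external_\<Gamma>[OF dM(3)] dM(2) by (simp add: external_iff)
    then have lab: "(glued, \<psi> (class_root M)) \<in> labelled n" using npG by (simp add: labelled_def)
    define L where "L = label_class n glued (\<psi> (class_root M))"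
    have L: "L \<in> labelled_classes n" unfolding L_def by (rule label_class_in[OF lab])
    note cL = class_graph[OF L n]
    obtain \<phi> where \<phi>: "graph_iso \<phi> glued (class_graph L)" "\<phi> (\<psi> (class_root M)) = class_root L"
      using label_class_eq_iff[OF lab cL(1)] cL(2) by (auto simp: L_def)
    obtain H where H: "chart (class_graph L) H ?\<Gamma> (\<phi> \<circ> \<psi>)"
      "\<And>c. c \<in> vertices ?\<Gamma> \<Longrightarrow> vertex_deco H (\<phi> \<circ> \<psi>) c = vertex_deco U \<psi> c"
      "\<And>e. e \<in> internal_edges ?\<Gamma> \<Longrightarrow> edge_deco (class_graph L) H (\<phi> \<circ> \<psi>) e = edge_deco glued U \<psi> e"
      using chart_transport[OF gc(1) \<phi>(1) labelledD(4)[OF cL(1)]] by blast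
    interpret c2: chart "class_graph L" H ?\<Gamma> "\<phi> \<circ> \<psi>" by (rule H(1))
    have KQ: "c2.K = quotient_graph (class_graph L) H" by (simp add: c2.K_def quotient_graph_def)
    have "half_edges c2.K \<noteq> {}" using graph_isoD(4)[OF c2.\<psi> dM(3)] by blast
    then have ins: "(L, H) \<in> inserted n"
      using L good_subgraphs_contraction[OF c2.contraction_axioms] KQ by (simp add: inserted_def)
    note f = inserted_full[OF n ins]
    have "label_class n (quotient_graph (class_graph L) H) ((\<phi> \<circ> \<psi>) (class_root M)) = label_class n ?\<Gamma> (class_root M)"
      by (rule label_class_iso[OF cM(1) c2.\<psi>[unfolded KQ] c2.rib_K[unfolded KQ]])
    then have QM: "quotient_class n L H = M" using \<phi>(2) cM(2) by (simp add: quotient_class_def)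
    interpret c3: chart "class_graph L" H ?\<Gamma> "quotient_chart n L H" using f(5) QM by simp
    \<comment> \<open>The chart picked by \<open>quotient_chart\<close> and the one obtained from
      gluing both preserve roots, so they coincide and read off the same decorations.\<close>
    have eq: "quotient_chart n L H y = (\<phi> \<circ> \<psi>) y" if "y \<in> half_edges ?\<Gamma>" for y
      using graph_iso_rigid[OF dM(4) n_point_generatingD(2)[OF dM(1)] c3.\<psi> c2.\<psi> dM(3) _ that] f(6) QM \<phi>(2)
      by simp
    have "vertex_deco H (quotient_chart n L H) c = \<omega> c" if c: "c \<in> vertices ?\<Gamma>" for c
    proof -
      have "Min c \<in> half_edges ?\<Gamma>" using vertex_Min[OF dM(4) c] by blast
      then have "vertex_deco H (quotient_chart n L H) c = vertex_deco H (\<phi> \<circ> \<psi>) c"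
        unfolding vertex_deco_def using eq by simp
      then show ?thesis using H(2)[OF c] gc(2)[OF c] by simp
    qed
    then have v: "restrict (vertex_deco H (quotient_chart n L H)) (vertices ?\<Gamma>) = \<omega>"
      using M(3) by (intro extensionalityI[of _ "vertices ?\<Gamma>"]) (auto simp: PiE_def)
    have "edge_deco (class_graph L) H (quotient_chart n L H) e = \<mu> e" if e: "e \<in> internal_edges ?\<Gamma>" for e
    proof -
      have "Min e \<in> half_edges ?\<Gamma>" by (rule edge_Min(1)[OF dM(4) e])
      then have "edge_deco (class_graph L) H (quotient_chart n L H) e = edge_deco (class_graph L) H (\<phi> \<circ> \<psi>) e"
        unfolding edge_deco_def edge_length_def edge_point_def using eq by simp
      then show ?thesis using H(3)[OF e] gc(3)[OF e] by simp
    qed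
    then have "restrict (edge_deco (class_graph L) H (quotient_chart n L H)) (internal_edges ?\<Gamma>) = \<mu>"
      using M(4) by (intro extensionalityI[of _ "internal_edges ?\<Gamma>"]) (auto simp: PiE_def)
    then have "decompose n (L, H) = b" unfolding M(1) decompose_def by (simp add: Let_def QM v)
    then show "b \<in> decompose n ` inserted n" using ins by force
  qed
qed

lemma image_mset_set_sum: "finite A \<Longrightarrow> image_mset f (mset_set A) = (\<Sum>x\<in>A. {#f x#})"
  by (induction A rule: finite_induct) simp_all

lemma deco_sum_restrict:
  "deco_sum f \<Gamma> (restrict \<omega> (vertices \<Gamma>), restrict l (internal_edges \<Gamma>)) = deco_sum f \<Gamma> (\<omega>, l)"
  by (simp add: deco_sum_def)

lemma decompose_weights:
  assumes n: "n = 2 \<or> n = 4" and LH: "(L, H) \<in> inserted n" and D: "decompose n (L, H) = (M, d)"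
  shows "graph_monomial H = deco_sum (\<lambda>g. {#g#}) (class_graph M) d"
    "graph_monomial (quotient_graph (class_graph L) H) = {#forget_label M#}"
    "gen_loops (forget_label L) = gen_loops (forget_label M) + deco_sum gen_loops (class_graph M) d"
proof -
  note f = inserted_full[OF n LH]
  let ?G = "class_graph L" and ?\<psi> = "quotient_chart n L H"
  have M: "M = quotient_class n L H" using D by (simp add: decompose_def Let_def)
  interpret chart ?G H "class_graph M" ?\<psi> unfolding M by (rule f(5))
  have d: "deco_sum g (class_graph M) d = deco_sum g (class_graph M) (vertex_deco H ?\<psi>, edge_deco ?G H ?\<psi>)"
    "deco_sum k (class_graph M) d = deco_sum k (class_graph M) (vertex_deco H ?\<psi>, edge_deco ?G H ?\<psi>)"
    for g :: "ck_generator \<Rightarrow> ck_generator multiset" and k :: "ck_generator \<Rightarrow> nat"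
    using D by (auto simp: decompose_def Let_def deco_sum_restrict)
  have fin: "finite (components H)" using r(1) by (simp add: components_eq H_sel(2))
  show "graph_monomial H = deco_sum (\<lambda>g. {#g#}) (class_graph M) d"
    unfolding graph_monomial_def image_mset_set_sum[OF fin] d(1)
    unfolding deco_sum_def prod.case by (rule sum_components)
  have KQ: "K = quotient_graph ?G H" by (simp add: K_def quotient_graph_def)
  have "gen_loops (forget_label L) = loop_order K + loop_order H"
    using loop_order_eq by (simp add: gen_loops_forget)
  also have "loop_order K = gen_loops (forget_label M)"
    using \<psi>.loop_order by (simp add: gen_loops_forget)
  also have "loop_order H = (\<Sum>C\<in>components H. gen_loops (abs_ck_generator (induced_graph H C)))"
    unfolding loop_order_components[OF H_sel(1)] by (rule sum.cong) (simp_all add: gen_loops_abs gen)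
  also have "\<dots> = deco_sum gen_loops (class_graph M) d"
    unfolding d(2) unfolding deco_sum_def prod.case by (rule sum_components)
  finally show "gen_loops (forget_label L) = gen_loops (forget_label M) + deco_sum gen_loops (class_graph M) d" .
  note np = f(2)[folded KQ]
  have "graph_monomial K = {#abs_ck_generator K#}"
    unfolding graph_monomial_def
      connected_components[OF rib_K n_point_generatingD(2)[OF np] n_point_generating_nonempty[OF np]]
    by (simp add: induced_graph_whole[OF rib_K])
  also have "abs_ck_generator K = forget_label M"
    using forget_label_class[OF f(3) n] by (simp add: KQ M quotient_class_def)
  finally show "graph_monomial (quotient_graph ?G H) = {#forget_label M#}" by (simp add: KQ)
qed

lemma finite_good_subgraphs: "ribbon_graph G \<Longrightarrow> finite (good_subgraphs G)"
proof -
  assume G: "ribbon_graph G"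
  have "good_subgraphs G \<subseteq>
      (\<lambda>p. \<lparr>half_edges = half_edges G, vperm = vperm G, einv = p\<rparr>) ` {p. p permutes half_edges G}"
  proof
    fix H assume "H \<in> good_subgraphs G"
    then have H: "ribbon_graph H" "half_edges H = half_edges G" "vperm H = vperm G"
      by (auto simp: good_subgraphs_def ribbon_subgraphs_def)
    then have "H = \<lparr>half_edges = half_edges G, vperm = vperm G, einv = einv H\<rparr>"
      by (intro ribbon_graph.equality) auto
    then show "H \<in> (\<lambda>p. \<lparr>half_edges = half_edges G, vperm = vperm G, einv = p\<rparr>) ` {p. p permutes half_edges G}"
      using ribbon_graphD(3)[OF H(1)] H(2) by auto
  qed
  moreover have "finite {p. p permutes half_edges G}"
    by (rule finite_permutations[OF ribbon_graphD(1)[OF G]])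
  ultimately show ?thesis using finite_subset by blast
qed

definition insertion_term ::
    "(nat ribbon_graph \<times> nat) set \<times> decoration \<Rightarrow> ck_generator multiset \<times> ck_generator multiset" where
  "insertion_term = (\<lambda>(M, d). (deco_sum (\<lambda>g. {#g#}) (class_graph M) d, {#forget_label M#}))"

definition insertion_loops :: "(nat ribbon_graph \<times> nat) set \<times> decoration \<Rightarrow> nat" where
  "insertion_loops = (\<lambda>(M, d). gen_loops (forget_label M) + deco_sum gen_loops (class_graph M) d)"

text \<open>Subgraphs with empty quotient are split off. For n = 2 this is exactly
  \<open>H = G\<close>; for n = 4 there are none, since \<open>H = G\<close> contracts to the single
  vertex.\<close>

lemma coproduct_graph_class:
  assumes n: "n = 2 \<or> n = 4" and L: "L \<in> labelled_classes n"
  shows "coproduct_graph (class_graph L) =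
    (\<Sum>H | (L, H) \<in> inserted n. Poly_Mapping.single (graph_monomial H, graph_monomial (quotient_graph (class_graph L) H)) 1)
    + (if n = 2 then Poly_Mapping.single ({#forget_label L#}, {#}) 1 else 0)"
proof -
  let ?G = "class_graph L"
  let ?t = "\<lambda>H. Poly_Mapping.single (graph_monomial H, graph_monomial (quotient_graph ?G H)) (1::rat)"
  note c = class_graph[OF L n]
  note d = labelledD[OF c(1)]
  have fin: "finite (good_subgraphs ?G)" by (rule finite_good_subgraphs[OF d(4)])
  have gc: "contraction ?G H" if "H \<in> good_subgraphs ?G" for H by (rule good_contraction[OF L n that])
  have R: "half_edges (quotient_graph ?G H) = contraction.R ?G H" if "H \<in> good_subgraphs ?G" for H
    using contraction.K_sel(1)[OF gc[OF that]] contraction_K[OF gc[OF that]] by simp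
  let ?A = "{H. (L, H) \<in> inserted n}"
  let ?B = "{H \<in> good_subgraphs ?G. contraction.R ?G H = {}}"
  have A: "?A = {H \<in> good_subgraphs ?G. contraction.R ?G H \<noteq> {}}"
    using R L by (auto simp: inserted_def)
  have "coproduct_graph ?G = (\<Sum>H\<in>good_subgraphs ?G. ?t H)"
    unfolding coproduct_graph_def good_subgraphs_def quotient_graph_def by simp
  also have "good_subgraphs ?G = ?A \<union> ?B" unfolding A by blast
  also have "(\<Sum>H\<in>?A \<union> ?B. ?t H) = (\<Sum>H\<in>?A. ?t H) + (\<Sum>H\<in>?B. ?t H)"
    using fin unfolding A by (intro sum.union_disjoint) auto
  also have "(\<Sum>H\<in>?B. ?t H) = (if n = 2 then Poly_Mapping.single ({#forget_label L#}, {#}) 1 else 0)"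
  proof (cases "n = 2")
    case True
    have comp: "components ?G = {half_edges ?G}"
      by (rule connected_components[OF d(4) n_point_generatingD(2)[OF d(1)] n_point_generating_nonempty[OF d(1)]])
    have "?G \<in> good_subgraphs ?G"
      using d(1,4) True comp by (auto simp: good_subgraphs_def ribbon_subgraphs_def induced_graph_whole generating_def)
    moreover have "contraction.R ?G ?G = {}"
      using contraction.whole_graph_K_empty[OF gc[OF calculation]] d(1) True by simp
    moreover have "H = ?G" if "H \<in> ?B" for H
      using contraction.no_four_point_component(2)[OF gc, of H n] d(1) that by auto
    ultimately have "?B = {?G}" "half_edges (quotient_graph ?G ?G) = {}" using R by auto
    moreover have "graph_monomial ?G = {#forget_label L#}"
      using comp by (simp add: graph_monomial_def induced_graph_whole[OF d(4)] abs_class_graph)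
    moreover have "graph_monomial (quotient_graph ?G ?G) = {#}"
      using calculation(2) by (simp add: graph_monomial_def components_eq)
    ultimately show ?thesis using True by simp
  next
    case False
    then have "?B = {}" using contraction.no_four_point_component(1)[OF gc] d(1) by auto
    then show ?thesis using False by (simp only: sum.empty if_False)
  qed
  finally show ?thesis .
qed

text \<open>At fixed loop order all sums are finite, and \<open>decompose\<close> preserves both the
  loop order and the tensor monomial.\<close>

lemma coproduct_classes:
  assumes n: "n = 2 \<or> n = 4"
  shows "(\<Sum>L | L \<in> labelled_classes n \<and> gen_loops (forget_label L) = N. coproduct_graph (class_graph L)) =
      (\<Sum>b | b \<in> insertions n \<and> insertion_loops b = N. Poly_Mapping.single (insertion_term b) 1) +
      (if n = 2 then (\<Sum>L | L \<in> labelled_classes n \<and> gen_loops (forget_label L) = N.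
         Poly_Mapping.single ({#forget_label L#}, {#}) 1) else 0)"
    and "finite {b \<in> insertions n. insertion_loops b = N}"
proof -
  let ?S = "{L \<in> labelled_classes n. gen_loops (forget_label L) = N}"
  let ?t = "\<lambda>L H. Poly_Mapping.single (graph_monomial H, graph_monomial (quotient_graph (class_graph L) H)) (1::rat)"
  let ?A = "{x \<in> inserted n. gen_loops (forget_label (fst x)) = N}"
  have finS: "finite ?S" by (rule finite_labelled_classes[OF n])
  have finH: "finite {H. (L, H) \<in> inserted n}" if "L \<in> labelled_classes n" for L
    by (rule finite_subset[OF _ finite_good_subgraphs[OF labelledD(4)[OF class_graph(1)[OF that n]]]])
      (auto simp: inserted_def)
  have A: "?A = Sigma ?S (\<lambda>L. {H. (L, H) \<in> inserted n})" by (auto simp: inserted_def)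
  have finA: "finite ?A" unfolding A using finS finH by (intro finite_SigmaI) auto
  have w: "insertion_loops (decompose n x) = gen_loops (forget_label (fst x)) \<and>
      insertion_term (decompose n x) = (graph_monomial (snd x), graph_monomial (quotient_graph (class_graph (fst x)) (snd x)))"
    if "x \<in> inserted n" for x
  proof -
    obtain L H where x: "x = (L, H)" by (cases x)
    obtain M d where D: "decompose n (L, H) = (M, d)" by (cases "decompose n (L, H)")
    show ?thesis using decompose_weights[OF n _ D] that
      by (simp add: x D insertion_loops_def insertion_term_def)
  qed
  have b: "bij_betw (decompose n) ?A {b \<in> insertions n. insertion_loops b = N}"
    unfolding bij_betw_def
  proof
    show "inj_on (decompose n) ?A"
      by (rule inj_on_subset[OF bij_betw_imp_inj_on[OF bij_decompose[OF n]]]) blast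
    have "insertions n = decompose n ` inserted n"
      using bij_betw_imp_surj_on[OF bij_decompose[OF n]] by simp
    then show "decompose n ` ?A = {b \<in> insertions n. insertion_loops b = N}"
      using w by (auto intro: rev_image_eqI)
  qed
  then show "finite {b \<in> insertions n. insertion_loops b = N}" using finA bij_betw_finite by blast
  have "(\<Sum>L\<in>?S. coproduct_graph (class_graph L)) = (\<Sum>L\<in>?S. \<Sum>H | (L, H) \<in> inserted n. ?t L H) +
      (\<Sum>L\<in>?S. if n = 2 then Poly_Mapping.single ({#forget_label L#}, {#}) 1 else 0)"
    unfolding sum.distrib[symmetric]
    by (rule sum.cong[OF refl], rule coproduct_graph_class[OF n]) simp
  also have "(\<Sum>L\<in>?S. \<Sum>H | (L, H) \<in> inserted n. ?t L H) = (\<Sum>(L, H)\<in>?A. ?t L H)"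
    unfolding A using finS finH by (intro sum.Sigma) auto
  also have "\<dots> = (\<Sum>x\<in>?A. Poly_Mapping.single (insertion_term (decompose n x)) 1)"
    by (rule sum.cong) (use w in auto)
  also have "\<dots> = (\<Sum>b | b \<in> insertions n \<and> insertion_loops b = N. Poly_Mapping.single (insertion_term b) 1)"
    by (rule sum.reindex_bij_betw[OF b])
  finally show "(\<Sum>L | L \<in> labelled_classes n \<and> gen_loops (forget_label L) = N. coproduct_graph (class_graph L)) =
      (\<Sum>b | b \<in> insertions n \<and> insertion_loops b = N. Poly_Mapping.single (insertion_term b) 1) +
      (if n = 2 then (\<Sum>L | L \<in> labelled_classes n \<and> gen_loops (forget_label L) = N.
         Poly_Mapping.single ({#forget_label L#}, {#}) 1) else 0)"
    by simp
qed

section \<open>Formal sums\<close>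

unbundle fps_syntax

text \<open>A sum over an infinite fibre would be 0 by convention, hence the condition
  \<open>finite_fibres\<close> accompanying the rules below.\<close>

definition series_of :: "'i set \<Rightarrow> ('i \<Rightarrow> nat) \<Rightarrow> ('i \<Rightarrow> 'r::comm_ring_1) \<Rightarrow> 'r fps" where
  "series_of S d w = Abs_fps (\<lambda>n. \<Sum>s | s \<in> S \<and> d s = n. w s)"

definition finite_fibres :: "'i set \<Rightarrow> ('i \<Rightarrow> nat) \<Rightarrow> bool" where
  "finite_fibres S d \<longleftrightarrow> (\<forall>n. finite {s \<in> S. d s = n})"

lemma series_of_nth: "series_of S d w $ n = (\<Sum>s | s \<in> S \<and> d s = n. w s)"
  by (simp add: series_of_def)

lemma finite_fibres_le: "finite_fibres S d \<Longrightarrow> finite {s \<in> S. d s \<le> n}"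
proof -
  assume "finite_fibres S d"
  moreover have "{s \<in> S. d s \<le> n} = (\<Union>m\<le>n. {s \<in> S. d s = m})" by auto
  ultimately show ?thesis by (simp add: finite_fibres_def)
qed

lemma series_of_reindex:
  assumes "bij_betw \<phi> S T" "\<And>s. s \<in> S \<Longrightarrow> d s = e (\<phi> s) \<and> v s = w (\<phi> s)"
  shows "series_of S d v = series_of T e w" "finite_fibres T e \<longleftrightarrow> finite_fibres S d"
proof -
  have b: "bij_betw \<phi> {s \<in> S. d s = n} {t \<in> T. e t = n}" for n
    using assms by (auto simp: bij_betw_def intro: inj_on_subset)
  show "finite_fibres T e \<longleftrightarrow> finite_fibres S d"
    unfolding finite_fibres_def using bij_betw_finite[OF b] by simp
  show "series_of S d v = series_of T e w"
    unfolding series_of_def using assms(2)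
    by (auto simp: fps_eq_iff sum.reindex_bij_betw[OF b, symmetric] intro!: sum.cong)
qed

lemma series_of_mult:
  assumes "finite_fibres S d" "finite_fibres T e"
  shows "series_of S d v * series_of T e w = series_of (S \<times> T) (\<lambda>(s, t). d s + e t) (\<lambda>(s, t). v s * w t)"
    and "finite_fibres (S \<times> T) (\<lambda>(s, t). d s + e t)"
proof -
  let ?A = "\<lambda>n i. {s \<in> S. d s = i} \<times> {t \<in> T. e t = n - i}"
  have U: "{x \<in> S \<times> T. (\<lambda>(s, t). d s + e t) x = n} = (\<Union>i\<in>{0..n}. ?A n i)" for n by auto
  have fin: "finite (?A n i)" for n i using assms by (simp add: finite_fibres_def)
  then show "finite_fibres (S \<times> T) (\<lambda>(s, t). d s + e t)" unfolding finite_fibres_def U by blast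
  show "series_of S d v * series_of T e w = series_of (S \<times> T) (\<lambda>(s, t). d s + e t) (\<lambda>(s, t). v s * w t)"
  proof (rule fps_ext)
    fix n
    have "series_of (S \<times> T) (\<lambda>(s, t). d s + e t) (\<lambda>(s, t). v s * w t) $ n =
        (\<Sum>i\<in>{0..n}. \<Sum>(s, t)\<in>?A n i. v s * w t)"
      unfolding series_of_nth U by (rule sum.UNION_disjoint) (use fin in auto)
    also have "\<dots> = (\<Sum>i\<in>{0..n}. (\<Sum>s | s \<in> S \<and> d s = i. v s) * (\<Sum>t | t \<in> T \<and> e t = n - i. w t))"
      by (simp add: sum_product sum.cartesian_product)
    finally show "(series_of S d v * series_of T e w) $ n =
        series_of (S \<times> T) (\<lambda>(s, t). d s + e t) (\<lambda>(s, t). v s * w t) $ n"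
      by (simp add: fps_mult_nth series_of_nth)
  qed
qed

lemma series_of_singleton: "series_of {x} d w = fps_const (w x) * fps_X ^ d x"
proof (rule fps_ext)
  fix n
  have "{s. s = x \<and> d s = n} = (if d x = n then {x} else {})" by auto
  then show "series_of {x} d w $ n = (fps_const (w x) * fps_X ^ d x) $ n"
    by (simp add: series_of_nth fps_X_power_nth)
qed

text \<open>Expanding a power chooses one term from each factor, so the terms are functions on a set
  indexing the factors.\<close>

lemma series_of_PiE:
  assumes "finite I" "finite_fibres S d"
  shows "series_of S d w ^ card I = series_of (I \<rightarrow>\<^sub>E S) (\<lambda>f. \<Sum>i\<in>I. d (f i)) (\<lambda>f. \<Prod>i\<in>I. w (f i))"
    and "finite_fibres (I \<rightarrow>\<^sub>E S) (\<lambda>f. \<Sum>i\<in>I. d (f i))"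
proof -
  have "series_of S d w ^ card I = series_of (I \<rightarrow>\<^sub>E S) (\<lambda>f. \<Sum>i\<in>I. d (f i)) (\<lambda>f. \<Prod>i\<in>I. w (f i))
    \<and> finite_fibres (I \<rightarrow>\<^sub>E S) (\<lambda>f. \<Sum>i\<in>I. d (f i))"
    using assms(1)
  proof (induction I rule: finite_induct)
    case empty
    show ?case by (simp add: series_of_singleton finite_fibres_def)
  next
    case (insert x I)
    let ?\<phi> = "\<lambda>(y, g). g(x := y)"
    have b: "bij_betw ?\<phi> (S \<times> (I \<rightarrow>\<^sub>E S)) (insert x I \<rightarrow>\<^sub>E S)"
      unfolding bij_betw_def PiE_insert_eq using inj_combinator[OF insert(2), of "\<lambda>_. S"] by simp
    have eq: "(\<lambda>(s, f). d s + (\<Sum>i\<in>I. d (f i))) p = (\<Sum>i\<in>insert x I. d (?\<phi> p i)) \<and>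
        (\<lambda>(s, f). w s * (\<Prod>i\<in>I. w (f i))) p = (\<Prod>i\<in>insert x I. w (?\<phi> p i))"
      if "p \<in> S \<times> (I \<rightarrow>\<^sub>E S)" for p
    proof -
      obtain y g where p: "p = (y, g)" by (cases p)
      have "(\<Sum>i\<in>I. d ((g(x := y)) i)) = (\<Sum>i\<in>I. d (g i))" "(\<Prod>i\<in>I. w ((g(x := y)) i)) = (\<Prod>i\<in>I. w (g i))"
        using insert(2) by (auto intro!: sum.cong prod.cong)
      then show ?thesis using insert(1,2) by (simp add: p)
    qed
    note m = series_of_mult(1)[OF assms(2) conjunct2[OF insert.IH], of w "\<lambda>f. \<Prod>i\<in>I. w (f i)"]
      series_of_mult(2)[OF assms(2) conjunct2[OF insert.IH]]
    have r: "series_of (S \<times> (I \<rightarrow>\<^sub>E S)) (\<lambda>(s, f). d s + (\<Sum>i\<in>I. d (f i))) (\<lambda>(s, f). w s * (\<Prod>i\<in>I. w (f i)))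
        = series_of (insert x I \<rightarrow>\<^sub>E S) (\<lambda>f. \<Sum>i\<in>insert x I. d (f i)) (\<lambda>f. \<Prod>i\<in>insert x I. w (f i))"
      by (rule series_of_reindex(1)[OF b]) (rule eq)
    have r': "finite_fibres (insert x I \<rightarrow>\<^sub>E S) (\<lambda>f. \<Sum>i\<in>insert x I. d (f i)) \<longleftrightarrow>
        finite_fibres (S \<times> (I \<rightarrow>\<^sub>E S)) (\<lambda>(s, f). d s + (\<Sum>i\<in>I. d (f i)))"
      by (rule series_of_reindex(2)[OF b, of _ _ "\<lambda>(s, f). w s * (\<Prod>i\<in>I. w (f i))" "\<lambda>f. \<Prod>i\<in>insert x I. w (f i)"]) (rule eq)
    have "series_of S d w ^ card (insert x I) = series_of S d w * series_of (I \<rightarrow>\<^sub>E S) (\<lambda>f. \<Sum>i\<in>I. d (f i)) (\<lambda>f. \<Prod>i\<in>I. w (f i))"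
      using insert by simp
    then show ?case using m r r' by simp
  qed
  then show "series_of S d w ^ card I = series_of (I \<rightarrow>\<^sub>E S) (\<lambda>f. \<Sum>i\<in>I. d (f i)) (\<lambda>f. \<Prod>i\<in>I. w (f i))"
    "finite_fibres (I \<rightarrow>\<^sub>E S) (\<lambda>f. \<Sum>i\<in>I. d (f i))" by auto
qed

text \<open>A list is empty or a head with a tail, so the series W of lists satisfies W = 1 + sW.
  Positive degrees bound the length and the entries of a list of given degree.\<close>

lemma series_of_lists:
  assumes "finite_fibres S d" "\<And>s. s \<in> S \<Longrightarrow> 0 < d s"
  shows "finite_fibres (lists S) (\<lambda>xs. \<Sum>x\<leftarrow>xs. d x)"
    "(1 - series_of S d w) * series_of (lists S) (\<lambda>xs. \<Sum>x\<leftarrow>xs. d x) (\<lambda>xs. \<Prod>x\<leftarrow>xs. w x) = 1"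
proof -
  let ?d = "\<lambda>xs. \<Sum>x\<leftarrow>xs. d x" and ?w = "\<lambda>xs. \<Prod>x\<leftarrow>xs. w x"
  have bound: "length xs \<le> ?d xs \<and> set xs \<subseteq> {s \<in> S. d s \<le> ?d xs}" if "xs \<in> lists S" for xs
    using that
  proof (induction xs)
    case (Cons x xs)
    then have "0 < d x" using assms(2) by auto
    then show ?case using Cons by fastforce
  qed simp
  show fib: "finite_fibres (lists S) ?d" unfolding finite_fibres_def
  proof
    fix n
    have "{xs \<in> lists S. ?d xs = n} \<subseteq> {xs. set xs \<subseteq> {s \<in> S. d s \<le> n} \<and> length xs \<le> n}"
      using bound by blast
    then show "finite {xs \<in> lists S. ?d xs = n}"
      using finite_lists_length_le[OF finite_fibres_le[OF assms(1)]] finite_subset by blast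
  qed
  let ?c = "\<lambda>(x, xs). x # xs"
  have b: "bij_betw ?c (S \<times> lists S) (lists S - {[]})"
    unfolding bij_betw_def
  proof
    show "inj_on ?c (S \<times> lists S)" by (auto simp: inj_on_def)
    show "?c ` (S \<times> lists S) = lists S - {[]}"
    proof (intro equalityI subsetI)
      fix xs assume "xs \<in> lists S - {[]}"
      then show "xs \<in> ?c ` (S \<times> lists S)" by (cases xs) auto
    qed auto
  qed
  have "series_of S d w * series_of (lists S) ?d ?w = series_of (lists S - {[]}) ?d ?w"
    unfolding series_of_mult(1)[OF assms(1) fib] by (rule series_of_reindex(1)[OF b]) auto
  moreover have "series_of (lists S) ?d ?w = 1 + series_of (lists S - {[]}) ?d ?w"
  proof (rule fps_ext)
    fix n
    have s: "{xs \<in> lists S. ?d xs = n} = (if n = 0 then {[]} else {}) \<union> {xs \<in> lists S - {[]}. ?d xs = n}" by auto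
    have f: "finite {xs \<in> lists S - {[]}. ?d xs = n}"
      using fib by (rule_tac finite_subset[of _ "{xs \<in> lists S. ?d xs = n}"]) (auto simp: finite_fibres_def)
    show "series_of (lists S) ?d ?w $ n = (1 + series_of (lists S - {[]}) ?d ?w) $ n"
      unfolding series_of_nth s using f by (subst sum.union_disjoint) (auto simp: series_of_nth)
  qed
  ultimately show "(1 - series_of S d w) * series_of (lists S) ?d ?w = 1" by (simp add: algebra_simps)
qed

lemma fps_sums_coeff:
  fixes F :: "nat \<Rightarrow> 'r::comm_ring_1 fps"
  assumes "\<And>k n. n < k \<Longrightarrow> F k $ n = 0"
  shows "F sums Abs_fps (\<lambda>n. \<Sum>k\<le>n. F k $ n)"
  unfolding sums_def
proof (rule tendsto_fpsI)
  fix n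
  have "(\<Sum>k<N. F k) $ n = (\<Sum>k\<le>n. F k $ n)" if "Suc n \<le> N" for N
    unfolding fps_sum_nth using that assms by (intro sum.mono_neutral_right) auto
  then show "\<forall>\<^sub>F N in sequentially. (\<Sum>k<N. F k) $ n = Abs_fps (\<lambda>n. \<Sum>k\<le>n. F k $ n) $ n"
    unfolding eventually_sequentially by auto
qed

lemma fps_power_nth_zero:
  fixes a :: "'r::comm_ring_1 fps"
  assumes "a $ 0 = 0" "n < k"
  shows "a ^ k $ n = 0"
  using assms(2)
proof (induction k arbitrary: n)
  case (Suc k)
  have "a $ i * a ^ k $ (n - i) = 0" if "i \<in> {0..n}" for i
    using assms(1) Suc that by (cases "i = 0") auto
  then show ?case by (simp add: fps_mult_nth)
qed simp

text \<open>Telescoping shows that the partial sums differ from \<open>W\<close> by the multiple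
  \<open>(1 - Y)^N * W\<close>, which vanishes below degree \<open>N\<close>.\<close>

lemma geometric_inverse_eq:
  fixes Y W :: hck_hat
  assumes "Y $ 0 = 1" "Y * W = 1"
  shows "geometric_inverse Y = W"
proof -
  let ?Z = "1 - Y"
  have z: "?Z ^ k $ n = 0" if "n < k" for k n using assms(1) that by (intro fps_power_nth_zero) auto
  have partial: "(\<Sum>k<N. ?Z ^ k) = W - ?Z ^ N * W" for N
  proof -
    have "Y * (\<Sum>k<N. ?Z ^ k) = 1 - ?Z ^ N" using one_diff_power_eq[of ?Z N] by simp
    then have *: "W * (Y * (\<Sum>k<N. ?Z ^ k)) = W * (1 - ?Z ^ N)" by simp
    have "(Y * W) * (\<Sum>k<N. ?Z ^ k) = W * (Y * (\<Sum>k<N. ?Z ^ k))" by (simp only: mult_ac)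
    also note *
    also have "W * (1 - ?Z ^ N) = W - ?Z ^ N * W" by (simp add: right_diff_distrib mult.commute)
    finally have "(Y * W) * (\<Sum>k<N. ?Z ^ k) = W - ?Z ^ N * W" .
    then show ?thesis using assms(2) by simp
  qed
  have "(\<lambda>k. ?Z ^ k) sums W" unfolding sums_def
  proof (rule tendsto_fpsI)
    fix n
    have "(\<Sum>k<N. ?Z ^ k) $ n = W $ n" if "Suc n \<le> N" for N
    proof -
      have "(?Z ^ N * W) $ n = 0"
        unfolding fps_mult_nth using z that by (intro sum.neutral) auto
      then show ?thesis unfolding partial by simp
    qed
    then show "\<forall>\<^sub>F N in sequentially. (\<Sum>k<N. ?Z ^ k) $ n = W $ n"
      unfolding eventually_sequentially by blast
  qed
  then show ?thesis unfolding geometric_inverse_def by (rule sums_unique[symmetric])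
qed

text \<open>The library states the multiplicativity of composition for integral domains only.\<close>

lemma fps_compose_upto:
  fixes a b :: "'r::comm_ring_1 fps"
  assumes "b $ 0 = 0" "n \<le> N"
  shows "(a oo b) $ n = (\<Sum>i\<le>N. fps_const (a $ i) * b ^ i) $ n"
proof -
  have "(\<Sum>i\<le>N. a $ i * b ^ i $ n) = (\<Sum>i\<in>{0..n}. a $ i * b ^ i $ n)"
    using assms fps_power_nth_zero[OF assms(1)] by (intro sum.mono_neutral_right) auto
  then show ?thesis by (simp add: fps_compose_nth fps_sum_nth)
qed

lemma fps_compose_mult:
  fixes a b c :: "'r::comm_ring_1 fps"
  assumes "b $ 0 = 0"
  shows "(a * c) oo b = (a oo b) * (c oo b)"
proof (rule fps_ext)
  fix n
  let ?A = "\<Sum>i\<le>n. fps_const (a $ i) * b ^ i" and ?C = "\<Sum>j\<le>n. fps_const (c $ j) * b ^ j"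
  have "((a oo b) * (c oo b)) $ n = (?A * ?C) $ n"
    unfolding fps_mult_nth[of "a oo b"] fps_mult_nth[of ?A]
    by (rule sum.cong) (simp_all add: fps_compose_upto[OF assms, of _ n])
  also have "?A * ?C = (\<Sum>(i, j)\<in>{..n} \<times> {..n}. fps_const (a $ i * c $ j) * b ^ (i + j))"
    by (simp add: sum_product sum.cartesian_product power_add mult_ac flip: fps_const_mult)
  also have "\<dots> $ n = (\<Sum>(i, j)\<in>{..n} \<times> {..n}. a $ i * c $ j * b ^ (i + j) $ n)"
    by (simp add: fps_sum_nth case_prod_unfold)
  \<comment> \<open>Terms with \<open>i + j > n\<close> vanish because \<open>b\<close> has no
    constant term.\<close>
  also have "\<dots> = (\<Sum>(i, j)\<in>{(i, j). i + j \<le> n}. a $ i * c $ j * b ^ (i + j) $ n)"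
  proof (intro sum.mono_neutral_right ballI)
    fix x assume "x \<in> {..n} \<times> {..n} - {(i, j). i + j \<le> n}"
    then show "(case x of (i, j) \<Rightarrow> a $ i * c $ j * b ^ (i + j) $ n) = 0"
      using fps_power_nth_zero[OF assms, of n "fst x + snd x"] by auto
  qed auto
  also have "\<dots> = (\<Sum>k\<le>n. \<Sum>i\<le>k. a $ i * c $ (k - i) * b ^ k $ n)"
    by (subst sum.triangle_reindex_eq) simp
  also have "\<dots> = ((a * c) oo b) $ n"
    by (simp add: fps_compose_nth fps_mult_nth sum_distrib_right atLeast0AtMost)
  finally show "((a * c) oo b) $ n = ((a oo b) * (c oo b)) $ n" by simp
qed


section \<open>Linear extension of monoid homomorphisms\<close>

text \<open>Scalars act as multiplication by \<open>single 0 c\<close>, the form used by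
  \<open>coproduct\<close>, which becomes an instance by mere unfolding.\<close>

definition lin :: "('m \<Rightarrow> ('k::comm_monoid_add \<Rightarrow>\<^sub>0 rat)) \<Rightarrow> ('m \<Rightarrow>\<^sub>0 rat) \<Rightarrow> ('k \<Rightarrow>\<^sub>0 rat)" where
  "lin \<phi> p = (\<Sum>m\<in>Poly_Mapping.keys p. Poly_Mapping.single 0 (Poly_Mapping.lookup p m) * \<phi> m)"

lemma lin_add: "lin \<phi> (p + q) = lin \<phi> p + lin \<phi> q"
  unfolding lin_def
  by (rule setsum_keys_plus_distrib) (simp_all add: single_add distrib_right)

lemma lin_0: "lin \<phi> 0 = 0" by (simp add: lin_def)

lemma lin_sum: "lin \<phi> (\<Sum>i\<in>A. p i) = (\<Sum>i\<in>A. lin \<phi> (p i))"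
  by (induction A rule: infinite_finite_induct) (simp_all add: lin_0 lin_add)

lemma lin_single: "lin \<phi> (Poly_Mapping.single m c) = Poly_Mapping.single 0 c * \<phi> m"
  by (simp add: lin_def)

lemma poly_mapping_eq_sum:
  "(\<Sum>m\<in>Poly_Mapping.keys p. Poly_Mapping.single m (Poly_Mapping.lookup p m)) = p"
  by (rule poly_mapping_eqI)
    (simp add: lookup_sum lookup_single when_def in_keys_iff)

definition ring_map :: "('a::comm_ring_1 \<Rightarrow> 'b::comm_ring_1) \<Rightarrow> bool" where
  "ring_map \<eta> \<longleftrightarrow> (\<forall>p q. \<eta> (p + q) = \<eta> p + \<eta> q) \<and> (\<forall>p q. \<eta> (p * q) = \<eta> p * \<eta> q) \<and> \<eta> 1 = 1"

lemma ring_mapD: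
  assumes "ring_map \<eta>"
  shows "\<eta> (p + q) = \<eta> p + \<eta> q" "\<eta> (p * q) = \<eta> p * \<eta> q" "\<eta> 1 = 1" "\<eta> 0 = 0"
    "\<eta> (p - q) = \<eta> p - \<eta> q" "\<eta> (p ^ n) = \<eta> p ^ n" "\<eta> (sum f A) = (\<Sum>a\<in>A. \<eta> (f a))"
proof -
  show 1: "\<eta> (p + q) = \<eta> p + \<eta> q" "\<eta> (p * q) = \<eta> p * \<eta> q" "\<eta> 1 = 1" for p q
    using assms by (auto simp: ring_map_def)
  show 0: "\<eta> 0 = 0" using 1(1)[of 0 0] by simp
  show "\<eta> (p - q) = \<eta> p - \<eta> q" using 1(1)[of "p - q" q] by (simp add: algebra_simps)
  show "\<eta> (p ^ n) = \<eta> p ^ n" by (induction n) (simp_all add: 1)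
  show "\<eta> (sum f A) = (\<Sum>a\<in>A. \<eta> (f a))" by (induction A rule: infinite_finite_induct) (simp_all add: 0 1)
qed

lemma lin_ring_map:
  fixes \<phi> :: "'m::comm_monoid_add \<Rightarrow> ('k::comm_monoid_add \<Rightarrow>\<^sub>0 rat)"
  assumes "\<phi> 0 = 1" "\<And>a b. \<phi> (a + b) = \<phi> a * \<phi> b"
  shows "ring_map (lin \<phi>)"
  unfolding ring_map_def
proof (intro conjI allI)
  show "lin \<phi> (p + q) = lin \<phi> p + lin \<phi> q" for p q by (rule lin_add)
  show "lin \<phi> 1 = 1" using lin_single[of \<phi> 0 1] assms(1) by simp
  fix p q :: "'m \<Rightarrow>\<^sub>0 rat"
  let ?s = "\<lambda>p m. Poly_Mapping.single m (Poly_Mapping.lookup p m)"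
  have s: "lin \<phi> (?s p a * ?s q b) = lin \<phi> (?s p a) * lin \<phi> (?s q b)" for a b
    unfolding mult_single lin_single assms(2)
    using mult_single[of "0::'k" "Poly_Mapping.lookup p a" 0 "Poly_Mapping.lookup q b"]
    by (simp add: mult_ac)
  have "lin \<phi> (p * q) = lin \<phi> ((\<Sum>a\<in>Poly_Mapping.keys p. ?s p a) * (\<Sum>b\<in>Poly_Mapping.keys q. ?s q b))"
    by (simp add: poly_mapping_eq_sum)
  also have "\<dots> = lin \<phi> (\<Sum>a\<in>Poly_Mapping.keys p. ?s p a) * lin \<phi> (\<Sum>b\<in>Poly_Mapping.keys q. ?s q b)"
    unfolding sum_product lin_sum s ..
  finally show "lin \<phi> (p * q) = lin \<phi> p * lin \<phi> q" by (simp add: poly_mapping_eq_sum)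
qed

definition fps_map :: "('a::zero \<Rightarrow> 'b::zero) \<Rightarrow> 'a fps \<Rightarrow> 'b fps" where
  "fps_map \<eta> Y = Abs_fps (\<lambda>n. \<eta> (Y $ n))"

lemma fps_map_nth: "fps_map \<eta> Y $ n = \<eta> (Y $ n)" by (simp add: fps_map_def)

lemma fps_map_ring_map:
  assumes "ring_map \<eta>"
  shows "ring_map (fps_map \<eta>)"
  unfolding ring_map_def
  by (auto intro!: fps_ext simp: fps_map_nth fps_mult_nth ring_mapD[OF assms])

text \<open>The embeddings of the algebra as left and right tensor factor. Both are ring
  homomorphisms, which turns tensors into products in a single commutative ring.\<close>

definition left_leg :: "hck \<Rightarrow> hck_tensor" where "left_leg = lin (\<lambda>a. Poly_Mapping.single (a, 0) 1)"
definition right_leg :: "hck \<Rightarrow> hck_tensor" where "right_leg = lin (\<lambda>b. Poly_Mapping.single (0, b) 1)"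

lemma left_leg: "ring_map left_leg" and right_leg: "ring_map right_leg"
proof -
  have z: "((0::ck_generator multiset), (0::ck_generator multiset)) = 0" by (simp add: zero_prod_def)
  show "ring_map left_leg" "ring_map right_leg"
    unfolding left_leg_def right_leg_def
    by (rule lin_ring_map; simp add: mult_single z)+
qed

lemma left_leg_single: "left_leg (Poly_Mapping.single a c) = Poly_Mapping.single (a, 0) c"
  and right_leg_single: "right_leg (Poly_Mapping.single b c) = Poly_Mapping.single (0, b) c"
  by (simp_all add: left_leg_def right_leg_def lin_single mult_single zero_prod_def)

lemma tensor_eq: "tensor p q = left_leg p * right_leg q"
proof -
  have "left_leg p * right_leg q =
      left_leg (\<Sum>a\<in>Poly_Mapping.keys p. Poly_Mapping.single a (Poly_Mapping.lookup p a)) *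
      right_leg (\<Sum>b\<in>Poly_Mapping.keys q. Poly_Mapping.single b (Poly_Mapping.lookup q b))"
    by (simp add: poly_mapping_eq_sum)
  also have "\<dots> = tensor p q"
    by (simp add: ring_mapD(7)[OF left_leg] ring_mapD(7)[OF right_leg] left_leg_single right_leg_single
        sum_product mult_single tensor_def)
  finally show ?thesis by simp
qed

lemma coproduct_eq_lin: "coproduct = lin coproduct_monomial"
  by (rule ext) (simp add: coproduct_def lin_def)

lemma coproduct_ring_map: "ring_map coproduct"
  unfolding coproduct_eq_lin by (rule lin_ring_map) (simp_all add: coproduct_monomial_def)

lemma coproduct_gen: "coproduct (ck_gen g) = coproduct_graph (rep_ck_generator g)"
  unfolding coproduct_eq_lin ck_gen_def lin_single by (simp add: coproduct_monomial_def)


section \<open>Homogeneous series\<close>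

definition homogeneous :: "('m \<Rightarrow> nat) \<Rightarrow> nat \<Rightarrow> ('m \<Rightarrow>\<^sub>0 rat) \<Rightarrow> bool" where
  "homogeneous deg n p \<longleftrightarrow> (\<forall>m \<in> Poly_Mapping.keys p. deg m = n)"

lemma homogeneous_single: "deg m = n \<Longrightarrow> homogeneous deg n (Poly_Mapping.single m c)"
  by (simp add: homogeneous_def)

lemma homogeneous_0: "homogeneous deg n 0" by (simp add: homogeneous_def)

lemma homogeneous_add: "homogeneous deg n p \<Longrightarrow> homogeneous deg n q \<Longrightarrow> homogeneous deg n (p + q)"
  using keys_add[of p q] by (auto simp: homogeneous_def)

lemma homogeneous_sum: "(\<And>i. i \<in> A \<Longrightarrow> homogeneous deg n (p i)) \<Longrightarrow> homogeneous deg n (\<Sum>i\<in>A. p i)"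
  by (induction A rule: infinite_finite_induct) (simp_all add: homogeneous_0 homogeneous_add)

lemma homogeneous_mult:
  fixes p q :: "'m::comm_monoid_add \<Rightarrow>\<^sub>0 rat"
  assumes "\<And>a b. deg (a + b) = deg a + deg b" "homogeneous deg i p" "homogeneous deg j q"
  shows "homogeneous deg (i + j) (p * q)"
  using keys_mult[of p q] assms by (fastforce simp: homogeneous_def)

lemma to_completion_homogeneous:
  assumes "homogeneous deg k p"
  shows "to_completion deg p $ n = (if n = k then p else 0)"
proof (cases "n = k")
  case True
  then have "{m. m \<in> Poly_Mapping.keys p \<and> deg m = n} = Poly_Mapping.keys p"
    using assms by (auto simp: homogeneous_def)
  then show ?thesis using True by (simp add: to_completion_def homogeneous_part_def poly_mapping_eq_sum)
next
  case False
  then have "{m. m \<in> Poly_Mapping.keys p \<and> deg m = n} = {}"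
    using assms by (auto simp: homogeneous_def)
  then show ?thesis using False by (simp only: to_completion_def homogeneous_part_def fps_nth_Abs_fps sum.empty if_False)
qed

definition graded :: "hck_hat \<Rightarrow> bool" where
  "graded Y \<longleftrightarrow> (\<forall>k. homogeneous monomial_degree k (Y $ k))"

lemma monomial_degree_add: "monomial_degree (a + b) = monomial_degree a + monomial_degree b"
  by (simp add: monomial_degree_def)

lemma tensor_degree_add: "tensor_degree (a + b) = tensor_degree a + tensor_degree b"
  by (cases a; cases b) (simp add: tensor_degree_def monomial_degree_add)

lemma graded_1: "graded 1"
  unfolding graded_def by (auto simp: homogeneous_def monomial_degree_def split: if_splits)

lemma graded_mult: "graded Y \<Longrightarrow> graded Z \<Longrightarrow> graded (Y * Z)"
  unfolding graded_def fps_mult_nth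
proof (intro allI homogeneous_sum)
  fix k i :: nat assume h: "\<forall>k. homogeneous monomial_degree k (Y $ k)" "\<forall>k. homogeneous monomial_degree k (Z $ k)"
    and i: "i \<in> {0..k}"
  have "homogeneous monomial_degree (i + (k - i)) (Y $ i * Z $ (k - i))"
    using h by (intro homogeneous_mult monomial_degree_add) auto
  then show "homogeneous monomial_degree k (Y $ i * Z $ (k - i))" using i by simp
qed

lemma graded_power: "graded Y \<Longrightarrow> graded (Y ^ n)"
  by (induction n) (simp_all add: graded_1 graded_mult)

lemma coproduct_graph_homogeneous: "homogeneous tensor_degree (gen_loops g) (coproduct_graph (rep_ck_generator g))"
proof -
  let ?G = "rep_ck_generator g"
  obtain n where n: "n = 2 \<or> n = 4" "n_point_generating n ?G"
    using generating_rep[of g] by (auto simp: generating_def)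
  \<comment> \<open>Any external half edge will do; a label merely gives access to the description
    by labelled classes.\<close>
  obtain h where "h \<in> external ?G" using n_point_generatingD(4)[OF n(2)] by (auto simp: single_boundary_def)
  then have l: "(?G, h) \<in> labelled n" using n(2) by (simp add: labelled_def)
  define L where "L = label_class n ?G h"
  have L: "L \<in> labelled_classes n" unfolding L_def by (rule label_class_in[OF l])
  have fg: "forget_label L = g" unfolding L_def forget_label_class[OF l n(1)] by (rule abs_rep_ck_generator)
  then have G: "?G = class_graph L" by (simp add: class_graph_def)
  have deg: "monomial_degree (deco_sum (\<lambda>g. {#g#}) \<Gamma> d) = deco_sum gen_loops \<Gamma> d" for \<Gamma> d
  proof -
    have s: "monomial_degree (\<Sum>x\<in>A. f x) = (\<Sum>x\<in>A. monomial_degree (f x))" for A :: "'x set" and f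
      by (induction A rule: infinite_finite_induct) (simp_all add: monomial_degree_add, simp_all add: monomial_degree_def)
    have l: "monomial_degree (\<Sum>x\<leftarrow>xs. {#forget_label x#}) = (\<Sum>x\<leftarrow>xs. gen_loops (forget_label x))" for xs
      by (induction xs) (simp_all add: monomial_degree_def)
    have o: "monomial_degree {#g#} = gen_loops g" for g by (simp add: monomial_degree_def)
    show ?thesis by (cases d) (simp only: deco_sum_def prod.case monomial_degree_add s l o)
  qed
  have "homogeneous tensor_degree (gen_loops g) (Poly_Mapping.single (graph_monomial H, graph_monomial (quotient_graph ?G H)) 1)"
    if H: "(L, H) \<in> inserted n" for H
  proof (rule homogeneous_single)
    obtain M d where D: "decompose n (L, H) = (M, d)" by (cases "decompose n (L, H)")
    note w = decompose_weights[OF n(1) H D, folded G, unfolded fg]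
    show "tensor_degree (graph_monomial H, graph_monomial (quotient_graph ?G H)) = gen_loops g"
      unfolding w(1,2) w(3) tensor_degree_def prod.case deg by (simp add: monomial_degree_def)
  qed
  moreover have "homogeneous tensor_degree (gen_loops g) (Poly_Mapping.single ({#g#}, {#}) 1)"
    by (rule homogeneous_single) (simp add: tensor_degree_def monomial_degree_def)
  ultimately show ?thesis
    unfolding G coproduct_graph_class[OF n(1) L] unfolding fg
    by (intro homogeneous_add homogeneous_sum) (auto simp: homogeneous_0 G)
qed

lemma coproduct_homogeneous:
  assumes "homogeneous monomial_degree k p"
  shows "homogeneous tensor_degree k (coproduct p)"
proof -
  have m: "homogeneous tensor_degree (monomial_degree m) (coproduct_monomial m)" for m
  proof (induction m)
    case empty
    have "tensor_degree 0 = 0" by (simp add: tensor_degree_def zero_prod_def monomial_degree_def)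
    then have "homogeneous tensor_degree 0 (Poly_Mapping.single 0 1)" by (rule homogeneous_single)
    then show ?case by (simp add: coproduct_monomial_def monomial_degree_def)
  next
    case (add g m)
    have "homogeneous tensor_degree (gen_loops g + monomial_degree m)
        (coproduct_graph (rep_ck_generator g) * coproduct_monomial m)"
      by (rule homogeneous_mult[OF tensor_degree_add coproduct_graph_homogeneous add])
    then show ?case by (simp add: coproduct_monomial_def monomial_degree_def)
  qed
  have t0: "tensor_degree 0 = 0" by (simp add: tensor_degree_def zero_prod_def monomial_degree_def)
  have "homogeneous tensor_degree (0 + k) (Poly_Mapping.single 0 (Poly_Mapping.lookup p m) * coproduct_monomial m)"
    if "m \<in> Poly_Mapping.keys p" for m
    using assms that m[of m]
    by (intro homogeneous_mult tensor_degree_add homogeneous_single t0) (simp add: homogeneous_def)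
  then show ?thesis unfolding coproduct_def by (intro homogeneous_sum) simp
qed

text \<open>The coproduct respects the grading, so the k-th summand contributes to the k-th
  coefficient only and the continuous extension acts coefficientwise.\<close>

lemma coproduct_hat_graded: "graded Y \<Longrightarrow> coproduct_hat Y = fps_map coproduct Y"
proof -
  assume Y: "graded Y"
  let ?F = "\<lambda>k. to_completion tensor_degree (coproduct (Y $ k))"
  have F: "?F k $ n = (if n = k then coproduct (Y $ k) else 0)" for k n
    using Y by (intro to_completion_homogeneous coproduct_homogeneous) (simp add: graded_def)
  have "?F sums Abs_fps (\<lambda>n. \<Sum>k\<le>n. ?F k $ n)" by (rule fps_sums_coeff) (simp add: F)
  moreover have "(\<Sum>k\<le>n. ?F k $ n) = coproduct (Y $ n)" for n by (simp add: F)
  ultimately have "?F sums fps_map coproduct Y" by (simp add: fps_map_def)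
  then show ?thesis unfolding coproduct_hat_def by (rule sums_unique[symmetric])
qed

section \<open>The coproduct of the perturbative series\<close>

abbreviation class_loops :: "(nat ribbon_graph \<times> nat) set \<Rightarrow> nat" where
  "class_loops L \<equiv> gen_loops (forget_label L)"

abbreviation class_gen :: "(nat ribbon_graph \<times> nat) set \<Rightarrow> hck" where
  "class_gen L \<equiv> ck_gen (forget_label L)"

definition point_series :: "nat \<Rightarrow> hck_hat" where
  "point_series n = series_of (labelled_classes n) class_loops class_gen"

definition chain_series :: hck_hat where
  "chain_series = series_of (lists (labelled_classes 2)) (\<lambda>xs. \<Sum>L\<leftarrow>xs. class_loops L) (\<lambda>xs. \<Prod>L\<leftarrow>xs. class_gen L)"

lemma finite_fibres_classes: "n = 2 \<or> n = 4 \<Longrightarrow> finite_fibres (labelled_classes n) class_loops"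
  using finite_labelled_classes by (simp add: finite_fibres_def)

lemma class_counts:
  assumes "L \<in> labelled_classes n"
  shows "n = 4 \<Longrightarrow> card (vertices (class_graph L)) = Suc (class_loops L) \<and>
      card (internal_edges (class_graph L)) = 2 * class_loops L"
    "n = 2 \<Longrightarrow> card (vertices (class_graph L)) = class_loops L \<and>
      Suc (card (internal_edges (class_graph L))) = 2 * class_loops L"
proof -
  note d = labelledD(1)[OF class_graph(1)[OF assms]]
  show "n = 4 \<Longrightarrow> card (vertices (class_graph L)) = Suc (class_loops L) \<and>
      card (internal_edges (class_graph L)) = 2 * class_loops L"
    using n_point_generating_counts(1) d unfolding gen_loops_forget by blast
  show "n = 2 \<Longrightarrow> card (vertices (class_graph L)) = class_loops L \<and>
      Suc (card (internal_edges (class_graph L))) = 2 * class_loops L"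
    using n_point_generating_counts(2) d unfolding gen_loops_forget by blast
qed

lemma two_point_loops: "L \<in> labelled_classes 2 \<Longrightarrow> 0 < class_loops L"
  using class_counts(2)[of L 2] by (cases "class_loops L") auto

lemma point_series_2_0: "point_series 2 $ 0 = 0"
proof -
  have "{L. L \<in> labelled_classes 2 \<and> class_loops L = 0} = {}" using two_point_loops by fastforce
  then show ?thesis unfolding point_series_def series_of_nth by (simp only: sum.empty)
qed

lemma X_e_eq: "X_e = 1 - point_series 2"
  by (simp add: X_e_def point_series_def series_of_def)

lemma X_v_eq: "X_v = point_series 4"
proof (rule fps_ext)
  fix n
  let ?v = "label_class 4 vertex_graph 0"
  have g: "generating vertex_graph" using vertex_graph_generating by (auto simp: generating_def)
  have "card (half_edges vertex_graph) = 4" by (simp add: vertex_graph_def)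
  then have "loop_order vertex_graph = 0" using n_point_generatingD(7)[OF vertex_graph_generating] by simp
  then have v0: "gen_loops ck_v = 0" using gen_loops_abs[OF g] by (simp add: ck_v_def)
  have v: "?v \<in> labelled_classes 4" "forget_label ?v = ck_v"
    and vu: "\<And>L. L \<in> labelled_classes 4 \<Longrightarrow> forget_label L = ck_v \<Longrightarrow> L = ?v"
    using forget_label_eq_ck_v by auto
  have fin: "finite {L \<in> labelled_classes 4. class_loops L = n}" by (rule finite_labelled_classes) simp
  let ?A = "{L. L \<in> labelled_classes 4 \<and> forget_label L \<noteq> ck_v \<and> class_loops L = n}"
  have s: "{L. L \<in> labelled_classes 4 \<and> class_loops L = n} = ?A \<union> (if n = 0 then {?v} else {})"
  proof (rule set_eqI)
    fix L
    show "L \<in> {L. L \<in> labelled_classes 4 \<and> class_loops L = n} \<longleftrightarrow> L \<in> ?A \<union> (if n = 0 then {?v} else {})"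
    proof (cases "L \<in> labelled_classes 4 \<and> forget_label L = ck_v")
      case True
      then have "L = ?v" using vu by blast
      then show ?thesis using v v0 by auto
    next
      case False
      then have "L \<noteq> ?v" using v by blast
      then show ?thesis using False by auto
    qed
  qed
  have "point_series 4 $ n = (\<Sum>L\<in>?A. class_gen L) + (\<Sum>L\<in>(if n = 0 then {?v} else {}). class_gen L)"
    unfolding point_series_def series_of_nth s
  proof (rule sum.union_disjoint)
    show "finite ?A" by (rule finite_subset[OF _ fin]) blast
  qed (use v in \<open>auto split: if_splits\<close>)
  also have "(\<Sum>L\<in>(if n = 0 then {?v} else {}). class_gen L) = to_completion monomial_degree (ck_gen ck_v) $ n"
  proof -
    have "homogeneous monomial_degree 0 (ck_gen ck_v)"
      unfolding ck_gen_def by (rule homogeneous_single) (simp add: monomial_degree_def v0)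
    then show ?thesis using v(2) by (simp add: to_completion_homogeneous)
  qed
  finally show "X_v $ n = point_series 4 $ n" by (simp add: X_v_def)
qed

lemma X_e_chain: "X_e * chain_series = 1"
  unfolding X_e_eq point_series_def chain_series_def
  using series_of_lists(2)[OF finite_fibres_classes[OF disjI1[OF refl]] two_point_loops] .

lemma geometric_inverse_X_e: "geometric_inverse X_e = chain_series"
  by (rule geometric_inverse_eq) (simp_all add: X_e_chain, simp add: X_e_eq point_series_2_0)

lemma graded_point_series: "graded (point_series n)"
  unfolding graded_def point_series_def series_of_nth ck_gen_def
  by (auto intro!: homogeneous_sum homogeneous_single simp: monomial_degree_def)

lemma graded_X_v: "graded X_v"
  unfolding X_v_eq by (rule graded_point_series)

lemma prod_list_ck_gen:
  "(\<Prod>L\<leftarrow>xs. class_gen L) = Poly_Mapping.single (\<Sum>L\<leftarrow>xs. {#forget_label L#}) 1"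
  by (induction xs) (simp_all add: ck_gen_def mult_single del: add_mset_add_single flip: zero_multiset_def)

lemma graded_chain_series: "graded chain_series"
proof -
  have "monomial_degree (\<Sum>L\<leftarrow>xs. {#forget_label L#}) = (\<Sum>L\<leftarrow>xs. class_loops L)" for xs
    by (induction xs) (simp_all add: monomial_degree_def)
  then show ?thesis
    unfolding graded_def chain_series_def series_of_nth prod_list_ck_gen
    by (auto intro!: homogeneous_sum homogeneous_single)
qed

lemma prod_single_one:
  "(\<Prod>i\<in>I. Poly_Mapping.single (m i) (1::rat)) = Poly_Mapping.single (\<Sum>i\<in>I. m i) 1"
  by (induction I rule: infinite_finite_induct) (simp_all add: mult_single)

lemma decoration_series:
  assumes "finite (vertices \<Gamma>)" "finite (internal_edges \<Gamma>)"
  shows "series_of (decorations \<Gamma>) (deco_sum gen_loops \<Gamma>)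
      (\<lambda>d. Poly_Mapping.single (deco_sum (\<lambda>g. {#g#}) \<Gamma> d) 1) =
      point_series 4 ^ card (vertices \<Gamma>) * chain_series ^ card (internal_edges \<Gamma>)"
    "finite_fibres (decorations \<Gamma>) (deco_sum gen_loops \<Gamma>)"
proof -
  have f4: "finite_fibres (labelled_classes 4) class_loops"
    and f2: "finite_fibres (labelled_classes 2) class_loops" using finite_fibres_classes by auto
  note fl = series_of_lists(1)[OF f2 two_point_loops]
  note v = series_of_PiE[OF assms(1) f4] and e = series_of_PiE[OF assms(2) fl]
  have v1: "point_series 4 ^ card (vertices \<Gamma>) = series_of (vertices \<Gamma> \<rightarrow>\<^sub>E labelled_classes 4)
      (\<lambda>\<omega>. \<Sum>c\<in>vertices \<Gamma>. class_loops (\<omega> c)) (\<lambda>\<omega>. \<Prod>c\<in>vertices \<Gamma>. class_gen (\<omega> c))"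
    unfolding point_series_def by (rule v(1))
  have e1: "chain_series ^ card (internal_edges \<Gamma>) = series_of (internal_edges \<Gamma> \<rightarrow>\<^sub>E lists (labelled_classes 2))
      (\<lambda>l. \<Sum>e\<in>internal_edges \<Gamma>. \<Sum>L\<leftarrow>l e. class_loops L)
      (\<lambda>l. \<Prod>e\<in>internal_edges \<Gamma>. \<Prod>L\<leftarrow>l e. class_gen L)"
    unfolding chain_series_def by (rule series_of_PiE(1)[OF assms(2) fl])
  have d: "deco_sum gen_loops \<Gamma> = (\<lambda>(\<omega>, l). (\<Sum>c\<in>vertices \<Gamma>. class_loops (\<omega> c)) +
      (\<Sum>e\<in>internal_edges \<Gamma>. \<Sum>L\<leftarrow>l e. class_loops L))"
    by (simp add: deco_sum_def)
  have w: "(\<lambda>d. Poly_Mapping.single (deco_sum (\<lambda>g. {#g#}) \<Gamma> d) (1::rat)) =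
      (\<lambda>(\<omega>, l). (\<Prod>c\<in>vertices \<Gamma>. class_gen (\<omega> c)) * (\<Prod>e\<in>internal_edges \<Gamma>. \<Prod>L\<leftarrow>l e. class_gen L))"
    unfolding prod_list_ck_gen unfolding ck_gen_def prod_single_one
    by (simp add: fun_eq_iff deco_sum_def mult_single)
  show "finite_fibres (decorations \<Gamma>) (deco_sum gen_loops \<Gamma>)"
    unfolding decorations_def d by (rule series_of_mult(2)[OF v(2) e(2)])
  show "series_of (decorations \<Gamma>) (deco_sum gen_loops \<Gamma>)
      (\<lambda>d. Poly_Mapping.single (deco_sum (\<lambda>g. {#g#}) \<Gamma> d) 1) =
      point_series 4 ^ card (vertices \<Gamma>) * chain_series ^ card (internal_edges \<Gamma>)"
    unfolding decorations_def d w v1 e1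
    by (rule series_of_mult(1)[OF v(2) e(2), symmetric])
qed

text \<open>The numbers of vertices and edges depend on the loop order alone, so all
  \<open>M\<close> with \<open>k\<close> loops have the same series of decorations and it factors
  out of the sum over them.\<close>

lemma insertion_sum:
  assumes n: "n = 2 \<or> n = 4"
    and V: "\<And>M. M \<in> labelled_classes n \<Longrightarrow> card (vertices (class_graph M)) = V (class_loops M)"
    and E: "\<And>M. M \<in> labelled_classes n \<Longrightarrow> card (internal_edges (class_graph M)) = E (class_loops M)"
  shows "(\<Sum>b | b \<in> insertions n \<and> insertion_loops b = N. Poly_Mapping.single (insertion_term b) 1) =
    (\<Sum>k\<le>N. left_leg ((point_series 4 ^ V k * chain_series ^ E k) $ (N - k)) * right_leg (point_series n $ k))"
proof -
  let ?S = "{M \<in> labelled_classes n. class_loops M \<le> N}"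
  let ?D = "\<lambda>M. {d \<in> decorations (class_graph M). deco_sum gen_loops (class_graph M) d = N - class_loops M}"
  let ?m = "\<lambda>M d. deco_sum (\<lambda>g. {#g#}) (class_graph M) d"
  let ?W = "\<lambda>k. point_series 4 ^ V k * chain_series ^ E k"
  have finS: "finite ?S" by (rule finite_fibres_le[OF finite_fibres_classes[OF n]])
  have fin: "finite (vertices (class_graph M))" "finite (internal_edges (class_graph M))"
    if "M \<in> labelled_classes n" for M
    using finite_vertices finite_internal_edges labelledD(4)[OF class_graph(1)[OF that n]] by blast+
  have finD: "finite (?D M)" if "M \<in> ?S" for M
    using decoration_series(2)[OF fin] that by (auto simp: finite_fibres_def)
  have "{b. b \<in> insertions n \<and> insertion_loops b = N} = Sigma ?S ?D"
    by (auto simp: insertions_def insertion_loops_def)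
  then have "(\<Sum>b | b \<in> insertions n \<and> insertion_loops b = N. Poly_Mapping.single (insertion_term b) (1::rat)) =
      (\<Sum>(M, d)\<in>Sigma ?S ?D. Poly_Mapping.single (insertion_term (M, d)) 1)"
    by (simp add: case_prod_unfold)
  also have "\<dots> = (\<Sum>M\<in>?S. \<Sum>d\<in>?D M. Poly_Mapping.single (insertion_term (M, d)) 1)"
    using finS finD by (intro sum.Sigma[symmetric]) auto
  also have "\<dots> = (\<Sum>M\<in>?S. left_leg (?W (class_loops M) $ (N - class_loops M)) * right_leg (class_gen M))"
  proof (rule sum.cong[OF refl])
    fix M assume M: "M \<in> ?S"
    have W: "?W (class_loops M) $ (N - class_loops M) = (\<Sum>d\<in>?D M. Poly_Mapping.single (?m M d) 1)"
      using decoration_series(1)[OF fin] M V E by (simp flip: series_of_nth)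
    show "(\<Sum>d\<in>?D M. Poly_Mapping.single (insertion_term (M, d)) 1) =
        left_leg (?W (class_loops M) $ (N - class_loops M)) * right_leg (class_gen M)"
      unfolding W ring_mapD(7)[OF left_leg] sum_distrib_right
      by (simp add: left_leg_single right_leg_single ck_gen_def mult_single insertion_term_def)
  qed
  also have "\<dots> = (\<Sum>k\<le>N. \<Sum>M\<in>{M \<in> ?S. class_loops M = k}.
      left_leg (?W (class_loops M) $ (N - class_loops M)) * right_leg (class_gen M))"
    using finS by (intro sum.group[symmetric]) auto
  also have "\<dots> = (\<Sum>k\<le>N. left_leg (?W k $ (N - k)) * right_leg (point_series n $ k))"
  proof (rule sum.cong[OF refl])
    fix k assume "k \<in> {..N}"
    then have "{M \<in> ?S. class_loops M = k} = {M. M \<in> labelled_classes n \<and> class_loops M = k}" by auto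
    then show "(\<Sum>M\<in>{M \<in> ?S. class_loops M = k}.
        left_leg (?W (class_loops M) $ (N - class_loops M)) * right_leg (class_gen M)) =
      left_leg (?W k $ (N - k)) * right_leg (point_series n $ k)"
      by (simp add: point_series_def series_of_nth ring_mapD(7)[OF right_leg] sum_distrib_left)
  qed
  finally show ?thesis .
qed

lemma coproduct_point_series:
  "coproduct (point_series n $ N) =
    (\<Sum>L | L \<in> labelled_classes n \<and> class_loops L = N. coproduct_graph (class_graph L))"
  by (simp add: point_series_def series_of_nth ring_mapD(7)[OF coproduct_ring_map] coproduct_gen class_graph_def)

text \<open>\<open>twist u Y\<close> is the right-hand side \<open>\<Sum>k. Y u\<^sup>k \<otimes> Y\<^sub>k\<close>, written so that it is visibly multiplicative
  in \<open>Y\<close>: \<open>Y \<otimes> 1\<close> times the result of substituting \<open>u \<otimes> 1\<close> for the loop counting variable of \<open>1 \<otimes> Y\<close>.\<close>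

definition twist :: "hck_hat \<Rightarrow> hck_hat \<Rightarrow> hck_tensor_hat" where
  "twist u Y = fps_map left_leg Y * (fps_map right_leg Y oo (fps_map left_leg u * fps_X))"

lemma twist_mult: "twist u (Y * Z) = twist u Y * twist u Z"
proof -
  have V: "(fps_map left_leg u * fps_X) $ 0 = 0" by (simp add: fps_mult_nth)
  show ?thesis
    unfolding twist_def ring_mapD(2)[OF fps_map_ring_map[OF left_leg]]
      ring_mapD(2)[OF fps_map_ring_map[OF right_leg]] fps_compose_mult[OF V]
    by (simp only: mult_ac)
qed

lemma twist_1: "twist u 1 = 1"
  by (simp add: twist_def ring_mapD(3)[OF fps_map_ring_map[OF left_leg]]
      ring_mapD(3)[OF fps_map_ring_map[OF right_leg]])

lemma twist_power: "twist u (Y ^ n) = twist u Y ^ n"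
  by (induction n) (simp_all add: twist_1 twist_mult)

lemma twist_nth: "twist u Y $ n = (\<Sum>k\<le>n. left_leg ((Y * u ^ k) $ (n - k)) * right_leg (Y $ k))"
proof -
  let ?V = "fps_map left_leg u * fps_X"
  note l = ring_mapD[OF fps_map_ring_map[OF left_leg]]
  have V: "?V $ 0 = 0" by (simp add: fps_mult_nth)
  let ?C = "\<Sum>k\<le>n. fps_const (right_leg (Y $ k)) * ?V ^ k"
  have "twist u Y $ n = (fps_map left_leg Y * ?C) $ n"
    unfolding twist_def fps_mult_nth
    by (rule sum.cong) (simp_all add: fps_compose_upto[OF V, of _ n] fps_map_nth)
  also have "fps_map left_leg Y * ?C =
      (\<Sum>k\<le>n. fps_const (right_leg (Y $ k)) * (fps_map left_leg (Y * u ^ k) * fps_X ^ k))"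
    unfolding sum_distrib_left l(2) l(6) power_mult_distrib by (simp only: mult_ac)
  also have "\<dots> $ n = (\<Sum>k\<le>n. left_leg ((Y * u ^ k) $ (n - k)) * right_leg (Y $ k))"
    unfolding fps_sum_nth
    by (rule sum.cong) (simp_all add: fps_X_power_mult_nth fps_X_power_mult_right_nth fps_map_nth mult.commute)
  finally show ?thesis .
qed

text \<open>The right factor is concentrated in degree \<open>k\<close>, so the k-th summand starts
  in degree \<open>k\<close> and every coefficient of the sum is finite.\<close>

lemma tensor_sums_twist: "(\<lambda>k. tensor_hat (Y * u ^ k) (loop_component k Y)) sums twist u Y"
proof -
  let ?F = "\<lambda>k. tensor_hat (Y * u ^ k) (loop_component k Y)"
  have F: "?F k $ n = (if k \<le> n then left_leg ((Y * u ^ k) $ (n - k)) * right_leg (Y $ k) else 0)" for k n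
  proof -
    have "?F k $ n = (\<Sum>i\<le>n. if n - i = k then left_leg ((Y * u ^ k) $ i) * right_leg (Y $ k) else 0)"
      unfolding tensor_hat_def loop_component_def fps_nth_Abs_fps tensor_eq
      by (rule sum.cong) (simp_all add: ring_mapD(4)[OF right_leg])
    also have "\<dots> = (\<Sum>i\<le>n. if i = n - k \<and> k \<le> n then left_leg ((Y * u ^ k) $ i) * right_leg (Y $ k) else 0)"
      by (rule sum.cong) auto
    also have "\<dots> = (if k \<le> n then left_leg ((Y * u ^ k) $ (n - k)) * right_leg (Y $ k) else 0)"
      by (cases "k \<le> n") simp_all
    finally show ?thesis .
  qed
  have "?F sums Abs_fps (\<lambda>n. \<Sum>k\<le>n. ?F k $ n)" by (rule fps_sums_coeff) (simp add: F)
  also have "Abs_fps (\<lambda>n. \<Sum>k\<le>n. ?F k $ n) = twist u Y"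
    by (rule fps_ext) (simp add: F twist_nth)
  finally show ?thesis .
qed

text \<open>One more loop in \<Gamma> means one more vertex and two more internal edges, for 2-point
  and 4-point graphs alike.\<close>

abbreviation (input) insertion_weight :: hck_hat where
  "insertion_weight \<equiv> X_v * geometric_inverse X_e ^ 2"

lemma coproduct_X_v: "fps_map coproduct X_v = twist insertion_weight X_v"
proof (rule fps_ext)
  fix N
  have "coproduct (X_v $ N) =
      (\<Sum>k\<le>N. left_leg ((point_series 4 ^ Suc k * chain_series ^ (2 * k)) $ (N - k)) * right_leg (point_series 4 $ k))"
    unfolding X_v_eq coproduct_point_series
    using coproduct_classes(1)[of 4 N] insertion_sum[of 4 Suc "\<lambda>k. 2 * k" N] class_counts(1) by simp
  also have "\<dots> = twist insertion_weight X_v $ N"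
    unfolding twist_nth geometric_inverse_X_e X_v_eq
    by (simp only: power_mult_distrib power_mult power_Suc mult.assoc)
  finally show "fps_map coproduct X_v $ N = twist insertion_weight X_v $ N" by (simp add: fps_map_nth)
qed

text \<open>For k > 0 one factor 1/X^e is cancelled, which leaves the exponent 2k - 1, and the
  coefficient of X^e is minus that of the 2-point series. The term k = 0 combines the constant 1
  with the contributions of \<open>H = G\<close>.\<close>

lemma coproduct_X_e: "fps_map coproduct X_e = twist insertion_weight X_e"
proof (rule fps_ext)
  fix N
  \<comment> \<open>At \<open>k = 0\<close> the exponent \<open>2 * k - 1\<close> is truncated to 0;
    this is harmless since the 2-point series has no coefficient in degree 0.\<close>
  let ?W = "\<lambda>k. point_series 4 ^ k * chain_series ^ (2 * k - 1)"
  let ?T = "\<lambda>k. left_leg (?W k $ (N - k)) * right_leg (point_series 2 $ k)"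
  have "card (internal_edges (class_graph M)) = 2 * class_loops M - 1" if "M \<in> labelled_classes 2" for M
    using class_counts(2)[OF that refl] by linarith
  then have i: "(\<Sum>b | b \<in> insertions 2 \<and> insertion_loops b = N. Poly_Mapping.single (insertion_term b) 1) = (\<Sum>k\<le>N. ?T k)"
    using insertion_sum[of 2 "\<lambda>k. k" "\<lambda>k. 2 * k - 1" N] class_counts(2) by simp
  have "(\<Sum>L | L \<in> labelled_classes 2 \<and> class_loops L = N. Poly_Mapping.single ({#forget_label L#}, {#}) 1)
      = left_leg (point_series 2 $ N)"
    by (simp add: point_series_def series_of_nth ring_mapD(7)[OF left_leg] ck_gen_def left_leg_single)
  then have c: "coproduct (point_series 2 $ N) = (\<Sum>k\<le>N. ?T k) + left_leg (point_series 2 $ N)"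
    unfolding coproduct_point_series using coproduct_classes(1)[of 2 N] i by simp
  note m = ring_mapD[OF coproduct_ring_map] and l = ring_mapD[OF left_leg] and r = ring_mapD[OF right_leg]
  have X: "X_e $ k = (if k = 0 then 1 else 0) - point_series 2 $ k" for k by (simp add: X_e_eq)
  have Xl: "coproduct (X_e $ N) = left_leg (X_e $ N) - (\<Sum>k\<le>N. ?T k)"
    unfolding X m(5) l(5) c by (simp add: m(3,4) l(3,4))
  have t: "left_leg ((X_e * insertion_weight ^ k) $ (N - k)) * right_leg (X_e $ k) =
      (if k = 0 then left_leg (X_e $ N) else 0) - ?T k" for k
  proof (cases k)
    case 0
    then show ?thesis by (simp add: X[of 0] point_series_2_0 r(3,4))
  next
    case (Suc j)
    have "insertion_weight ^ k = point_series 4 ^ k * chain_series ^ (2 * k)"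
      unfolding geometric_inverse_X_e X_v_eq by (simp only: power_mult_distrib power_mult)
    also have "chain_series ^ (2 * k) = chain_series * chain_series ^ (2 * k - 1)"
      by (simp add: Suc)
    finally have "X_e * insertion_weight ^ k = (X_e * chain_series) * ?W k"
      by (simp only: mult_ac)
    then have "X_e * insertion_weight ^ k = ?W k" by (simp add: X_e_chain)
    moreover have "right_leg (X_e $ k) = - right_leg (point_series 2 $ k)"
      using r(5)[of 0 "point_series 2 $ k"] r(4) by (simp add: X Suc)
    ultimately show ?thesis using Suc by simp
  qed
  have "twist insertion_weight X_e $ N = left_leg (X_e $ N) - (\<Sum>k\<le>N. ?T k)"
    unfolding twist_nth t sum_subtractf by simp
  then show "fps_map coproduct X_e $ N = twist insertion_weight X_e $ N" using Xl by (simp add: fps_map_nth)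
qed

unbundle no fps_syntax

theorem proposition19:
  fixes n1 n2 :: nat and f :: hck_hat
  assumes "f = X_v ^ n1 * geometric_inverse X_e ^ n2"
  shows "(\<lambda>k. tensor_hat (f * (X_v * geometric_inverse X_e ^ 2) ^ k) (loop_component k f))
           sums coproduct_hat f"
proof -
  let ?G = "geometric_inverse X_e" and ?u = "insertion_weight"
  note c = ring_mapD[OF fps_map_ring_map[OF coproduct_ring_map]]
  have inv: "X_e * ?G = 1" unfolding geometric_inverse_X_e by (rule X_e_chain)
  \<comment> \<open>The coproduct and \<open>twist\<close> are multiplicative and agree on
    \<open>X_e\<close>, so they send its inverse to inverses of the same element, and these
    coincide.\<close>
  have 1: "twist ?u X_e * fps_map coproduct ?G = 1"
    using c(2)[of X_e ?G] c(3) inv by (simp add: coproduct_X_e)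
  have 2: "twist ?u X_e * twist ?u ?G = 1"
    using twist_mult[of ?u X_e ?G] inv by (simp add: twist_1)
  have "fps_map coproduct ?G = fps_map coproduct ?G * (twist ?u X_e * twist ?u ?G)" using 2 by simp
  also have "\<dots> = (twist ?u X_e * fps_map coproduct ?G) * twist ?u ?G" by (simp only: mult_ac)
  finally have G: "fps_map coproduct ?G = twist ?u ?G" using 1 by simp
  have "fps_map coproduct f = twist ?u f"
    unfolding assms c(2) c(6) twist_mult twist_power G coproduct_X_v ..
  moreover have "graded f" unfolding assms geometric_inverse_X_e
    by (intro graded_mult graded_power graded_X_v graded_chain_series)
  ultimately have "coproduct_hat f = twist ?u f" by (simp add: coproduct_hat_graded)
  then show ?thesis using tensor_sums_twist by simp
qed

end
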